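(* Let algorithm QARSTA (described in the context) be applied to $f:\mathbb{R}^n\to\mathbb{R}$, and suppose: (1) $f\in\mathcal{C}^{2+}$ with Lipschitz constant $L_{\nabla^2 f}$; (2) $f$ is bounded below by $f_{low}$; (3) $\|\nabla^2\widehat m_k\|\le\kappa_H$ for all $k$, where $\kappa_H\ge1$ is independent of $k$; (4) all solutions $\widehat s_k$ of the trust-region subproblem satisfy $\widehat m_k(\mathbf 0)-\widehat m_k(\widehat s_k)\ge c_1\|\nabla\widehat m_k(\mathbf 0)\|\min\left(\Delta_k,\frac{\|\nabla\widehat m_k(\mathbf 0)\|}{\max\{\|\nabla^2\widehat m_k\|,1\}}\right)$ for some $c_1\in(0,1/2]$ independent of $k$; (5) each $D_k$ is $\alpha_D$-well aligned for $f$ at $x_k$ with probability at least $1-\delta_S$, where $\alpha_D\in(0,1)$ is independent of $k$. Suppose $0<\delta_S<1/(C_1+1)$, where $C_1=\ln(1/\gamma_{\mathrm{dec}})^{-1}\ln(\gamma_{\mathrm{inc}})$. If QARSTA is run with $\Delta_{\min}=0$, then $$\mathbb{P}\left[\inf_{k\ge0}\|\nabla f(x_k)\|=0\right]=1.$$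
   Context: $\|\cdot\|$ is the Euclidean vector norm and induced matrix norm; $\sigma_{\min}$ is the minimum singular value; $A^\dagger$ is the Moore–Penrose pseudoinverse. $f\in\mathcal{C}^{2+}$ with constant $L_{\nabla^2 f}$ means $f$ is twice continuously differentiable with $\nabla^2 f$ Lipschitz with constant $L_{\nabla^2 f}$. A matrix $B\in\mathbb{R}^{n\times z}$ is $\alpha$-well aligned for $f$ at $x$ if $\|B^\top\nabla f(x)\|\ge\alpha\|\nabla f(x)\|$. Simplex derivatives. For $g:\mathbb{R}^p\to\mathbb{R}$, $y\in\mathbb{R}^p$, $M=[m_1\cdots m_z]\in\mathbb{R}^{p\times z}$: $\delta_g(y;M)\in\mathbb{R}^z$ has $i$-th entry $g(y+m_i)-g(y)$; $\nabla_S g(y;M)=(M^\top)^\dagger\delta_g(y;M)$; $\delta_{\nabla_S g}(y;M)$ has $i$-th row $(\nabla_S g(y+m_i;M)-\nabla_S g(y;M))^\top$; $\nabla_S^2 g(y;M)=(M^\top)^\dagger\delta_{\nabla_S g}(y;M)$. Algorithm QARSTA. Inputs: integers $1\le p_{\mathrm{rand}}\le p\le n$; $x_0\in\mathbb{R}^n$, $\Delta_0>0$; $\Delta_{\min}\le\Delta_{\max}$; $0<\gamma_{\mathrm{dec}}<1<\gamma_{\mathrm{inc}}$; $0<\eta_1\le\eta_2<1$; $\mu>0$; $\epsilon_{\mathrm{rad}}\ge1$; $\epsilon_{\mathrm{geo}}>0$; $M_A\ge1$. (Normally $\Delta_{\min}>0$; with $\Delta_{\min}=0$ the stopping test below never triggers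 and infinitely many iterations are performed.) Direction generation GEN$(Q,q,\Delta)$: generate $A\in\mathbb{R}^{n\times q}$ with $A_{ij}\sim\mathcal{N}(0,1/q)$ such that $A$ has full-column rank and $\|A\|\le M_A$; set $\widetilde A=A-QQ^\top A$ if $Q$ is specified and $\widetilde A=A$ otherwise; $QR$-factorize $\widetilde A=\widetilde Q\widetilde R$; return the columns of $\Delta\widetilde Q$. Direction removal: given $D^U=[d_1^U\cdots d_m^U]$, let $M_i$ be $D^U$ without its $i$-th column, $\theta_i=\sigma_{\min}(M_i)\max(\|d_i^U\|^4/\Delta_{k+1}^4,1)$, and remove the direction with largest $\theta_i$; repeat (recomputing the $\theta_i$) until the required number of directions is removed. Initialization: the columns of $D_0$ are the $p$ directions from GEN with length $\Delta_0$ and $Q$ unspecified. Iteration $k=0,1,\dots$: factorize $D_k=Q_kR_k$ ($QR$), put $\widehat f(\widehat s)=f(x_k+Q_k\widehat s)$ and build $\widehat m_k(\widehat s)=\widehat f(\mathbf 0)+(2\nabla_S\widehat f(\mathbf 0;R_k)-\nabla_S\widehat f(\mathbf 0;2R_k))^\top\widehat s+\frac12\widehat s^\top\nabla_S^2\widehat f(\mathbf 0;R_k)\widehat s$ on $\mathbb{R}^p$. (a) Criticality test: if $\mu\|\nabla\widehat m_k(\mathbf 0)\|<\Delta_k$, set $\Delta_{k+1}=\gamma_{\mathrm{dec}}\Delta_k$, $x_{k+1}=x_k$, $D_{k+1}=\gamma_{\mathrm{dec}}D_k$. (b) Otherwise, solve approximately $\min\widehat m_k(\widehat s_k)$ s.t.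 $\|\widehat s_k\|\le\Delta_k$, set $s_k=Q_k\widehat s_k$ and $\rho_k=\frac{f(x_k)-f(x_k+s_k)}{\widehat m_k(\mathbf 0)-\widehat m_k(\widehat s_k)}$. Set $\Delta_{k+1}=\gamma_{\mathrm{dec}}\Delta_k$ if $\rho_k<\eta_1$; $\Delta_{k+1}=\min(\gamma_{\mathrm{inc}}\Delta_k,\Delta_{\max})$ if $\rho_k>\eta_2$ and $\|\widehat s_k\|\ge0.95\Delta_k$; $\Delta_{k+1}=\Delta_k$ otherwise. Let $x_{k+1}$ be any point with $f(x_{k+1})\le\min(\{f(x_k+s_k)\}\cup\{f(x_k+d_i+d_j):d_i,d_j\in[\mathbf 0~D_k]\})$, where $d\in[\mathbf 0~D_k]$ means $d$ is a column of that matrix. Create $D^U_{k+1}$: select $p$ directions from $\{x_k+s_k-x_{k+1}\}\cup\{x_k+d_i+d_j-x_{k+1}:d_i,d_j\in[\mathbf 0~D_k]\}$; remove $p_{\mathrm{rand}}$ of them by direction removal; remove all with norm $>\epsilon_{\mathrm{rad}}\Delta_{k+1}$; while $D^U_{k+1}$ is nonempty and $\sigma_{\min}(D^U_{k+1})<\epsilon_{\mathrm{geo}}$, remove one more by direction removal. If $p_1$ columns remain, let $D^R_{k+1}$ consist of $q=p-p_1$ directions from GEN with length $\Delta_{k+1}$ and $Q$ an orthonormal basis of the column space of $D^U_{k+1}$ (unspecified if empty), and set $D_{k+1}=[D^U_{k+1}~D^R_{k+1}]$. Stopping test: if $\Delta_{k+1}<\Delta_{\min}$, stop. Standing fact used in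 the paper's convergence analysis: under (1), each $\widehat m_k$ satisfies, for all $\|\widehat s\|\le\Delta_k$, $|f(x_k+Q_k\widehat s)-\widehat m_k(\widehat s)|\le\kappa_{ef}\Delta_k^2$ and $\|Q_k^\top\nabla f(x_k+Q_k\widehat s)-\nabla\widehat m_k(\widehat s)\|\le\kappa_{eg}\Delta_k$ with constants independent of $k$ ($\widehat m_k$ belongs to a class of $Q_k$-fully linear models). *)

theory Defs
  imports "HOL-Probability.Probability" "HOL-Probability.Stopping_Time"
begin

definition gradient :: "('a::real_inner \<Rightarrow> real) \<Rightarrow> 'a \<Rightarrow> 'a" where
  "gradient f x = (THE g. GDERIV f x :> g)"

definition hessian :: "(real^'n \<Rightarrow> real) \<Rightarrow> real^'n \<Rightarrow> real^'n^'n" where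
  "hessian f x = jacobian (gradient f) (at x)"

text \<open>The norm of the type \<^typ>\<open>real^'n^'m\<close> is the Frobenius norm, hence the explicit
  induced norm.\<close>

definition mnorm :: "real^'n^'m \<Rightarrow> real" where
  "mnorm A = onorm (\<lambda>v. A *v v)"

definition C2_plus :: "(real^'n \<Rightarrow> real) \<Rightarrow> real \<Rightarrow> bool" where
  "C2_plus f L \<longleftrightarrow>
     (\<forall>x. f differentiable (at x)) \<and>
     (\<forall>x. gradient f differentiable (at x)) \<and>
     continuous_on UNIV (hessian f) \<and>
     (\<forall>x y. mnorm (hessian f x - hessian f y) \<le> L * norm (x - y))"

definition well_aligned :: "real \<Rightarrow> real^'z^'n \<Rightarrow> (real^'n \<Rightarrow> real) \<Rightarrow> real^'n \<Rightarrow> bool" where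
  "well_aligned \<alpha> B f x \<longleftrightarrow> norm (transpose B *v gradient f x) \<ge> \<alpha> * norm (gradient f x)"

text \<open>Moore--Penrose pseudoinverse: the unique solution of the four Penrose equations.\<close>

definition pinv :: "real^'b^'a \<Rightarrow> real^'a^'b" where
  "pinv A = (THE X. A ** X ** A = A \<and> X ** A ** X = X \<and>
                    transpose (A ** X) = A ** X \<and> transpose (X ** A) = X ** A)"

definition is_qr ::
  "real^'p::{finite,linorder}^'n \<Rightarrow> real^'p::{finite,linorder}^'n \<Rightarrow>
   real^'p::{finite,linorder}^'p::{finite,linorder} \<Rightarrow> bool" where
  "is_qr D Q R \<longleftrightarrow> D = Q ** R \<and> transpose Q ** Q = mat 1 \<and> (\<forall>i j. j < i \<longrightarrow> R $ i $ j = 0)"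


definition simplex_diff :: "(real^'p \<Rightarrow> real) \<Rightarrow> real^'p \<Rightarrow> real^'z^'p \<Rightarrow> real^'z" where
  "simplex_diff g y M = (\<chi> i. g (y + column i M) - g y)"

definition simplex_gradient :: "(real^'p \<Rightarrow> real) \<Rightarrow> real^'p \<Rightarrow> real^'z^'p \<Rightarrow> real^'p" where
  "simplex_gradient g y M = pinv (transpose M) *v simplex_diff g y M"

definition simplex_gradient_diff :: "(real^'p \<Rightarrow> real) \<Rightarrow> real^'p \<Rightarrow> real^'z^'p \<Rightarrow> real^'p^'z" where
  "simplex_gradient_diff g y M =
     (\<chi> i. simplex_gradient g (y + column i M) M - simplex_gradient g y M)"

definition simplex_hessian :: "(real^'p \<Rightarrow> real) \<Rightarrow> real^'p \<Rightarrow> real^'z^'p \<Rightarrow> real^'p^'p" where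
  "simplex_hessian g y M = pinv (transpose M) ** simplex_gradient_diff g y M"

definition subspace_fun :: "(real^'n \<Rightarrow> real) \<Rightarrow> real^'n \<Rightarrow> real^'p^'n \<Rightarrow> real^'p \<Rightarrow> real" where
  "subspace_fun f x Q s = f (x + Q *v s)"

definition quad_model ::
  "(real^'n \<Rightarrow> real) \<Rightarrow> real^'n \<Rightarrow> real^'p^'n \<Rightarrow> real^'p^'p \<Rightarrow> real^'p \<Rightarrow> real" where
  "quad_model f x Q R s =
     (let g = subspace_fun f x Q in
       g 0 + (2 *\<^sub>R simplex_gradient g 0 R - simplex_gradient g 0 (2 *\<^sub>R R)) \<bullet> s
           + (1/2) * (s \<bullet> (simplex_hessian g 0 R *v s)))"


text \<open>A matrix with \<open>n\<close> rows whose number of columns is determined at run time is the list of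
  its columns.\<close>

definition cols :: "real^'p::{finite,linorder}^'n \<Rightarrow> (real^'n) list" where
  "cols D = map (\<lambda>j. column j D) (sorted_list_of_set UNIV)"

definition orthonormal_list :: "(real^'n) list \<Rightarrow> bool" where
  "orthonormal_list us \<longleftrightarrow>
     (\<forall>i<length us. \<forall>j<length us. us ! i \<bullet> us ! j = (if i = j then 1 else 0))"

definition is_qr_list :: "(real^'n) list \<Rightarrow> (real^'n) list \<Rightarrow> (nat \<Rightarrow> nat \<Rightarrow> real) \<Rightarrow> bool" where
  "is_qr_list as qs R \<longleftrightarrow>
     length qs = length as \<and> orthonormal_list qs \<and> (\<forall>i j. j < i \<longrightarrow> R i j = 0) \<and>
     (\<forall>j<length as. as ! j = (\<Sum>i<length as. R i j *\<^sub>R qs ! i))"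

definition full_column_rank :: "(real^'n) list \<Rightarrow> bool" where
  "full_column_rank as \<longleftrightarrow> dim (set as) = length as"

definition mnorm_list :: "(real^'n) list \<Rightarrow> real" where
  "mnorm_list as =
     Sup {norm (\<Sum>j<length as. c j *\<^sub>R as ! j) | c. L2_set c {..<length as} = 1}"

text \<open>Singular values as the nonnegative square roots of the eigenvalues of \<open>M\<^sup>T M\<close>, which is
  appropriate for matrices with at most as many columns as rows (the only ones that occur).
  The set is finite, and nonempty if there is at least one column, so that \<open>Inf\<close> is a minimum.\<close>

definition singular_values :: "(real^'n) list \<Rightarrow> real set" where
  "singular_values ds =
     {\<sigma>. \<sigma> \<ge> 0 \<and> (\<exists>c. (\<exists>j<length ds. c j \<noteq> 0) \<and>
          (\<forall>j<length ds. ds ! j \<bullet> (\<Sum>i<length ds. c i *\<^sub>R ds ! i) = \<sigma>\<^sup>2 * c j))}"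

definition sigma_min :: "(real^'n) list \<Rightarrow> real" where
  "sigma_min ds = Inf (singular_values ds)"

text \<open>Measurable structure on column lists: generated by the length and the columns.\<close>

definition dirs_space :: "(real^'n) list measure" where
  "dirs_space =
     vimage_algebra UNIV (\<lambda>ds. (length ds, \<lambda>i. if i < length ds then ds ! i else 0))
       (count_space UNIV \<Otimes>\<^sub>M PiM (UNIV :: nat set) (\<lambda>_. borel))"


text \<open>Law of an \<open>n \<times> q\<close> matrix with independent \<open>N(0, 1/q)\<close> entries (the second argument of
  \<^const>\<open>normal_density\<close> is the standard deviation), conditioned on having full column rank and
  induced norm at most \<open>MA\<close>.\<close>

definition gen_law :: "nat \<Rightarrow> real \<Rightarrow> (real^'n) list measure" where
  "gen_law q MA =
     uniform_measure
       (distr (PiM ({..<q} \<times> (UNIV :: 'n set))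
                 (\<lambda>_. density lborel (normal_density 0 (1 / sqrt (real q)))))
              dirs_space (\<lambda>a. map (\<lambda>j. \<chi> i. a (j, i)) [0..<q]))
       {as. full_column_rank as \<and> mnorm_list as \<le> MA}"

text \<open>\<open>gen_dirs Q A \<Delta> ds\<close>: from the generated matrix \<open>A\<close>, the direction generation may return
  \<open>ds\<close>. An unspecified \<open>Q\<close> is the empty list.\<close>

definition gen_dirs ::
  "(real^'n) list \<Rightarrow> (real^'n) list \<Rightarrow> real \<Rightarrow> (real^'n) list \<Rightarrow> bool" where
  "gen_dirs Q A \<Delta> ds \<longleftrightarrow>
     (\<exists>Qt Rt. is_qr_list (map (\<lambda>a. a - (\<Sum>u\<leftarrow>Q. (u \<bullet> a) *\<^sub>R u)) A) Qt Rt \<and>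
              ds = map (\<lambda>v. \<Delta> *\<^sub>R v) Qt)"

definition remove_nth :: "nat \<Rightarrow> 'a list \<Rightarrow> 'a list" where
  "remove_nth i xs = take i xs @ drop (Suc i) xs"

definition removal_score :: "real \<Rightarrow> (real^'n) list \<Rightarrow> nat \<Rightarrow> real" where
  "removal_score \<Delta> ds i = sigma_min (remove_nth i ds) * max (norm (ds ! i) ^ 4 / \<Delta> ^ 4) 1"

text \<open>If only one direction is left, it is removed whatever the value of \<open>sigma_min []\<close>.\<close>

definition removal_step :: "real \<Rightarrow> (real^'n) list \<Rightarrow> (real^'n) list \<Rightarrow> bool" where
  "removal_step \<Delta> ds ds' \<longleftrightarrow>
     (\<exists>i<length ds. (\<forall>j<length ds. removal_score \<Delta> ds j \<le> removal_score \<Delta> ds i) \<and>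
                    ds' = remove_nth i ds)"


record ('n::finite) qarsta_inputs =
  p_rand :: nat
  x_init :: "real^'n"
  rad_init :: real
  rad_min :: real
  rad_max :: real
  gam_dec :: real
  gam_inc :: real
  eta1 :: real
  eta2 :: real
  crit_mu :: real
  eps_rad :: real
  eps_geo :: real
  gen_bound :: real

text \<open>The lower bound \<open>rad_min\<close> may be zero, but \<open>rad_max\<close> is positive in any case.\<close>

definition valid_inputs :: "nat \<Rightarrow> nat \<Rightarrow> 'n::finite qarsta_inputs \<Rightarrow> bool" where
  "valid_inputs n p P \<longleftrightarrow>
     1 \<le> p_rand P \<and> p_rand P \<le> p \<and> p \<le> n \<and>
     0 < rad_init P \<and> 0 \<le> rad_min P \<and> rad_min P \<le> rad_max P \<and> 0 < rad_max P \<and>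
     0 < gam_dec P \<and> gam_dec P < 1 \<and> 1 < gam_inc P \<and>
     0 < eta1 P \<and> eta1 P \<le> eta2 P \<and> eta2 P < 1 \<and>
     0 < crit_mu P \<and> 1 \<le> eps_rad P \<and> 0 < eps_geo P \<and> 1 \<le> gen_bound P"

text \<open>The quantities of iteration \<open>k\<close>: \<open>iterate\<close> is \<open>x\<^sub>k\<close>, \<open>radius\<close> is \<open>\<Delta>\<^sub>k\<close>, \<open>kept_dirs\<close> is
  \<open>D\<^sup>U\<^sub>k\<close>, \<open>n_gen\<close> is the number of directions generated for \<open>D\<^sub>k\<close> (zero if the direction
  generation is not called), \<open>gen_mat\<close> is the random matrix \<open>A\<close> used for that,
  \<open>dir_mat\<close> is \<open>D\<^sub>k\<close> with QR factors \<open>fac_Q\<close>, \<open>fac_R\<close>, and \<open>tr_step\<close> is the approximate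
  solution of the trust-region subproblem (meaningless if the criticality test holds).\<close>

record ('n::finite, 'p::finite) qarsta_state =
  iterate :: "real^'n"
  radius :: real
  kept_dirs :: "(real^'n) list"
  n_gen :: nat
  gen_mat :: "(real^'n) list"
  dir_mat :: "real^'p^'n"
  fac_Q :: "real^'p^'n"
  fac_R :: "real^'p^'p"
  tr_step :: "real^'p"

definition model :: "(real^'n \<Rightarrow> real) \<Rightarrow> ('n::finite, 'p::finite) qarsta_state \<Rightarrow> real^'p \<Rightarrow> real" where
  "model f S = quad_model f (iterate S) (fac_Q S) (fac_R S)"

text \<open>The model is quadratic, so its Hessian may be evaluated anywhere.\<close>

definition model_hessian ::
  "(real^'n \<Rightarrow> real) \<Rightarrow> ('n::finite, 'p::finite) qarsta_state \<Rightarrow> real^'p^'p" where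
  "model_hessian f S = hessian (model f S) 0"

definition critical ::
  "'n::finite qarsta_inputs \<Rightarrow> (real^'n \<Rightarrow> real) \<Rightarrow> ('n, 'p::finite) qarsta_state \<Rightarrow> bool" where
  "critical P f S \<longleftrightarrow> crit_mu P * norm (gradient (model f S) 0) < radius S"

definition full_step :: "('n::finite, 'p::finite) qarsta_state \<Rightarrow> real^'n" where
  "full_step S = fac_Q S *v tr_step S"

definition rho :: "(real^'n \<Rightarrow> real) \<Rightarrow> ('n::finite, 'p::finite) qarsta_state \<Rightarrow> real" where
  "rho f S = (f (iterate S) - f (iterate S + full_step S)) /
             (model f S 0 - model f S (tr_step S))"

definition next_radius ::
  "'n::finite qarsta_inputs \<Rightarrow> (real^'n \<Rightarrow> real) \<Rightarrow> ('n, 'p::finite) qarsta_state \<Rightarrow> real" where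
  "next_radius P f S =
     (if rho f S < eta1 P then gam_dec P * radius S
      else if rho f S > eta2 P \<and> norm (tr_step S) \<ge> 95/100 * radius S
        then min (gam_inc P * radius S) (rad_max P)
      else radius S)"

definition sample_offsets :: "('n::finite, 'p::{finite,linorder}) qarsta_state \<Rightarrow> (real^'n) set" where
  "sample_offsets S =
     {d + d' | d d'. d \<in> insert 0 (set (cols (dir_mat S))) \<and> d' \<in> insert 0 (set (cols (dir_mat S)))}"

definition candidate_offsets :: "('n::finite, 'p::{finite,linorder}) qarsta_state \<Rightarrow> (real^'n) set" where
  "candidate_offsets S = insert (full_step S) (sample_offsets S)"

text \<open>\<open>keeps_dirs P S x' \<Delta>' ds\<close>: with new iterate \<open>x'\<close> and new radius \<open>\<Delta>'\<close>, the directions \<open>ds\<close>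
  may be retained from the iteration with state \<open>S\<close>. The lists \<open>ds0\<close>, \<open>ds1\<close> are the selected
  directions and those left after the removal of \<open>p_rand\<close> of them.\<close>

definition keeps_dirs ::
  "'n::finite qarsta_inputs \<Rightarrow> ('n, 'p::{finite,linorder}) qarsta_state \<Rightarrow> real^'n \<Rightarrow> real \<Rightarrow>
   (real^'n) list \<Rightarrow> bool" where
  "keeps_dirs P S x' \<Delta>' ds \<longleftrightarrow>
     (\<exists>ds0 ds1.
        distinct ds0 \<and> length ds0 = CARD('p) \<and>
        set ds0 \<subseteq> (\<lambda>v. iterate S + v - x') ` candidate_offsets S \<and>
        (removal_step \<Delta>' ^^ p_rand P) ds0 ds1 \<and>
        (\<lambda>as bs. as \<noteq> [] \<and> sigma_min as < eps_geo P \<and> removal_step \<Delta>' as bs)\<^sup>*\<^sup>*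
          (filter (\<lambda>d. norm d \<le> eps_rad P * \<Delta>') ds1) ds \<and>
        (ds = [] \<or> sigma_min ds \<ge> eps_geo P))"

text \<open>\<open>D\<close> consists of the kept directions followed by newly generated ones; \<open>Qb\<close> is
  necessarily empty if there are no kept directions.\<close>

definition forms_dirs :: "('n::finite, 'p::{finite,linorder}) qarsta_state \<Rightarrow> bool" where
  "forms_dirs S \<longleftrightarrow>
     n_gen S = CARD('p) - length (kept_dirs S) \<and>
     (\<exists>Qb ds. orthonormal_list Qb \<and> span (set Qb) = span (set (kept_dirs S)) \<and>
              gen_dirs Qb (gen_mat S) (radius S) ds \<and>
              cols (dir_mat S) = kept_dirs S @ ds)"

definition qarsta_init ::
  "'n::finite qarsta_inputs \<Rightarrow> ('n, 'p::{finite,linorder}) qarsta_state \<Rightarrow> bool" where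
  "qarsta_init P S \<longleftrightarrow>
     iterate S = x_init P \<and> radius S = rad_init P \<and> kept_dirs S = [] \<and> forms_dirs S"

definition qarsta_step ::
  "'n::finite qarsta_inputs \<Rightarrow> (real^'n \<Rightarrow> real) \<Rightarrow>
   ('n, 'p::{finite,linorder}) qarsta_state \<Rightarrow> ('n, 'p) qarsta_state \<Rightarrow> bool" where
  "qarsta_step P f S S' \<longleftrightarrow>
     is_qr (dir_mat S) (fac_Q S) (fac_R S) \<and>
     (if critical P f S then
        radius S' = gam_dec P * radius S \<and> iterate S' = iterate S \<and>
        dir_mat S' = gam_dec P *\<^sub>R dir_mat S \<and> n_gen S' = 0
      else
        norm (tr_step S) \<le> radius S \<and>
        radius S' = next_radius P f S \<and>
        f (iterate S') \<le> Min ((\<lambda>v. f (iterate S + v)) ` candidate_offsets S) \<and>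
        keeps_dirs P S (iterate S') (radius S') (kept_dirs S') \<and>
        forms_dirs S')"

text \<open>A run with stopping test: iteration \<open>k\<close> is performed unless some earlier test stopped the
  algorithm.\<close>

definition qarsta_run ::
  "'n::finite qarsta_inputs \<Rightarrow> (real^'n \<Rightarrow> real) \<Rightarrow>
   (nat \<Rightarrow> ('n, 'p::{finite,linorder}) qarsta_state) \<Rightarrow> bool" where
  "qarsta_run P f S \<longleftrightarrow>
     qarsta_init P (S 0) \<and>
     (\<forall>k. (\<forall>j\<in>{1..k}. \<not> radius (S j) < rad_min P) \<longrightarrow> qarsta_step P f (S k) (S (Suc k)))"

text \<open>\<open>F k\<close> is the information available immediately before the \<open>k\<close>-th random matrix is
  generated. What is chosen freely in the algorithm (trust-region solution, next iterate, selected
  directions, factorizations) may depend on the past, but not on the future; conditionally on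
  \<open>F k\<close>, the \<open>k\<close>-th matrix has the law of the direction generation.\<close>

locale qarsta_process = prob_space M + filtration "space M" F
  for M :: "'w measure" and F :: "nat \<Rightarrow> 'w measure" +
  fixes P :: "'n::finite qarsta_inputs"
    and f :: "real^'n \<Rightarrow> real"
    and S :: "nat \<Rightarrow> 'w \<Rightarrow> ('n, 'p::{finite,linorder}) qarsta_state"
  assumes F_sub: "sets (F k) \<subseteq> sets M"
    and iterate_meas: "(\<lambda>\<omega>. iterate (S k \<omega>)) \<in> borel_measurable (F k)"
    and radius_meas: "(\<lambda>\<omega>. radius (S k \<omega>)) \<in> borel_measurable (F k)"
    and kept_dirs_meas: "(\<lambda>\<omega>. kept_dirs (S k \<omega>)) \<in> measurable (F k) dirs_space"
    and n_gen_meas: "(\<lambda>\<omega>. n_gen (S k \<omega>)) \<in> measurable (F k) (count_space UNIV)"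
    and gen_mat_meas: "(\<lambda>\<omega>. gen_mat (S k \<omega>)) \<in> measurable (F (Suc k)) dirs_space"
    and dir_mat_meas: "(\<lambda>\<omega>. dir_mat (S k \<omega>)) \<in> borel_measurable (F (Suc k))"
    and fac_Q_meas: "(\<lambda>\<omega>. fac_Q (S k \<omega>)) \<in> borel_measurable (F (Suc k))"
    and fac_R_meas: "(\<lambda>\<omega>. fac_R (S k \<omega>)) \<in> borel_measurable (F (Suc k))"
    and tr_step_meas: "(\<lambda>\<omega>. tr_step (S k \<omega>)) \<in> borel_measurable (F (Suc k))"
    and gen_mat_law: "\<lbrakk>q \<ge> 1; E \<in> sets (F k); E \<subseteq> {\<omega>. n_gen (S k \<omega>) = q}; B \<in> sets dirs_space\<rbrakk> \<Longrightarrow>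
        prob (E \<inter> {\<omega> \<in> space M. gen_mat (S k \<omega>) \<in> B}) =
        prob E * measure (gen_law q (gen_bound P)) B"
    and run: "AE \<omega> in M. qarsta_run P f (\<lambda>k. S k \<omega>)"

end

theory Submission
  imports Defs
begin

text \<open>Since \<open>\<Delta>\<^sub>k\<^sub>+\<^sub>1\<^sup>2 \<le> \<gamma>\<^sub>d\<^sub>e\<^sub>c\<^sup>2 \<Delta>\<^sub>k\<^sup>2 + C (f(x\<^sub>k) - f(x\<^sub>k\<^sub>+\<^sub>1))\<close> and \<open>f\<close> is bounded
  below, the radii tend to zero on every path. The threshold \<open>\<epsilon>\<^sub>g\<^sub>e\<^sub>o\<close> does not scale with the radius,
  so for small radii all directions are regenerated after each noncritical iteration, \<open>D\<^sub>k = \<Delta>\<^sub>k Q\<close>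
  with \<open>Q\<close> orthonormal, and the model errors are \<open>O(\<Delta>\<^sub>k\<^sup>3)\<close> for values and \<open>O(\<Delta>\<^sub>k\<^sup>2)\<close> for
  gradients. Hence the radius can shrink at a freshly generated \<open>D\<^sub>k\<close> only if the criticality test
  holds, which forces \<open>\<parallel>Q\<^sup>T \<nabla>f(x\<^sub>k)\<parallel> = O(\<Delta>\<^sub>k)\<close>; by anti-concentration of the Gaussian matrix, this has
  conditional probability \<open>O(\<Delta>\<^sub>k)\<close> as long as \<open>\<parallel>\<nabla>f(x\<^sub>k)\<parallel> \<ge> \<epsilon>\<close>. On the other hand, with conditional
  probability at least one half the iteration decreases \<open>f\<close> by a multiple of \<open>\<Delta>\<^sub>k\<close>, so the expected
  sum of these radii is finite. By Borel--Cantelli the radius shrinks at only finitely many fresh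
  matrices, contradicting \<open>\<Delta>\<^sub>k \<rightarrow> 0\<close> unless the criticality test eventually always holds. In that case
  the directions only get rescaled, the limit yields \<open>D\<^sup>T \<nabla>f(x) = 0\<close> for the last generated \<open>D\<close>, and
  this is a null event.\<close>

section \<open>Pseudoinverses and Taylor expansion\<close>

text \<open>The telescoped recursion makes only the squares of the radii summable, while a critical
  step at a fresh matrix has probability of the order of the radius itself. First powers therefore
  need a separate account. For the event that the matrix is fresh, the radius small and the gradient
  at least \<epsilon>, the expected radius splits into a part with an unfavourable Gaussian column,
  which is at most half of the whole and can be absorbed, and a part paid for by the decrease of f.
  The latter telescopes. Only the first column a of the Gaussian matrix enters. QR makes the first
  new direction parallel to a, so \<open>|a . g| <= M_A |Q^T g|\<close>, and a small projected
  gradient forces one scalar Gaussian to be small. Conditioning on rank and norm costs a constant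
  factor, so the linear small-ball bound survives. Iterations inside a run of critical steps reuse
  old directions, so no probability is estimated there; they are treated on each path
  separately.\<close>

lemma orthogonal_projection_exists:
  fixes V :: "'a::euclidean_space set"
  assumes "subspace V"
  obtains p where "linear p" "\<And>x. p x \<in> V" "\<And>x. x \<in> V \<Longrightarrow> p x = x" "\<And>x y. p x \<bullet> y = x \<bullet> p y"
proof -
  obtain B where B: "B \<subseteq> V" "pairwise orthogonal B" "\<And>x. x \<in> B \<Longrightarrow> norm x = 1"
    "independent B" "span B = V"
    using orthonormal_basis_subspace[OF assms] by metis
  have fin: "finite B" using B(4) by (rule independent_imp_finite)
  define p where "p x = (\<Sum>b\<in>B. (b \<bullet> x) *\<^sub>R b)" for x
  have lin: "linear p"
    unfolding p_def by (intro linear_compose_sum) (auto intro!: linearI simp: inner_add_right scaleR_add_left)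
  have pb: "p b = b" if "b \<in> B" for b
  proof -
    have "p b = (\<Sum>c\<in>B. (if c = b then b else 0))"
      unfolding p_def
    proof (rule sum.cong[OF refl])
      fix c assume "c \<in> B"
      then show "(c \<bullet> b) *\<^sub>R c = (if c = b then b else 0)"
        using B(2,3) that by (auto simp: pairwise_def orthogonal_def dot_square_norm)
    qed
    then show ?thesis using that fin by simp
  qed
  have "p x = x" if "x \<in> span B" for x
    using that
  proof (induction rule: span_induct_alt)
    case base
    then show ?case by (simp add: linear_0[OF lin])
  next
    case (step c x y)
    then show ?case by (simp add: linear_add[OF lin] linear_scale[OF lin] pb)
  qed
  moreover have "p x \<in> V" for x
    unfolding p_def using B(1) assms by (auto intro!: subspace_sum subspace_scale)
  moreover have "p x \<bullet> y = x \<bullet> p y" for x y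
    unfolding p_def by (simp add: inner_sum_left inner_sum_right inner_commute mult.commute)
  ultimately show thesis using that lin B(5) by metis
qed

section \<open>The Moore-Penrose pseudoinverse\<close>

text \<open>The body of the definite description in \<open>pinv\<close>, named so that existence and
  uniqueness can be proved for it.\<close>

definition penrose :: "real^'b^'a \<Rightarrow> real^'a^'b \<Rightarrow> bool" where
  "penrose A X \<longleftrightarrow> A ** X ** A = A \<and> X ** A ** X = X \<and>
     transpose (A ** X) = A ** X \<and> transpose (X ** A) = X ** A"

text \<open>A X and A Y are symmetric projections with the same range. Transposing
  \<open>A X = (A Y) (A X)\<close> gives \<open>A X = (A X) (A Y)\<close>, which is A Y. The same
  works for X A and Y A, and X = X A X is determined by the two products.\<close>

lemma penrose_unique:
  assumes "penrose A X" "penrose A Y"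
  shows "X = Y"
proof -
  have "A ** X = (A ** Y) ** (A ** X)"
    using assms by (simp add: penrose_def matrix_mul_assoc)
  also have "\<dots> = transpose ((A ** X) ** (A ** Y))"
    using assms by (simp add: penrose_def matrix_transpose_mul)
  also have "(A ** X) ** (A ** Y) = A ** Y"
    using assms by (simp add: penrose_def matrix_mul_assoc)
  finally have 1: "A ** X = A ** Y" using assms by (simp add: penrose_def)
  have "X ** A = (X ** A) ** (Y ** A)"
    using assms by (simp add: penrose_def matrix_mul_assoc[symmetric])
  also have "\<dots> = transpose ((Y ** A) ** (X ** A))"
    using assms by (simp add: penrose_def matrix_transpose_mul)
  also have "(Y ** A) ** (X ** A) = Y ** A"
    using assms by (simp add: penrose_def matrix_mul_assoc[symmetric])
  finally have 2: "X ** A = Y ** A" using assms by (simp add: penrose_def)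
  have "X = X ** A ** X" using assms by (simp add: penrose_def)
  also have "\<dots> = Y ** A ** Y" using 1 2 by (metis matrix_mul_assoc)
  finally show ?thesis using assms by (simp add: penrose_def)
qed

lemma symmetric_matrix_of_selfadjoint:
  fixes p :: "real^'a \<Rightarrow> real^'a"
  assumes "\<And>x y. p x \<bullet> y = x \<bullet> p y"
  shows "transpose (matrix p) = matrix p"
proof -
  have "p (axis i 1) $ j = p (axis j 1) $ i" for i j
    using assms[of "axis i 1" "axis j 1"]
    by (simp add: inner_axis inner_axis' inner_commute)
  then show ?thesis by (simp add: transpose_def matrix_def vec_eq_iff)
qed

lemma linear_matrix_works: "linear f \<Longrightarrow> matrix f *v x = f (x :: real^'n)"
  using matrix_works[of f x] linear_matrix_vector_mul_eq by blast

text \<open>A is injective on the orthogonal complement of its kernel. X first projects onto the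
  range of A and then inverts this restriction, so A X and X A are the orthogonal projections
  \<open>r\<close> and \<open>id - k\<close>.\<close>

lemma penrose_exists: "\<exists>X. penrose (A :: real^'b^'a) X"
proof -
  define f where "f v = A *v v" for v
  have f: "linear f" unfolding f_def by simp
  obtain k where k: "linear k" "\<And>x. k x \<in> {v. f v = 0}" "\<And>x. f x = 0 \<Longrightarrow> k x = x"
    "\<And>x y. k x \<bullet> y = x \<bullet> k y"
    using orthogonal_projection_exists[OF linear_subspace_kernel[OF f]]
    by (metis (mono_tags, lifting) mem_Collect_eq)
  obtain r where r: "linear r" "\<And>x. r x \<in> range f" "\<And>x. x \<in> range f \<Longrightarrow> r x = x"
    "\<And>x y. r x \<bullet> y = x \<bullet> r y"
    using orthogonal_projection_exists[OF linear_subspace_image[OF f subspace_UNIV]] by blast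
  \<comment> \<open>As k is the self-adjoint projection onto the kernel of f, its own kernel is the
    orthogonal complement of that kernel.\<close>
  define V where "V = {v. k v = 0}"
  have V: "subspace V" unfolding V_def by (rule linear_subspace_kernel[OF k(1)])
  have fk: "f (k x) = 0" for x using k(2) by auto
  have decomp: "x - k x \<in> V" "f (x - k x) = f x" for x
  proof -
    have "k (x - k x) = k x - k (k x)" by (rule linear_diff[OF k(1)])
    then show "x - k x \<in> V" using k(3)[OF fk[of x]] by (simp add: V_def)
    show "f (x - k x) = f x" using linear_diff[OF f, of x "k x"] by (simp add: fk)
  qed
  have "inj_on f V"
    unfolding linear_inj_on_iff_eq_0[OF f V] using k(3) by (auto simp: V_def)
  then obtain g where g: "range g \<subseteq> V" "linear g" "\<And>v. v \<in> V \<Longrightarrow> g (f v) = v"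
    using linear_exists_left_inverse_on[OF f V] by blast
  have gf: "g (f x) = x - k x" for x using g(3)[OF decomp(1)] decomp(2) by metis
  have fg: "f (g y) = y" if "y \<in> range f" for y
    using that decomp(2) by (auto simp: gf)
  define X where "X = matrix (\<lambda>y. g (r y))"
  have lgr: "linear (\<lambda>y. g (r y))" using linear_compose[OF r(1) g(2)] by (simp add: o_def)
  have Xv: "X *v y = g (r y)" for y unfolding X_def by (rule linear_matrix_works[OF lgr])
  have AX: "(A ** X) *v y = r y" for y
    by (simp add: matrix_vector_mul_assoc[symmetric] Xv f_def[symmetric] fg r(2))
  have XA: "(X ** A) *v y = y - k y" for y
    by (simp add: matrix_vector_mul_assoc[symmetric] Xv f_def[symmetric] r(3) gf)
  have "A ** X ** A = A"
    by (rule matrix_eq[THEN iffD2])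
      (simp add: matrix_vector_mul_assoc[symmetric] Xv f_def[symmetric] r(3) gf decomp(2))
  moreover have "X ** A ** X = X"
    by (rule matrix_eq[THEN iffD2])
      (simp add: matrix_vector_mul_assoc[symmetric] Xv f_def[symmetric] r(2,3) fg)
  moreover have "transpose (A ** X) = A ** X"
  proof -
    have "A ** X = matrix r"
      by (rule matrix_eq[THEN iffD2]) (simp add: AX linear_matrix_works[OF r(1)])
    then show ?thesis using symmetric_matrix_of_selfadjoint[of r] r(4) by metis
  qed
  moreover have "transpose (X ** A) = X ** A"
  proof -
    have l: "linear (\<lambda>y. y - k y)" using k(1) by (intro linear_compose_sub linear_ident)
    have "X ** A = matrix (\<lambda>y. y - k y)"
      by (rule matrix_eq[THEN iffD2]) (simp add: XA linear_matrix_works[OF l])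
    moreover have "(x - k x) \<bullet> y = x \<bullet> (y - k y)" for x y
      using k(4)[of x y] by (simp add: inner_diff_left inner_diff_right)
    ultimately show ?thesis
      using symmetric_matrix_of_selfadjoint[of "\<lambda>y. y - k y"] by simp
  qed
  ultimately show ?thesis unfolding penrose_def by blast
qed

lemma penrose_pinv: "penrose A (pinv A)"
proof -
  have "\<exists>!X. penrose A X" using penrose_exists penrose_unique by blast
  from theI'[OF this] show ?thesis unfolding pinv_def penrose_def .
qed

lemma pinv_eqI: "penrose A X \<Longrightarrow> pinv A = X"
  using penrose_unique penrose_pinv by blast

lemma pinv_scaleR:
  assumes "c \<noteq> 0"
  shows "pinv (c *\<^sub>R A) = (1 / c) *\<^sub>R pinv A"
  using penrose_pinv[of A] assms
  by (intro pinv_eqI) (simp add: penrose_def scalar_matrix_assoc[symmetric] matrix_scalar_ac transpose_scalar)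

text \<open>P = A X is symmetric and idempotent, so |P v|^2 = v . P v, and Cauchy-Schwarz
  applies.\<close>

lemma norm_penrose_projection_le:
  assumes "penrose A X"
  shows "norm ((A ** X) *v v) \<le> norm v"
proof -
  let ?P = "A ** X"
  have "(?P *v v) \<bullet> (?P *v v) = v \<bullet> (transpose ?P *v (?P *v v))"
    by (metis dot_lmul_matrix inner_commute transpose_matrix_vector)
  also have "\<dots> = v \<bullet> (?P *v v)"
    using assms by (simp add: penrose_def matrix_vector_mul_assoc matrix_mul_assoc)
  also have "\<dots> \<le> norm v * norm (?P *v v)" by (rule norm_cauchy_schwarz)
  finally have "norm (?P *v v) * norm (?P *v v) \<le> norm v * norm (?P *v v)"
    by (simp add: dot_square_norm power2_eq_square)
  then show ?thesis by (cases "norm (?P *v v) = 0") auto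
qed

section \<open>Gradients and the second-order Taylor expansion\<close>

lemma gradient_eqI:
  assumes "GDERIV f x :> g"
  shows "gradient f x = g"
  unfolding gradient_def
proof (rule the_equality[where P = "\<lambda>g. GDERIV f x :> g", OF assms])
  fix g' assume "GDERIV f x :> g'"
  with assms have "(\<lambda>h. h \<bullet> g') = (\<lambda>h. h \<bullet> g)"
    unfolding gderiv_def by (rule has_derivative_unique[rotated])
  then have "(g' - g) \<bullet> g' = (g' - g) \<bullet> g" by metis
  then have "(g' - g) \<bullet> (g' - g) = 0" by (simp add: inner_diff_right)
  then show "g' = g" by simp
qed

lemma GDERIV_gradient:
  fixes f :: "'a::euclidean_space \<Rightarrow> real"
  assumes "f differentiable (at x)"
  shows "GDERIV f x :> gradient f x"
proof -
  obtain f' where f': "(f has_derivative f') (at x)" using assms differentiable_def by blast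
  have lin: "linear f'" using f' has_derivative_linear by blast
  define g where "g = (\<Sum>b\<in>Basis. f' b *\<^sub>R b)"
  have "f' h = h \<bullet> g" for h
  proof -
    have "f' h = f' (\<Sum>b\<in>Basis. (h \<bullet> b) *\<^sub>R b)" by (simp add: euclidean_representation)
    also have "\<dots> = (\<Sum>b\<in>Basis. (h \<bullet> b) * f' b)" by (simp add: linear_sum[OF lin] linear_scale[OF lin])
    also have "\<dots> = h \<bullet> g" by (simp add: g_def inner_sum_right mult.commute)
    finally show ?thesis .
  qed
  then have "f' = (\<lambda>h. h \<bullet> g)" by (rule ext)
  with f' have "GDERIV f x :> g" by (simp add: gderiv_def)
  with gradient_eqI[OF this] show ?thesis by simp
qed

lemma norm_matrix_vector_le: "norm (A *v v) \<le> mnorm A * norm v"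
  unfolding mnorm_def by (rule onorm[OF matrix_vector_mul_bounded_linear])

lemma C2_plus_lipschitz_nonneg:
  assumes "C2_plus (f :: real^'n \<Rightarrow> real) L"
  shows "L \<ge> 0"
proof -
  have "0 \<le> mnorm (hessian f 0 - hessian f 1)"
    unfolding mnorm_def by (rule onorm_pos_le[OF matrix_vector_mul_bounded_linear])
  also have "\<dots> \<le> L * norm (0 - 1 :: real^'n)" using assms unfolding C2_plus_def by blast
  finally show ?thesis by (simp add: zero_le_mult_iff)
qed

text \<open>Lagrange remainder along the segment from x to x + d. The Hessian at the intermediate
  point differs from the one at x by at most L |d|; this mean value form gives the constant
  L/2.\<close>

lemma C2_plus_taylor:
  assumes "C2_plus f L"
  shows "\<bar>f (x + d) - f x - gradient f x \<bullet> d - (d \<bullet> (hessian f x *v d)) / 2\<bar> \<le> L / 2 * norm d ^ 3"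
proof -
  \<comment> \<open>The restriction of f to the line and its first two derivatives, indexed by order
    as \<open>Maclaurin\<close> expects; orders above 2 never occur.\<close>
  define \<phi> where "\<phi> m t = (if m = 0 then f (x + t *\<^sub>R d) else if m = 1 then gradient f (x + t *\<^sub>R d) \<bullet> d
    else d \<bullet> (hessian f (x + t *\<^sub>R d) *v d))" for m :: nat and t :: real
  have line: "((\<lambda>t. x + t *\<^sub>R d) has_derivative (\<lambda>h. h *\<^sub>R d)) (at t)" for t
    by (auto intro!: derivative_eq_intros)
  have d1: "DERIV (\<phi> 0) t :> \<phi> (Suc 0) t" for t
  proof -
    have "(f has_derivative (\<lambda>h. h \<bullet> gradient f (x + t *\<^sub>R d))) (at (x + t *\<^sub>R d))"
      using assms GDERIV_gradient unfolding C2_plus_def gderiv_def by blast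
    from has_derivative_compose[OF line this]
    have "((\<lambda>t. f (x + t *\<^sub>R d)) has_derivative (*) (gradient f (x + t *\<^sub>R d) \<bullet> d)) (at t)"
      by (rule has_derivative_eq_rhs) (simp add: inner_commute mult.commute fun_eq_iff)
    then show ?thesis by (simp add: \<phi>_def[abs_def] has_field_derivative_def)
  qed
  have d2: "DERIV (\<phi> 1) t :> \<phi> (Suc 1) t" for t
  proof -
    have "(gradient f has_derivative (\<lambda>h. hessian f (x + t *\<^sub>R d) *v h)) (at (x + t *\<^sub>R d))"
      using assms unfolding C2_plus_def hessian_def by (metis jacobian_works)
    from has_derivative_compose[OF line this]
    have "((\<lambda>t. gradient f (x + t *\<^sub>R d) \<bullet> d) has_derivative
      (\<lambda>h. (hessian f (x + t *\<^sub>R d) *v (h *\<^sub>R d)) \<bullet> d)) (at t)"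
      by (rule has_derivative_inner_left)
    then have "((\<lambda>t. gradient f (x + t *\<^sub>R d) \<bullet> d) has_derivative
      (*) (d \<bullet> (hessian f (x + t *\<^sub>R d) *v d))) (at t)"
      by (rule has_derivative_eq_rhs)
        (simp add: matrix_vector_mult_scaleR inner_commute mult.commute fun_eq_iff)
    then show ?thesis by (simp add: \<phi>_def[abs_def] has_field_derivative_def)
  qed
  have "\<exists>t>0. t < 1 \<and> \<phi> 0 1 = (\<Sum>m<2. \<phi> m 0 / fact m * 1 ^ m) + \<phi> 2 t / fact 2 * 1 ^ 2"
  proof (rule Maclaurin)
    show "\<forall>m t. m < 2 \<and> 0 \<le> t \<and> t \<le> 1 \<longrightarrow> DERIV (\<phi> m) t :> \<phi> (Suc m) t"
      using d1 d2 by (auto simp: less_2_cases_iff)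
  qed auto
  then obtain t where t: "0 < t" "t < 1" "\<phi> 0 1 = (\<Sum>m<2. \<phi> m 0 / fact m) + \<phi> 2 t / 2" by auto
  then have "f (x + d) - f x - gradient f x \<bullet> d - (d \<bullet> (hessian f x *v d)) / 2 =
      (d \<bullet> ((hessian f (x + t *\<^sub>R d) - hessian f x) *v d)) / 2"
    by (simp add: \<phi>_def numeral_2_eq_2 matrix_vector_mult_diff_rdistrib inner_diff_right diff_divide_distrib)
  moreover have "\<bar>d \<bullet> ((hessian f (x + t *\<^sub>R d) - hessian f x) *v d)\<bar> \<le> L * norm d ^ 3"
  proof -
    have "\<bar>d \<bullet> ((hessian f (x + t *\<^sub>R d) - hessian f x) *v d)\<bar>
      \<le> norm d * norm ((hessian f (x + t *\<^sub>R d) - hessian f x) *v d)" by (rule Cauchy_Schwarz_ineq2)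
    also have "\<dots> \<le> norm d * (mnorm (hessian f (x + t *\<^sub>R d) - hessian f x) * norm d)"
      by (intro mult_left_mono norm_matrix_vector_le) auto
    also have "mnorm (hessian f (x + t *\<^sub>R d) - hessian f x) \<le> L * norm ((x + t *\<^sub>R d) - x)"
      using assms unfolding C2_plus_def by blast
    also have "norm ((x + t *\<^sub>R d) - x) \<le> norm d"
      using t by (simp add: mult_left_le_one_le)
    finally show ?thesis
      using C2_plus_lipschitz_nonneg[OF assms] by (simp add: power3_eq_cube mult_left_mono mult_right_mono mult_ac)
  qed
  ultimately have "\<bar>f (x + d) - f x - gradient f x \<bullet> d - (d \<bullet> (hessian f x *v d)) / 2\<bar> * 2 \<le> L * norm d ^ 3"
    by (metis abs_divide abs_numeral nonzero_eq_divide_eq zero_neq_numeral)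
  then show ?thesis by simp
qed

section \<open>Accuracy of the quadratic model\<close>

lemma is_qr_column: "is_qr D Q R \<Longrightarrow> Q *v column i R = column i D"
  unfolding is_qr_def
  by (auto simp: vec_eq_iff column_def matrix_vector_mult_def matrix_matrix_mult_def)

lemma is_qr_transpose_vector: "is_qr D Q R \<Longrightarrow> transpose R *v (transpose Q *v g) = transpose D *v g"
  unfolding is_qr_def by (metis matrix_transpose_mul matrix_vector_mul_assoc)

lemma is_qr_gram: "is_qr D Q R \<Longrightarrow> transpose R ** R = transpose D ** D"
  unfolding is_qr_def by (metis matrix_mul_assoc matrix_mul_lid matrix_transpose_mul)

lemma gram_diagonal: "(transpose A ** A) $ i $ i = column i A \<bullet> column i A"
  for A :: "real^'b^'a"
  by (simp add: matrix_matrix_mult_def transpose_def column_def inner_vec_def)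

lemma is_qr_norm_column:
  assumes "is_qr D Q R"
  shows "norm (column i R) = norm (column i D)"
  unfolding norm_eq_sqrt_inner gram_diagonal[symmetric] is_qr_gram[OF assms] ..

lemma transpose_matrix_vector_nth: "(transpose A *v v) $ i = column i A \<bullet> v"
  for A :: "real^'b^'a"
  by (simp add: matrix_vector_mult_def transpose_def column_def inner_vec_def)

lemma matrix_vector_columns: "A *v v = (\<Sum>i\<in>UNIV. v $ i *\<^sub>R column i A)"
  for A :: "real^'b^'a"
  by (simp add: vec_eq_iff matrix_vector_mult_def column_def mult.commute)

definition model_gradient :: "(real^'n \<Rightarrow> real) \<Rightarrow> real^'n \<Rightarrow> real^'p^'n \<Rightarrow> real^'p^'p \<Rightarrow> real^'p" where
  "model_gradient f x Q R =
     2 *\<^sub>R simplex_gradient (subspace_fun f x Q) 0 R - simplex_gradient (subspace_fun f x Q) 0 (2 *\<^sub>R R)"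

lemma quad_model_eq:
  "quad_model f x Q R s = f x + model_gradient f x Q R \<bullet> s
     + (1/2) * (s \<bullet> (simplex_hessian (subspace_fun f x Q) 0 R *v s))"
  by (simp add: quad_model_def model_gradient_def Let_def subspace_fun_def)

lemma quad_model_0: "quad_model f x Q R 0 = f x"
  by (simp add: quad_model_eq)

lemma gradient_quad_model: "gradient (quad_model f x Q R) 0 = model_gradient f x Q R"
proof (rule gradient_eqI)
  let ?H = "simplex_hessian (subspace_fun f x Q) 0 R"
  have lin: "((\<lambda>s. ?H *v s) has_derivative (\<lambda>h. ?H *v h)) (at 0)"
    by (rule bounded_linear_imp_has_derivative) (rule matrix_vector_mul_bounded_linear)
  have "((\<lambda>s. f x + model_gradient f x Q R \<bullet> s + (1/2) * (s \<bullet> (?H *v s))) has_derivative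
     (\<lambda>h. h \<bullet> model_gradient f x Q R)) (at 0)"
    by (auto intro!: derivative_eq_intros lin simp: inner_commute)
  then show "GDERIV (quad_model f x Q R) 0 :> model_gradient f x Q R"
    unfolding gderiv_def quad_model_eq[abs_def] .
qed

text \<open>Doubling R halves the pseudoinverse of its transpose. Both simplex gradients thus share
  one pseudoinverse, applied to an extrapolated difference vector.\<close>

lemma model_gradient_eq:
  fixes f :: "real^'n \<Rightarrow> real" and D :: "real^'p::{finite,linorder}^'n"
  assumes "is_qr D Q R"
  shows "model_gradient f x Q R = pinv (transpose R) *v
    (\<chi> i. 2 * (f (x + column i D) - f x) - (f (x + 2 *\<^sub>R column i D) - f x) / 2)"
proof -
  have c: "column i (2 *\<^sub>R R) = 2 *\<^sub>R column i R" for i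
    by (simp add: column_def vec_eq_iff)
  have p: "pinv (transpose (2 *\<^sub>R R)) = (1/2) *\<^sub>R pinv (transpose R)"
    using pinv_scaleR[of 2 "transpose R"] by (simp add: transpose_scalar)
  have "model_gradient f x Q R =
      pinv (transpose R) *v (2 *\<^sub>R simplex_diff (subspace_fun f x Q) 0 R -
        (1/2) *\<^sub>R simplex_diff (subspace_fun f x Q) 0 (2 *\<^sub>R R))"
    unfolding model_gradient_def simplex_gradient_def p
    by (simp add: matrix_vector_mult_diff_distrib matrix_vector_mult_scaleR scaleR_matrix_vector_assoc[symmetric])
  also have "2 *\<^sub>R simplex_diff (subspace_fun f x Q) 0 R - (1/2) *\<^sub>R simplex_diff (subspace_fun f x Q) 0 (2 *\<^sub>R R)
     = (\<chi> i. 2 * (f (x + column i D) - f x) - (f (x + 2 *\<^sub>R column i D) - f x) / 2)"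
    by (simp add: vec_eq_iff simplex_diff_def subspace_fun_def c matrix_vector_mult_scaleR is_qr_column[OF assms])
  finally show ?thesis .
qed

text \<open>The combination of step sizes \<open>1\<close> and \<open>2\<close> cancels the second-order Taylor term, which is
  why no bound on the Hessian of \<open>f\<close> enters.\<close>

lemma model_gradient_error:
  fixes f :: "real^'n \<Rightarrow> real" and D :: "real^'p::{finite,linorder}^'n"
  assumes C2: "C2_plus f L" and qr: "is_qr D Q R" and D: "\<And>i. norm (column i D) \<le> B"
  shows "norm (transpose R *v model_gradient f x Q R - transpose D *v gradient f x)
    \<le> 3 * real CARD('p) * L * B ^ 3"
proof -
  define w :: "real^'p::{finite,linorder}" where
    "w = (\<chi> i. 2 * (f (x + column i D) - f x) - (f (x + 2 *\<^sub>R column i D) - f x) / 2)"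
  let ?P = "transpose R ** pinv (transpose R)" and ?v = "transpose D *v gradient f x"
  have L: "L \<ge> 0" by (rule C2_plus_lipschitz_nonneg[OF C2])
  have "transpose R *v model_gradient f x Q R = ?P *v w"
    unfolding model_gradient_eq[OF qr] w_def by (simp add: matrix_vector_mul_assoc)
  \<comment> \<open>\<open>?v\<close> equals R^T (Q^T g) and so lies in the range of R^T, which the
    projection \<open>?P\<close> fixes. R may therefore be singular.\<close>
  moreover have "?P *v ?v = ?v"
    unfolding is_qr_transpose_vector[OF qr, symmetric] matrix_vector_mul_assoc matrix_mul_assoc
    using penrose_pinv[of "transpose R"] unfolding penrose_def by simp
  ultimately have "norm (transpose R *v model_gradient f x Q R - ?v) = norm (?P *v (w - ?v))"
    by (simp add: matrix_vector_mult_diff_distrib)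
  also have "\<dots> \<le> norm (w - ?v)" by (rule norm_penrose_projection_le[OF penrose_pinv])
  also have "\<dots> \<le> (\<Sum>i\<in>UNIV. \<bar>(w - ?v) $ i\<bar>)" by (rule norm_le_l1_cart)
  also have "\<dots> \<le> (\<Sum>i\<in>(UNIV :: 'p set). 3 * L * B ^ 3)"
  proof (rule sum_mono)
    fix i
    let ?d = "column i D"
    let ?q = "(?d \<bullet> (hessian f x *v ?d)) / 2"
    have 1: "\<bar>f (x + ?d) - f x - gradient f x \<bullet> ?d - ?q\<bar> \<le> L / 2 * norm ?d ^ 3"
      using C2_plus_taylor[OF C2, of x ?d] .
    have 2: "\<bar>f (x + 2 *\<^sub>R ?d) - f x - 2 * (gradient f x \<bullet> ?d) - 4 * ?q\<bar> \<le> 8 * (L / 2 * norm ?d ^ 3)"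
      using C2_plus_taylor[OF C2, of x "2 *\<^sub>R ?d"]
      by (simp add: matrix_vector_mult_scaleR power_mult_distrib)
    \<comment> \<open>The error L/2 |d|^3 at step d enters twice, the error 4 L |d|^3 at step 2d
      enters with factor 1/2: together 3 L |d|^3.\<close>
    have comb: "\<bar>2 * a - b / 2\<bar> \<le> 3 * c" if "\<bar>a\<bar> \<le> c / 2" "\<bar>b\<bar> \<le> 4 * c" for a b c :: real
      using that by linarith
    have eq: "(w - ?v) $ i = 2 * (f (x + ?d) - f x - gradient f x \<bullet> ?d - ?q)
       - (f (x + 2 *\<^sub>R ?d) - f x - 2 * (gradient f x \<bullet> ?d) - 4 * ?q) / 2"
      by (simp add: w_def transpose_matrix_vector_nth inner_commute diff_divide_distrib
          del: transpose_matrix_vector)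
    have "\<bar>(w - ?v) $ i\<bar> \<le> 3 * (L * norm ?d ^ 3)"
      unfolding eq by (rule comb) (use 1 2 in simp_all)
    also have "\<dots> \<le> 3 * (L * B ^ 3)"
      using D[of i] L by (intro mult_left_mono power_mono) auto
    finally show "\<bar>(w - ?v) $ i\<bar> \<le> 3 * L * B ^ 3" by simp
  qed
  also have "\<dots> = 3 * real CARD('p) * L * B ^ 3" by simp
  finally show ?thesis .
qed

section \<open>Models built on orthogonal directions of equal length\<close>

text \<open>R is \<Delta> times an orthogonal matrix: for square matrices a left inverse is a right
  inverse, and a two-sided inverse is the pseudoinverse.\<close>

lemma scaled_orthogonal_inverse:
  fixes R :: "real^'p^'p"
  assumes "transpose R ** R = \<Delta>\<^sup>2 *\<^sub>R mat 1" "\<Delta> > 0"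
  shows "R ** transpose R = \<Delta>\<^sup>2 *\<^sub>R mat 1" "pinv (transpose R) = (1 / \<Delta>\<^sup>2) *\<^sub>R R"
    "norm (transpose R *v v) = \<Delta> * norm v"
proof -
  let ?X = "(1 / \<Delta>\<^sup>2) *\<^sub>R R"
  have 1: "transpose R ** ?X = mat 1"
    using assms by (simp add: matrix_scalar_ac scalar_matrix_assoc[symmetric])
  then have 2: "?X ** transpose R = mat 1" using matrix_left_right_inverse by blast
  then show "R ** transpose R = \<Delta>\<^sup>2 *\<^sub>R mat 1"
    using assms(2) by (simp add: scalar_matrix_assoc[symmetric] field_simps vector_fraction_eq_iff)
  show "pinv (transpose R) = ?X"
    by (rule pinv_eqI) (simp add: penrose_def 1 2)
  have "(transpose R *v v) \<bullet> (transpose R *v v) = v \<bullet> ((R ** transpose R) *v v)"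
    by (metis dot_lmul_matrix matrix_vector_mul_assoc transpose_matrix_vector inner_commute)
  also have "\<dots> = (\<Delta> * norm v)\<^sup>2"
    using \<open>R ** transpose R = _\<close>
    by (simp add: scaleR_matrix_vector_assoc[symmetric] dot_square_norm power_mult_distrib)
  finally show "norm (transpose R *v v) = \<Delta> * norm v"
    using assms(2) by (simp add: dot_square_norm power2_eq_iff_nonneg)
qed

lemma bilinear_form_bound:
  fixes v :: "real^'p"
  assumes "\<And>i j. \<bar>e i j\<bar> \<le> c" "\<And>i. \<bar>v $ i\<bar> \<le> 1"
  shows "\<bar>\<Sum>i\<in>UNIV. \<Sum>j\<in>UNIV. v $ i * v $ j * e i j\<bar> \<le> (real CARD('p))\<^sup>2 * c"
proof -
  have "\<bar>\<Sum>i\<in>UNIV. \<Sum>j\<in>UNIV. v $ i * v $ j * e i j\<bar> \<le> (\<Sum>i\<in>(UNIV::'p set). \<Sum>j\<in>(UNIV::'p set). c)"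
  proof (rule order_trans[OF sum_abs] , rule sum_mono, rule order_trans[OF sum_abs], rule sum_mono)
    fix i j
    have "\<bar>v $ i\<bar> * \<bar>v $ j\<bar> * \<bar>e i j\<bar> \<le> 1 * 1 * c"
      using assms(1)[of i j] assms(2)[of i] assms(2)[of j] by (intro mult_mono) auto
    then show "\<bar>v $ i * v $ j * e i j\<bar> \<le> c" by (simp add: abs_mult)
  qed
  then show ?thesis by (simp add: power2_eq_square)
qed

text \<open>The vector \<open>v s\<close> holds the coordinates of s with respect to the columns of
  R. In these coordinates the simplex Hessian is the matrix of mixed second differences of f along
  the columns of D.\<close>

lemma simplex_hessian_form:
  fixes f :: "real^'n \<Rightarrow> real" and D :: "real^'p::{finite,linorder}^'n"
  assumes qr: "is_qr D Q R" and gram: "transpose D ** D = \<Delta>\<^sup>2 *\<^sub>R mat 1" and \<Delta>: "\<Delta> > 0"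
  defines "v \<equiv> \<lambda>s. (1 / \<Delta>\<^sup>2) *\<^sub>R (transpose R *v s)"
  shows "s \<bullet> (simplex_hessian (subspace_fun f x Q) 0 R *v s) =
    (\<Sum>i\<in>UNIV. \<Sum>j\<in>UNIV. v s $ i * v s $ j *
       (f (x + column i D + column j D) - f (x + column i D) - f (x + column j D) + f x))"
proof -
  let ?g = "subspace_fun f x Q"
  have pinv: "pinv (transpose R) = (1 / \<Delta>\<^sup>2) *\<^sub>R R"
    using scaled_orthogonal_inverse(2) is_qr_gram[OF qr] gram \<Delta> by metis
  have sg: "simplex_gradient ?g y R \<bullet> s = (\<Sum>j\<in>UNIV. v s $ j * simplex_diff ?g y R $ j)" for y
  proof -
    have "simplex_gradient ?g y R \<bullet> s = simplex_diff ?g y R \<bullet> v s"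
      unfolding simplex_gradient_def pinv v_def
      by (simp add: scaleR_matrix_vector_assoc[symmetric] inner_commute)
        (metis dot_lmul_matrix inner_commute transpose_matrix_vector)
    then show ?thesis by (simp add: inner_vec_def mult.commute)
  qed
  have "s \<bullet> (simplex_hessian ?g 0 R *v s) = v s \<bullet> (simplex_gradient_diff ?g 0 R *v s)"
    unfolding simplex_hessian_def pinv v_def
    by (simp add: matrix_vector_mul_assoc[symmetric] scaleR_matrix_vector_assoc[symmetric] scalar_matrix_assoc[symmetric])
      (metis dot_lmul_matrix inner_commute transpose_matrix_vector)
  also have "\<dots> = (\<Sum>i\<in>UNIV. v s $ i * ((simplex_gradient ?g (column i R) R - simplex_gradient ?g 0 R) \<bullet> s))"
    by (simp add: inner_vec_def simplex_gradient_diff_def matrix_vector_mult_def)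
  also have "\<dots> = (\<Sum>i\<in>UNIV. v s $ i * (\<Sum>j\<in>UNIV. v s $ j * (simplex_diff ?g (column i R) R $ j - simplex_diff ?g 0 R $ j)))"
    by (simp add: inner_diff_left sg right_diff_distrib sum_subtractf)
  moreover have "simplex_diff ?g (column i R) R $ j - simplex_diff ?g 0 R $ j =
      f (x + column i D + column j D) - f (x + column i D) - f (x + column j D) + f x" for i j
    by (simp add: simplex_diff_def subspace_fun_def matrix_vector_right_distrib is_qr_column[OF qr] add.assoc)
  ultimately show ?thesis by (simp add: sum_distrib_left mult.assoc)
qed

text \<open>In the coordinates v of s every entry is at most 1 in modulus, so an O(\<Delta>^3) error
  in each mixed second difference remains O(\<Delta>^3) in the quadratic term. Values are then one
  order more accurate than for a fully linear model.\<close>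

lemma quad_model_accuracy:
  fixes f :: "real^'n \<Rightarrow> real" and D :: "real^'p::{finite,linorder}^'n"
  assumes C2: "C2_plus f L" and qr: "is_qr D Q R"
    and gram: "transpose D ** D = \<Delta>\<^sup>2 *\<^sub>R mat 1" and \<Delta>: "\<Delta> > 0"
  shows model_gradient_accuracy:
      "norm (model_gradient f x Q R - transpose Q *v gradient f x) \<le> 3 * real CARD('p) * L * \<Delta>\<^sup>2"
    and quad_model_value_accuracy: "norm s \<le> \<Delta> \<Longrightarrow>
      \<bar>quad_model f x Q R s - f (x + Q *v s)\<bar> \<le> 6 * (real CARD('p))\<^sup>2 * L * \<Delta> ^ 3"
proof -
  let ?p = "real CARD('p)" and ?b = "model_gradient f x Q R" and ?g = "gradient f x" and ?H = "hessian f x"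
  have L: "L \<ge> 0" by (rule C2_plus_lipschitz_nonneg[OF C2])
  have gramR: "transpose R ** R = \<Delta>\<^sup>2 *\<^sub>R mat 1" using is_qr_gram[OF qr] gram by simp
  note R = scaled_orthogonal_inverse[OF gramR \<Delta>]
  have nd: "norm (column i D) = \<Delta>" for i
  proof -
    have "column i D \<bullet> column i D = (transpose D ** D) $ i $ i"
      by (rule gram_diagonal[symmetric])
    also have "\<dots> = \<Delta>\<^sup>2" by (simp add: gram mat_def)
    finally show ?thesis using \<Delta> by (simp add: norm_eq_sqrt_inner)
  qed
  show grad: "norm (?b - transpose Q *v ?g) \<le> 3 * ?p * L * \<Delta>\<^sup>2"
  proof -
    have "\<Delta> * norm (?b - transpose Q *v ?g) = norm (transpose R *v ?b - transpose D *v ?g)"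
      by (simp add: R(3)[symmetric] matrix_vector_mult_diff_distrib is_qr_transpose_vector[OF qr]
          del: transpose_matrix_vector)
    also have "\<dots> \<le> 3 * ?p * L * \<Delta> ^ 3"
      by (rule model_gradient_error[OF C2 qr]) (simp add: nd)
    finally have "\<Delta> * norm (?b - transpose Q *v ?g) \<le> \<Delta> * (3 * ?p * L * \<Delta>\<^sup>2)"
      by (simp add: power3_eq_cube power2_eq_square mult_ac)
    then show ?thesis using \<Delta> by simp
  qed
  assume s: "norm s \<le> \<Delta>"
  define v where "v = (1 / \<Delta>\<^sup>2) *\<^sub>R (transpose R *v s)"
  have v1: "\<bar>v $ i\<bar> \<le> 1" for i
  proof -
    have "norm v = norm s / \<Delta>"
      using \<Delta> by (simp add: v_def R(3) power2_eq_square field_simps del: transpose_matrix_vector)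
    also have "\<dots> \<le> 1" using s \<Delta> by simp
    finally show ?thesis using component_le_norm_cart[of v i] by simp
  qed
  have Dv: "D *v v = Q *v s"
  proof -
    have "D *v v = (1 / \<Delta>\<^sup>2) *\<^sub>R (Q *v ((R ** transpose R) *v s))"
      using qr by (simp add: v_def is_qr_def matrix_vector_mult_scaleR matrix_vector_mul_assoc matrix_mul_assoc
          del: transpose_matrix_vector)
    then show ?thesis using \<Delta>
      by (simp add: R(1) scaleR_matrix_vector_assoc[symmetric] matrix_vector_mult_scaleR)
  qed
  define q where "q d = (d \<bullet> (?H *v d)) / 2" for d
  define d where "d i = column i D" for i
  \<comment> \<open>Deviation of a mixed second difference from the Hessian form. The form is
    symmetrized, so that symmetry of second derivatives is never invoked.\<close>
  define e where "e i j = f (x + d i + d j) - f (x + d i) - f (x + d j) + f x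
      - (d i \<bullet> (?H *v d j) + d j \<bullet> (?H *v d i)) / 2" for i j
  have T: "\<bar>f (x + h) - f x - ?g \<bullet> h - q h\<bar> \<le> L / 2 * norm h ^ 3" for h
    unfolding q_def by (rule C2_plus_taylor[OF C2])
  \<comment> \<open>The Taylor error at \<open>d i + d j\<close>, of norm at most 2 \<Delta>, is 4 L
    \<Delta>^3; each of the two single directions adds half of L \<Delta>^3.\<close>
  have e: "\<bar>e i j\<bar> \<le> 5 * L * \<Delta> ^ 3" for i j
  proof -
    have "e i j = (f (x + (d i + d j)) - f x - ?g \<bullet> (d i + d j) - q (d i + d j))
       - (f (x + d i) - f x - ?g \<bullet> d i - q (d i)) - (f (x + d j) - f x - ?g \<bullet> d j - q (d j))"
      unfolding e_def q_def
      by (simp add: matrix_vector_right_distrib inner_add_left inner_add_right add_divide_distrib add.assoc)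
    moreover have "\<bar>f (x + (d i + d j)) - f x - ?g \<bullet> (d i + d j) - q (d i + d j)\<bar> \<le> 4 * (L * \<Delta> ^ 3)"
    proof -
      have "norm (d i + d j) \<le> 2 * \<Delta>"
        using norm_triangle_ineq[of "d i" "d j"] by (simp add: d_def nd)
      then have "norm (d i + d j) ^ 3 \<le> (2 * \<Delta>) ^ 3" by (intro power_mono) auto
      then have "L / 2 * norm (d i + d j) ^ 3 \<le> L / 2 * (2 * \<Delta>) ^ 3"
        using L by (intro mult_left_mono) auto
      then show ?thesis using T[of "d i + d j"] by (simp add: power_mult_distrib)
    qed
    moreover have "\<bar>f (x + d i) - f x - ?g \<bullet> d i - q (d i)\<bar> \<le> L * \<Delta> ^ 3 / 2" for i
      using T[of "d i"] by (simp add: d_def nd)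
    moreover have "\<bar>a - b - c\<bar> \<le> 5 * t" if "\<bar>a\<bar> \<le> 4 * t" "\<bar>b\<bar> \<le> t / 2" "\<bar>c\<bar> \<le> t / 2" for a b c t :: real
      using that by linarith
    ultimately show ?thesis by (simp only: mult.assoc)
  qed
  have quad: "(\<Sum>i\<in>UNIV. \<Sum>j\<in>UNIV. v $ i * v $ j * ((d i \<bullet> (?H *v d j) + d j \<bullet> (?H *v d i)) / 2)) = 2 * q (Q *v s)"
  proof -
    have Qs: "Q *v s = (\<Sum>i\<in>UNIV. v $ i *\<^sub>R d i)"
      unfolding Dv[symmetric] d_def by (rule matrix_vector_columns)
    have 1: "(Q *v s) \<bullet> (?H *v (Q *v s)) = (\<Sum>i\<in>UNIV. \<Sum>j\<in>UNIV. v $ i * v $ j * (d j \<bullet> (?H *v d i)))"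
    proof -
      have "?H *v (Q *v s) = (\<Sum>i\<in>UNIV. v $ i *\<^sub>R (?H *v d i))"
        unfolding Qs linear_sum[OF matrix_vector_mul_linear] by (simp add: matrix_vector_mult_scaleR)
      then show ?thesis
        by (simp add: Qs inner_sum_left inner_sum_right sum_distrib_left mult.assoc)
    qed
    have 2: "(\<Sum>i\<in>UNIV. \<Sum>j\<in>UNIV. v $ i * v $ j * (d j \<bullet> (?H *v d i))) =
        (\<Sum>i\<in>UNIV. \<Sum>j\<in>UNIV. v $ i * v $ j * (d i \<bullet> (?H *v d j)))"
      by (subst sum.swap) (simp add: mult.commute)
    show ?thesis unfolding q_def
      by (simp add: 1 2 distrib_left add_divide_distrib sum.distrib sum_divide_distrib[symmetric])
  qed
  have "s \<bullet> (simplex_hessian (subspace_fun f x Q) 0 R *v s) =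
      (\<Sum>i\<in>UNIV. \<Sum>j\<in>UNIV. v $ i * v $ j * (f (x + d i + d j) - f (x + d i) - f (x + d j) + f x))"
    unfolding v_def d_def by (rule simplex_hessian_form[OF qr gram \<Delta>])
  also have "\<dots> = (\<Sum>i\<in>UNIV. \<Sum>j\<in>UNIV. v $ i * v $ j * ((d i \<bullet> (?H *v d j) + d j \<bullet> (?H *v d i)) / 2)
      + v $ i * v $ j * e i j)"
    by (intro sum.cong refl) (simp add: e_def right_diff_distrib)
  also have "\<dots> = 2 * q (Q *v s) + (\<Sum>i\<in>UNIV. \<Sum>j\<in>UNIV. v $ i * v $ j * e i j)"
    by (simp only: sum.distrib quad)
  finally have hess: "\<bar>s \<bullet> (simplex_hessian (subspace_fun f x Q) 0 R *v s) / 2 - q (Q *v s)\<bar> \<le> ?p\<^sup>2 * (5 * L * \<Delta> ^ 3) / 2"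
    using bilinear_form_bound[of e "5 * L * \<Delta> ^ 3" v, OF e v1] by linarith
  have nQs: "norm (Q *v s) = norm s"
  proof -
    have "(Q *v s) \<bullet> (Q *v s) = s \<bullet> ((transpose Q ** Q) *v s)"
      by (metis dot_lmul_matrix matrix_vector_mul_assoc transpose_matrix_vector inner_commute)
    then show ?thesis using qr by (simp add: is_qr_def norm_eq_sqrt_inner)
  qed
  have lin: "\<bar>?b \<bullet> s - ?g \<bullet> (Q *v s)\<bar> \<le> 3 * ?p * L * \<Delta> ^ 3"
  proof -
    have "?b \<bullet> s - ?g \<bullet> (Q *v s) = (?b - transpose Q *v ?g) \<bullet> s"
      by (simp add: inner_diff_left) (metis dot_lmul_matrix inner_commute transpose_matrix_vector)
    then have "\<bar>?b \<bullet> s - ?g \<bullet> (Q *v s)\<bar> \<le> norm (?b - transpose Q *v ?g) * norm s"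
      using Cauchy_Schwarz_ineq2 by metis
    also have "\<dots> \<le> (3 * ?p * L * \<Delta>\<^sup>2) * \<Delta>"
      using grad s \<Delta> L by (intro mult_mono) auto
    finally show ?thesis by (simp add: power3_eq_cube power2_eq_square mult_ac)
  qed
  have "\<bar>f (x + Q *v s) - f x - ?g \<bullet> (Q *v s) - q (Q *v s)\<bar> \<le> L / 2 * \<Delta> ^ 3"
  proof -
    have "L / 2 * norm (Q *v s) ^ 3 \<le> L / 2 * \<Delta> ^ 3"
      unfolding nQs using s L by (intro mult_left_mono power_mono) auto
    then show ?thesis using T[of "Q *v s"] by linarith
  qed
  with hess lin have "\<bar>quad_model f x Q R s - f (x + Q *v s)\<bar>
      \<le> 3 * ?p * L * \<Delta> ^ 3 + ?p\<^sup>2 * (5 * L * \<Delta> ^ 3) / 2 + L / 2 * \<Delta> ^ 3"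
    unfolding quad_model_eq by linarith
  \<comment> \<open>3p + 5p^2/2 + 1/2 is at most 6p^2 because p is at least 1.\<close>
  also have "\<dots> \<le> 6 * ?p\<^sup>2 * (L * \<Delta> ^ 3)"
  proof -
    have p1: "?p \<ge> 1" using zero_less_card_finite[where 'a='p] by linarith
    then have p2: "?p \<le> ?p\<^sup>2" by (rule self_le_power) simp
    have "3 * ?p + ?p\<^sup>2 * 5 / 2 + 1 / 2 \<le> 6 * ?p\<^sup>2" using p1 p2 by linarith
    then have "(3 * ?p + ?p\<^sup>2 * 5 / 2 + 1 / 2) * (L * \<Delta> ^ 3) \<le> 6 * ?p\<^sup>2 * (L * \<Delta> ^ 3)"
      using L \<Delta> by (intro mult_right_mono) auto
    then show ?thesis by (simp add: algebra_simps)
  qed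
  finally show "\<bar>quad_model f x Q R s - f (x + Q *v s)\<bar> \<le> 6 * ?p\<^sup>2 * L * \<Delta> ^ 3" by simp
qed

section \<open>Lists of directions\<close>

text \<open>Take v maximizing the Rayleigh quotient on the unit sphere. Moving v along the residual
  w = T v - l v would raise the quotient to first order, unless w = 0.\<close>

lemma selfadjoint_max_eigenvector:
  fixes T :: "'a::euclidean_space \<Rightarrow> 'a"
  assumes lin: "linear T" and sym: "\<And>x y. T x \<bullet> y = x \<bullet> T y"
  obtains v where "norm v = 1" "T v = (v \<bullet> T v) *\<^sub>R v" "\<And>w. w \<bullet> T w \<le> (v \<bullet> T v) * (norm w)\<^sup>2"
proof -
  have "continuous_on (sphere 0 1) (\<lambda>v. v \<bullet> T v)"
    using lin by (intro continuous_intros linear_continuous_on) (simp add: linear_conv_bounded_linear)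
  moreover have "sphere (0::'a) 1 \<noteq> {}" by simp
  ultimately obtain v where v: "norm v = 1" "\<And>w. norm w = 1 \<Longrightarrow> w \<bullet> T w \<le> v \<bullet> T v"
    using continuous_attains_sup[of "sphere (0::'a) 1" "\<lambda>v. v \<bullet> T v"] by auto
  define l where "l = v \<bullet> T v"
  have max: "w \<bullet> T w \<le> l * (norm w)\<^sup>2" for w
  proof (cases "w = 0")
    case False
    define u where "u = (1 / norm w) *\<^sub>R w"
    have w: "w = norm w *\<^sub>R u" and "norm u = 1" using False by (auto simp: u_def)
    then have "u \<bullet> T u \<le> l" using v(2) l_def by blast
    then have "(norm w)\<^sup>2 * (u \<bullet> T u) \<le> (norm w)\<^sup>2 * l" by (intro mult_left_mono) auto
    moreover have "w \<bullet> T w = (norm w)\<^sup>2 * (u \<bullet> T u)"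
      by (subst (1 2) w) (simp add: linear_scale[OF lin] power2_eq_square)
    ultimately show ?thesis by (simp add: mult.commute)
  qed (simp add: linear_0[OF lin])
  define w where "w = T v - l *\<^sub>R v"
  have vv: "v \<bullet> v = 1" using v(1) by (simp add: norm_eq_1)
  have vw: "w \<bullet> v = 0" by (simp add: w_def inner_diff_left vv l_def inner_commute[of "T v" v])
  have Tv: "T v = w + l *\<^sub>R v" by (simp add: w_def)
  have wT: "w \<bullet> T v = w \<bullet> w" by (simp add: Tv inner_add_right vw)
  have ineq: "2 * t * (w \<bullet> w) + t\<^sup>2 * (w \<bullet> T w - l * (w \<bullet> w)) \<le> 0" for t
  proof -
    have "(v + t *\<^sub>R w) \<bullet> T (v + t *\<^sub>R w) = l + 2 * t * (w \<bullet> w) + t\<^sup>2 * (w \<bullet> T w)"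
      using wT sym[of v w]
      by (simp add: linear_add[OF lin] linear_scale[OF lin] inner_add_left inner_add_right
          l_def power2_eq_square inner_commute algebra_simps)
    moreover have "(norm (v + t *\<^sub>R w))\<^sup>2 = 1 + t\<^sup>2 * (w \<bullet> w)"
      unfolding power2_norm_eq_inner
      by (simp add: inner_add_left inner_add_right vv vw inner_commute[of v w] power2_eq_square)
    ultimately show ?thesis using max[of "v + t *\<^sub>R w"] by (simp add: algebra_simps)
  qed
  have "w \<bullet> w = 0"
  proof (rule ccontr)
    assume "w \<bullet> w \<noteq> 0"
    then have pos: "w \<bullet> w > 0" by (simp add: order_less_le)
    define c where "c = \<bar>w \<bullet> T w - l * (w \<bullet> w)\<bar> + 1"
    have c: "c > 0" "w \<bullet> T w - l * (w \<bullet> w) \<ge> - c" by (auto simp: c_def)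
    \<comment> \<open>For this t the quadratic loss, at most t^2 c = t |w|^2, is only half of the
      linear gain 2 t |w|^2.\<close>
    define t where "t = (w \<bullet> w) / c"
    have "t > 0" using pos c by (simp add: t_def)
    have "2 * t * (w \<bullet> w) \<le> t\<^sup>2 * c"
      using ineq[of t] mult_left_mono[OF c(2), of "t\<^sup>2"] by simp
    also have "t\<^sup>2 * c = t * (w \<bullet> w)" using c by (simp add: t_def power2_eq_square)
    finally show False using \<open>t > 0\<close> pos by simp
  qed
  then have "T v = l *\<^sub>R v" by (simp add: w_def)
  then show thesis using that[OF v(1)] max unfolding l_def by blast
qed

text \<open>The infimum in \<open>sigma_min\<close> says nothing about an empty set. An eigenvector
  of the Gram matrix M^T M comes from one of M M^T: if M M^T v = l v with l > 0, then M^T v works.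
  If the largest l is 0, all directions vanish and any coefficients do.\<close>

lemma singular_values_nonempty:
  assumes "ds \<noteq> []"
  shows "singular_values ds \<noteq> {}"
proof -
  define T where "T v = (\<Sum>i<length ds. (ds ! i \<bullet> v) *\<^sub>R ds ! i)" for v
  have lin: "linear T"
    unfolding T_def by (intro linear_compose_sum) (auto intro!: linearI simp: inner_add_right scaleR_add_left)
  have sym: "T x \<bullet> y = x \<bullet> T y" for x y
    by (simp add: T_def inner_sum_left inner_sum_right inner_commute mult.commute)
  have form: "w \<bullet> T w = (\<Sum>i<length ds. (ds ! i \<bullet> w)\<^sup>2)" for w
    by (simp add: T_def inner_sum_right power2_eq_square inner_commute)
  obtain v where v: "norm v = 1" "T v = (v \<bullet> T v) *\<^sub>R v" "\<And>w. w \<bullet> T w \<le> (v \<bullet> T v) * (norm w)\<^sup>2"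
    using selfadjoint_max_eigenvector[OF lin sym] by blast
  define l where "l = v \<bullet> T v"
  have l0: "l \<ge> 0" unfolding l_def form by (intro sum_nonneg) auto
  show ?thesis
  proof (cases "l = 0")
    case True
    have z: "ds ! j = 0" if "j < length ds" for j
    proof -
      have "(ds ! j \<bullet> ds ! j)\<^sup>2 \<le> (\<Sum>i<length ds. (ds ! i \<bullet> ds ! j)\<^sup>2)"
        using that by (intro member_le_sum) auto
      also have "\<dots> \<le> 0" using v(3)[of "ds ! j"] True unfolding form[symmetric] l_def by simp
      finally show ?thesis by simp
    qed
    have "0 \<in> singular_values ds"
      unfolding singular_values_def using assms z by (auto intro!: exI[of _ "\<lambda>_. 1"])
    then show ?thesis by blast
  next
    case False
    define c where "c i = ds ! i \<bullet> v" for i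
    have Tv: "(\<Sum>i<length ds. c i *\<^sub>R ds ! i) = l *\<^sub>R v"
      using v(2) unfolding l_def[symmetric] by (simp add: T_def c_def)
    have "\<exists>j<length ds. c j \<noteq> 0"
    proof (rule ccontr)
      assume "\<not> ?thesis"
      then have "l *\<^sub>R v = 0" unfolding Tv[symmetric] by simp
      then show False using False v(1) by auto
    qed
    then have "sqrt l \<in> singular_values ds"
      unfolding singular_values_def using l0
      by (auto intro!: exI[of _ c] simp: Tv) (simp add: c_def)
    then show ?thesis by blast
  qed
qed

text \<open>Read the eigenvalue equation at the coefficient of largest modulus: it gives \<sigma>^2
  <= m B^2, with m the number of directions. This is relaxed to m^2 B^2 to avoid a square
  root.\<close>

lemma sigma_min_le:
  assumes "ds \<noteq> []" and B: "\<And>d. d \<in> set ds \<Longrightarrow> norm d \<le> B"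
  shows "sigma_min ds \<le> real (length ds) * B"
proof -
  let ?m = "length ds"
  obtain \<sigma> where \<sigma>: "\<sigma> \<in> singular_values ds" using singular_values_nonempty[OF assms(1)] by blast
  then obtain c j0 where c: "\<sigma> \<ge> 0" "j0 < ?m" "c j0 \<noteq> 0"
    "\<And>j. j < ?m \<Longrightarrow> ds ! j \<bullet> (\<Sum>i<?m. c i *\<^sub>R ds ! i) = \<sigma>\<^sup>2 * c j"
    unfolding singular_values_def by blast
  have B0: "B \<ge> 0" using B[of "hd ds"] assms(1) by (meson hd_in_set norm_ge_zero order_trans)
  define mx where "mx = Max ((\<lambda>j. \<bar>c j\<bar>) ` {..<?m})"
  have ne: "{..<?m} \<noteq> {}" using c(2) by auto
  have le: "\<bar>c j\<bar> \<le> mx" if "j < ?m" for j unfolding mx_def using that by (intro Max_ge) auto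
  have "mx > 0" using le[OF c(2)] c(3) by linarith
  have "mx \<in> (\<lambda>j. \<bar>c j\<bar>) ` {..<?m}" unfolding mx_def by (rule Max_in) (use ne in auto)
  then obtain j where j: "j < ?m" "\<bar>c j\<bar> = mx" by auto
  have "\<sigma>\<^sup>2 * mx = \<bar>ds ! j \<bullet> (\<Sum>i<?m. c i *\<^sub>R ds ! i)\<bar>"
    using c(4)[OF j(1)] j(2) by (simp add: abs_mult)
  also have "\<dots> \<le> norm (ds ! j) * norm (\<Sum>i<?m. c i *\<^sub>R ds ! i)" by (rule Cauchy_Schwarz_ineq2)
  also have "\<dots> \<le> B * (\<Sum>i<?m. mx * B)"
  proof (rule mult_mono)
    have "norm (c i *\<^sub>R ds ! i) \<le> mx * B" if "i \<in> {..<?m}" for i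
      using that le[of i] B[of "ds ! i"] \<open>mx > 0\<close> by (auto intro!: mult_mono)
    then show "norm (\<Sum>i<?m. c i *\<^sub>R ds ! i) \<le> (\<Sum>i<?m. mx * B)"
      by (intro order_trans[OF norm_sum] sum_mono) auto
    show "norm (ds ! j) \<le> B" using B j(1) by simp
    show "0 \<le> B" by (rule B0)
    show "0 \<le> norm (\<Sum>i<?m. c i *\<^sub>R ds ! i)" by (rule norm_ge_zero)
  qed
  also have "\<dots> = real ?m * B\<^sup>2 * mx" by (simp add: power2_eq_square)
  finally have "\<sigma>\<^sup>2 \<le> real ?m * B\<^sup>2" using \<open>mx > 0\<close> by simp
  also have "\<dots> \<le> (real ?m)\<^sup>2 * B\<^sup>2"
  proof -
    have "1 \<le> real ?m" using assms(1) by (cases ds) auto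
    then have "real ?m \<le> (real ?m)\<^sup>2" by (rule self_le_power) simp
    then show ?thesis by (rule mult_right_mono) simp
  qed
  finally have "\<sigma> \<le> real ?m * B"
  proof (rule power2_le_imp_le[OF order_trans])
    show "(real ?m)\<^sup>2 * B\<^sup>2 \<le> (real ?m * B)\<^sup>2" by (simp add: power_mult_distrib)
    show "0 \<le> real ?m * B" using B0 by simp
  qed
  moreover have "sigma_min ds \<le> \<sigma>"
    unfolding sigma_min_def using \<sigma> by (intro cInf_lower bdd_belowI[of _ 0]) (auto simp: singular_values_def)
  ultimately show ?thesis by simp
qed

section \<open>How many directions are kept\<close>

lemma removal_step_imp:
  assumes "removal_step \<Delta> as bs"
  shows "Suc (length bs) = length as" "set bs \<subseteq> set as"
  using assms unfolding removal_step_def remove_nth_def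
  by (auto dest: in_set_takeD in_set_dropD)

lemma removal_steps_length:
  "(removal_step \<Delta> ^^ k) as bs \<Longrightarrow> length bs + k = length as"
proof (induction k arbitrary: bs)
  case (Suc k)
  then obtain cs where "(removal_step \<Delta> ^^ k) as cs" "removal_step \<Delta> cs bs" by auto
  then show ?case using Suc.IH removal_step_imp(1) by fastforce
qed simp

lemma guarded_removal_imp:
  assumes "(\<lambda>as bs. as \<noteq> [] \<and> sigma_min as < e \<and> removal_step \<Delta> as bs)\<^sup>*\<^sup>* as bs"
  shows "length bs \<le> length as \<and> set bs \<subseteq> set as"
  using assms
proof (induction rule: rtranclp_induct)
  case (step bs cs)
  then show ?case using removal_step_imp[of \<Delta> bs cs] by auto
qed simp

text \<open>Since \<open>p_rand\<close> is at least 1, this guarantees a new random direction after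
  every noncritical iteration.\<close>

lemma keeps_dirs_length:
  fixes S :: "('n::finite, 'p::{finite,linorder}) qarsta_state"
  assumes "keeps_dirs P S x \<Delta> ds"
  shows "length ds + p_rand P \<le> CARD('p)"
proof -
  from assms obtain ds0 ds1 where *: "length ds0 = CARD('p)" "(removal_step \<Delta> ^^ p_rand P) ds0 ds1"
    "(\<lambda>as bs. as \<noteq> [] \<and> sigma_min as < eps_geo P \<and> removal_step \<Delta> as bs)\<^sup>*\<^sup>*
      (filter (\<lambda>d. norm d \<le> eps_rad P * \<Delta>) ds1) ds"
    unfolding keeps_dirs_def by blast
  have "length ds \<le> length (filter (\<lambda>d. norm d \<le> eps_rad P * \<Delta>) ds1)"
    using guarded_removal_imp[OF *(3)] by blast
  also have "\<dots> \<le> length ds1" by (rule length_filter_le)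
  finally show ?thesis using removal_steps_length[OF *(2)] *(1) by linarith
qed

text \<open>The threshold \<^term>\<open>eps_geo P\<close> is not scaled by the radius, so short directions never pass.\<close>

lemma keeps_dirs_empty:
  fixes S :: "('n::finite, 'p::{finite,linorder}) qarsta_state"
  assumes keeps: "keeps_dirs P S x \<Delta> ds" and small: "real CARD('p) * (eps_rad P * \<Delta>) < eps_geo P"
    and nonneg: "0 \<le> eps_rad P * \<Delta>"
  shows "ds = []"
proof (rule ccontr)
  assume ne: "ds \<noteq> []"
  from keeps obtain ds1 where *: "(\<lambda>as bs. as \<noteq> [] \<and> sigma_min as < eps_geo P \<and> removal_step \<Delta> as bs)\<^sup>*\<^sup>*
      (filter (\<lambda>d. norm d \<le> eps_rad P * \<Delta>) ds1) ds"
    unfolding keeps_dirs_def by blast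
  have "sigma_min ds \<le> real (length ds) * (eps_rad P * \<Delta>)"
    using guarded_removal_imp[OF *] by (intro sigma_min_le[OF ne]) auto
  also have "\<dots> \<le> real CARD('p) * (eps_rad P * \<Delta>)"
    using keeps_dirs_length[OF keeps] nonneg by (intro mult_right_mono) auto
  finally show False using small keeps ne unfolding keeps_dirs_def by force
qed

section \<open>Orthogonality of generated directions and their relation to the Gaussian
  matrix\<close>

lemma length_cols: "length (cols (D :: real^'p::{finite,linorder}^'n)) = CARD('p)"
  by (simp add: cols_def)

lemma set_cols: "set (cols D) = range (\<lambda>j. column j D)"
  by (simp add: cols_def)

lemma column_inner_of_cols:
  fixes D :: "real^'p::{finite,linorder}^'n"
  assumes "cols D = map (\<lambda>v. \<Delta> *\<^sub>R v) qs" "orthonormal_list qs"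
  shows "column i D \<bullet> column j D = (if i = j then \<Delta>\<^sup>2 else 0)"
proof -
  let ?xs = "sorted_list_of_set (UNIV :: 'p set)"
  have len: "length ?xs = CARD('p)" "length qs = CARD('p)"
    using length_cols[of D] assms(1) by simp_all
  obtain a where a: "a < CARD('p)" "?xs ! a = i"
    using len(1) by (metis UNIV_I finite in_set_conv_nth set_sorted_list_of_set)
  obtain b where b: "b < CARD('p)" "?xs ! b = j"
    using len(1) by (metis UNIV_I finite in_set_conv_nth set_sorted_list_of_set)
  have col: "column (?xs ! c) D = \<Delta> *\<^sub>R qs ! c" if "c < CARD('p)" for c
    using arg_cong[OF assms(1), of "\<lambda>l. l ! c"] that len by (simp add: cols_def)
  have "a = b \<longleftrightarrow> i = j"
    using a b len distinct_sorted_list_of_set[of "UNIV :: 'p set"] by (metis nth_eq_iff_index_eq)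
  then show ?thesis
    using col[OF a(1)] col[OF b(1)] assms(2) a b len
    by (simp add: orthonormal_list_def power2_eq_square)
qed

lemma forms_dirs_length_gen_mat:
  assumes "forms_dirs S"
  shows "length (gen_mat S) = n_gen S"
  using assms length_cols[of "dir_mat S"]
  by (auto simp: forms_dirs_def gen_dirs_def is_qr_list_def)

text \<open>By triangularity the first column involves only the first orthonormal vector. This is
  the link from a Gaussian column to the sample directions.\<close>

lemma is_qr_list_head:
  assumes "is_qr_list as qs R" "as \<noteq> []"
  shows "as ! 0 = R 0 0 *\<^sub>R qs ! 0" "norm (qs ! 0) = 1"
proof -
  have "as ! 0 = (\<Sum>i<length as. R i 0 *\<^sub>R qs ! i)"
    using assms unfolding is_qr_list_def by blast
  also have "\<dots> = (\<Sum>i\<in>{0}. R i 0 *\<^sub>R qs ! i)"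
    using assms by (intro sum.mono_neutral_right) (auto simp: is_qr_list_def)
  finally show "as ! 0 = R 0 0 *\<^sub>R qs ! 0" by simp
  show "norm (qs ! 0) = 1"
    using assms by (simp add: is_qr_list_def orthonormal_list_def norm_eq_1)
qed

text \<open>Generating all p directions leaves no kept one. The basis \<open>Qb\<close> then spans
  only 0, and as its members are unit vectors it is empty, so the matrix is factorized without
  projection.\<close>

lemma forms_dirs_orthonormal:
  fixes S :: "('n::finite, 'p::{finite,linorder}) qarsta_state"
  assumes forms: "forms_dirs S" and n_gen: "n_gen S = CARD('p)"
  obtains qs R where "cols (dir_mat S) = map (\<lambda>v. radius S *\<^sub>R v) qs" "is_qr_list (gen_mat S) qs R"
proof -
  from forms obtain Qb ds where *: "orthonormal_list Qb" "span (set Qb) = span (set (kept_dirs S))"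
    "gen_dirs Qb (gen_mat S) (radius S) ds" "cols (dir_mat S) = kept_dirs S @ ds"
    "n_gen S = CARD('p) - length (kept_dirs S)"
    unfolding forms_dirs_def by blast
  have kept: "kept_dirs S = []"
    using *(5) n_gen zero_less_card_finite[where 'a='p] by (metis add_diff_cancel_left' diff_is_0_eq'
      le_add_diff_inverse2 length_0_conv less_numeral_extra(3) nat_le_linear)
  have "Qb = []"
  proof (rule ccontr)
    assume "Qb \<noteq> []"
    then have "Qb ! 0 \<in> span (set (kept_dirs S))" "Qb ! 0 \<bullet> Qb ! 0 = 1"
      using *(1,2) span_base[of "Qb ! 0" "set Qb"] by (auto simp: orthonormal_list_def)
    then show False by (simp add: kept)
  qed
  with *(3,4) kept that show thesis by (auto simp: gen_dirs_def)
qed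

lemma forms_dirs_gram:
  fixes S :: "('n::finite, 'p::{finite,linorder}) qarsta_state"
  assumes "forms_dirs S" "n_gen S = CARD('p)"
  shows "transpose (dir_mat S) ** dir_mat S = (radius S)\<^sup>2 *\<^sub>R mat 1"
proof -
  obtain qs R where qs: "cols (dir_mat S) = map (\<lambda>v. radius S *\<^sub>R v) qs" "is_qr_list (gen_mat S) qs R"
    using forms_dirs_orthonormal[OF assms] .
  have "(transpose (dir_mat S) ** dir_mat S) $ i $ j = column i (dir_mat S) \<bullet> column j (dir_mat S)" for i j
    by (simp add: matrix_matrix_mult_def transpose_def column_def inner_vec_def)
  then show ?thesis
    using column_inner_of_cols[OF qs(1)] qs(2) by (simp add: is_qr_list_def vec_eq_iff mat_def)
qed

text \<open>The first generated column is a multiple of a unit vector in the range of Q, and the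
  component of g along such a vector is at most |Q^T g|.\<close>

lemma forms_dirs_first_le:
  fixes S :: "('n::finite, 'p::{finite,linorder}) qarsta_state"
  assumes forms: "forms_dirs S" and n_gen: "n_gen S = CARD('p)" and rad: "radius S > 0"
    and qr: "is_qr (dir_mat S) Q R"
  shows "\<bar>gen_mat S ! 0 \<bullet> g\<bar> \<le> norm (gen_mat S ! 0) * norm (transpose Q *v g)"
proof -
  obtain qs T where qs: "cols (dir_mat S) = map (\<lambda>v. radius S *\<^sub>R v) qs" "is_qr_list (gen_mat S) qs T"
    using forms_dirs_orthonormal[OF forms n_gen] .
  have ne: "gen_mat S \<noteq> []" "qs \<noteq> []"
    using forms_dirs_length_gen_mat[OF forms] n_gen qs(2) by (auto simp: is_qr_list_def)
  note head = is_qr_list_head[OF qs(2) ne(1)]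
  have "radius S *\<^sub>R qs ! 0 \<in> set (cols (dir_mat S))"
    using ne(2) by (auto simp: qs(1))
  then obtain i where i: "column i (dir_mat S) = radius S *\<^sub>R qs ! 0"
    unfolding set_cols by auto
  have "radius S * (qs ! 0 \<bullet> g) = column i (dir_mat S) \<bullet> g" by (simp add: i)
  also have "\<dots> = (transpose R *v (transpose Q *v g)) $ i"
    by (simp only: is_qr_transpose_vector[OF qr] transpose_matrix_vector_nth)
  also have "\<dots> = column i R \<bullet> (transpose Q *v g)" by (rule transpose_matrix_vector_nth)
  finally have "radius S * \<bar>qs ! 0 \<bullet> g\<bar> \<le> norm (column i R) * norm (transpose Q *v g)"
    using rad Cauchy_Schwarz_ineq2 by (metis abs_mult abs_of_pos)
  also have "norm (column i R) = radius S"
    using rad head(2) by (simp add: is_qr_norm_column[OF qr] i)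
  finally have "\<bar>qs ! 0 \<bullet> g\<bar> \<le> norm (transpose Q *v g)" using rad by simp
  then show ?thesis by (simp only: head(1) inner_scaleR_left abs_mult norm_scaleR head(2) mult_1_right mult_left_mono abs_ge_zero)
qed

text \<open>Here kept directions may be present. The first generated column is its projection onto
  their span plus a multiple of a new direction, and g is orthogonal to both parts.\<close>

lemma forms_dirs_orthogonal_imp:
  assumes forms: "forms_dirs S" and n_gen: "n_gen S \<ge> 1" and rad: "radius S > 0"
    and orth: "transpose (dir_mat S) *v g = 0"
  shows "gen_mat S ! 0 \<bullet> g = 0"
proof -
  from forms obtain Qb ds where *: "orthonormal_list Qb" "span (set Qb) = span (set (kept_dirs S))"
    "gen_dirs Qb (gen_mat S) (radius S) ds" "cols (dir_mat S) = kept_dirs S @ ds"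
    unfolding forms_dirs_def by blast
  have "column i (dir_mat S) \<bullet> g = 0" for i
    using arg_cong[OF orth, of "\<lambda>v. v $ i"] by (simp only: transpose_matrix_vector_nth zero_index)
  then have cols: "d \<bullet> g = 0" if "d \<in> set (cols (dir_mat S))" for d
    using that unfolding set_cols by auto
  let ?proj = "\<lambda>a. a - (\<Sum>u\<leftarrow>Qb. (u \<bullet> a) *\<^sub>R u)"
  obtain qs T where qs: "is_qr_list (map ?proj (gen_mat S)) qs T" "ds = map (\<lambda>v. radius S *\<^sub>R v) qs"
    using *(3) unfolding gen_dirs_def by blast
  have ne: "gen_mat S \<noteq> []" "qs \<noteq> []"
    using forms_dirs_length_gen_mat[OF forms] n_gen qs(1) by (auto simp: is_qr_list_def)
  have "radius S *\<^sub>R qs ! 0 \<in> set ds" using ne(2) by (auto simp: qs(2))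
  then have "(radius S *\<^sub>R qs ! 0) \<bullet> g = 0" by (intro cols) (simp add: *(4))
  then have "qs ! 0 \<bullet> g = 0" using rad by simp
  moreover have "?proj (gen_mat S ! 0) = T 0 0 *\<^sub>R qs ! 0"
    using is_qr_list_head(1)[OF qs(1)] ne(1) by simp
  ultimately have "?proj (gen_mat S ! 0) \<bullet> g = 0" by simp
  moreover have "(\<Sum>u\<leftarrow>us. (u \<bullet> a) *\<^sub>R u) \<bullet> g = 0" if "\<And>u. u \<in> set us \<Longrightarrow> u \<bullet> g = 0" for us a
    using that by (induction us) (auto simp: inner_add_left)
  moreover have "u \<bullet> g = 0" if "u \<in> set Qb" for u
  proof -
    have "u \<in> span (set (kept_dirs S))" using that *(2) span_base by blast
    moreover have "orthogonal g d" if "d \<in> set (kept_dirs S)" for d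
      using cols[of d] that *(4) by (simp add: orthogonal_def inner_commute)
    ultimately have "orthogonal g u" using orthogonal_to_span by blast
    then show ?thesis by (simp add: orthogonal_def inner_commute)
  qed
  ultimately show ?thesis by (simp add: inner_diff_left)
qed

lemma norm_head_le_mnorm_list:
  assumes "as \<noteq> []"
  shows "norm (as ! 0) \<le> mnorm_list as"
proof -
  let ?S = "{norm (\<Sum>j<length as. c j *\<^sub>R as ! j) | c. L2_set c {..<length as} = 1}"
  \<comment> \<open>A supremum dominates its members only over a bounded set; unit coefficient
    vectors have entries of modulus at most 1.\<close>
  have "bdd_above ?S"
  proof (rule bdd_aboveI[of _ "\<Sum>j<length as. norm (as ! j)"])
    fix x assume "x \<in> ?S"
    then obtain c where c: "x = norm (\<Sum>j<length as. c j *\<^sub>R as ! j)" "L2_set c {..<length as} = 1" by blast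
    have "\<bar>c j\<bar> \<le> 1" if "j < length as" for j
      using member_le_L2_set[of "{..<length as}" j "\<lambda>j. \<bar>c j\<bar>"] that c(2) by (simp add: L2_set_def)
    then show "x \<le> (\<Sum>j<length as. norm (as ! j))"
      unfolding c(1) by (intro order_trans[OF norm_sum] sum_mono) (auto intro: mult_left_le_one_le)
  qed
  moreover have "norm (as ! 0) \<in> ?S"
  proof -
    define c :: "nat \<Rightarrow> real" where "c j = (if j = 0 then 1 else 0)" for j
    have "(\<Sum>j<length as. c j *\<^sub>R as ! j) = (\<Sum>j\<in>{0}. c j *\<^sub>R as ! j)"
      using assms by (intro sum.mono_neutral_right) (auto simp: c_def)
    moreover have "(\<Sum>j<length as. (c j)\<^sup>2) = (\<Sum>j\<in>{0}. (c j)\<^sup>2)"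
      using assms by (intro sum.mono_neutral_right) (auto simp: c_def)
    ultimately show ?thesis
      by (auto intro!: exI[of _ c] simp: L2_set_def c_def)
  qed
  ultimately show ?thesis unfolding mnorm_list_def by (rule cSup_upper[rotated])
qed

section \<open>The law of the generated directions\<close>

text \<open>u may be nonmeasurable, so the argument uses the simple functions below u: doubling one
  of them keeps it below u. Hence 2 I <= I for the integral I.\<close>

lemma nn_integral_zero_or_top:
  assumes u: "\<And>x. u x = 0 \<or> u x = top"
  shows "integral\<^sup>N M u = 0 \<or> integral\<^sup>N M u = top"
proof -
  have "2 * integral\<^sup>N M u = (SUP g\<in>{g. simple_function M g \<and> g \<le> u}. 2 * integral\<^sup>S M g)"
    unfolding nn_integral_def by (rule SUP_mult_left_ennreal)
  also have "\<dots> \<le> integral\<^sup>N M u"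
  proof (rule SUP_least)
    fix g assume g: "g \<in> {g. simple_function M g \<and> g \<le> u}"
    have "(\<lambda>x. 2 * g x) \<le> u"
    proof (rule le_funI)
      fix x show "2 * g x \<le> u x" using g u[of x] by (auto simp: le_fun_def dest!: spec[of _ x])
    qed
    moreover have "simple_function M (\<lambda>x. 2 * g x)" using g by auto
    ultimately have "integral\<^sup>S M (\<lambda>x. 2 * g x) \<le> integral\<^sup>N M u"
      unfolding nn_integral_def by (intro SUP_upper) auto
    then show "2 * integral\<^sup>S M g \<le> integral\<^sup>N M u" using g by simp
  qed
  finally have "2 * integral\<^sup>N M u \<le> integral\<^sup>N M u" .
  then show ?thesis by (cases "integral\<^sup>N M u") (auto simp: ennreal_mult[symmetric] simp flip: ennreal_numeral)
qed

text \<open>This includes the case that \<^term>\<open>A\<close> is not measurable, where \<^const>\<open>emeasure\<close> is zero by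
  convention; the measurability of the conditioning event of the direction generation is
  therefore not an issue.\<close>

lemma measure_uniform_measure_null:
  assumes "emeasure M A = 0"
  shows "measure (uniform_measure M A) B = 0"
proof -
  let ?u = "\<lambda>x. indicator A x / emeasure M A * indicator B x :: ennreal"
  have "?u x = 0 \<or> ?u x = top" for x
    by (simp add: assms divide_ennreal_def indicator_def)
  then have "integral\<^sup>N M ?u = 0 \<or> integral\<^sup>N M ?u = top" by (rule nn_integral_zero_or_top)
  \<comment> \<open>\<open>emeasure_measure_of_conv\<close> yields either this integral or the
    default 0. In the end \<open>measure\<close> sends top to 0.\<close>
  then have "emeasure (uniform_measure M A) B = 0 \<or> emeasure (uniform_measure M A) B = top"
    unfolding uniform_measure_def density_def emeasure_measure_of_conv by auto
  then show ?thesis by (auto simp: measure_def)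
qed

text \<open>The default 0 agrees with the padding in \<open>dirs_space\<close>, which makes this map
  a coordinate and hence measurable.\<close>

definition first_dir :: "(real^'n) list \<Rightarrow> real^'n" where
  "first_dir as = (if 0 < length as then as ! 0 else 0)"

lemma space_dirs_space [simp]: "space dirs_space = UNIV"
  by (simp add: dirs_space_def)

lemma measurable_first_dir [measurable]: "first_dir \<in> measurable dirs_space borel"
proof -
  have "(\<lambda>ds :: (real^'n) list. (length ds, \<lambda>i. if i < length ds then ds ! i else 0))
      \<in> measurable dirs_space (count_space UNIV \<Otimes>\<^sub>M PiM (UNIV :: nat set) (\<lambda>_. borel))"
    unfolding dirs_space_def by (rule measurable_vimage_algebra1) (auto simp: space_pair_measure space_PiM)
  then have "(\<lambda>ds :: (real^'n) list. snd (length ds, \<lambda>i. if i < length ds then ds ! i else 0) 0)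
      \<in> borel_measurable dirs_space"
    by measurable
  then show ?thesis by (simp add: first_dir_def[abs_def])
qed

section \<open>Anti-concentration of a Gaussian column\<close>

text \<open>Rounding sqrt(2 pi) down to 2 makes the mass of an interval of length 2t at most
  t/\<sigma>.\<close>

lemma normal_density_le: "\<sigma> > 0 \<Longrightarrow> normal_density \<mu> \<sigma> x \<le> 1 / (2 * \<sigma>)"
proof -
  assume \<sigma>: "\<sigma> > 0"
  have "(2 * \<sigma>)\<^sup>2 \<le> 2 * pi * \<sigma>\<^sup>2"
    using pi_ge_two \<sigma> by (simp add: power_mult_distrib)
  then have "2 * \<sigma> \<le> sqrt (2 * pi * \<sigma>\<^sup>2)" by (rule real_le_rsqrt)
  then have "1 / sqrt (2 * pi * \<sigma>\<^sup>2) \<le> 1 / (2 * \<sigma>)" using \<sigma> by (intro divide_left_mono) auto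
  moreover have "normal_density \<mu> \<sigma> x \<le> 1 / sqrt (2 * pi * \<sigma>\<^sup>2) * 1"
    unfolding normal_density_def by (intro mult_left_mono) auto
  ultimately show ?thesis by simp
qed

lemma (in prob_space) normal_small_ball:
  assumes X: "distributed M lborel X (normal_density \<mu> \<sigma>)" and \<sigma>: "\<sigma> > 0" and t: "t \<ge> 0"
  shows "prob {\<omega> \<in> space M. \<bar>X \<omega>\<bar> \<le> t} \<le> t / \<sigma>"
proof -
  have "emeasure M (X -` {-t..t} \<inter> space M) = (\<integral>\<^sup>+x. ennreal (normal_density \<mu> \<sigma> x) * indicator {-t..t} x \<partial>lborel)"
    using distributed_emeasure[OF X] by simp
  also have "\<dots> \<le> (\<integral>\<^sup>+x. ennreal (1 / (2 * \<sigma>)) * indicator {-t..t} x \<partial>lborel)"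
    by (intro nn_integral_mono mult_right_mono ennreal_leI normal_density_le \<sigma>) simp
  also have "\<dots> = ennreal (1 / (2 * \<sigma>)) * ennreal (2 * t)"
    using t by (subst nn_integral_cmult_indicator) auto
  also have "\<dots> = ennreal (t / \<sigma>)"
    using t \<sigma> by (simp add: ennreal_mult[symmetric])
  finally have "emeasure M (X -` {-t..t} \<inter> space M) \<le> ennreal (t / \<sigma>)" .
  moreover have "X -` {-t..t} \<inter> space M = {\<omega> \<in> space M. \<bar>X \<omega>\<bar> \<le> t}" by auto
  ultimately show ?thesis using t \<sigma> by (simp add: emeasure_eq_measure)
qed

text \<open>The inner product of the first column with a unit vector is again normal with variance
  1/q, being a sum of independent normals.\<close>

lemma gaussian_first_dir_small_ball:
  fixes u :: "real^'n"
  assumes q: "q \<ge> 1" and u: "norm u = 1" and t: "t \<ge> 0"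
  shows "measure (distr (PiM ({..<q} \<times> (UNIV :: 'n set)) (\<lambda>_. density lborel (normal_density 0 (1 / sqrt (real q)))))
      dirs_space (\<lambda>a. map (\<lambda>j. \<chi> i. a (j, i)) [0..<q])) {as. \<bar>first_dir as \<bullet> u\<bar> \<le> t} \<le> t * sqrt (real q)"
    and "prob_space (distr (PiM ({..<q} \<times> (UNIV :: 'n set)) (\<lambda>_. density lborel (normal_density 0 (1 / sqrt (real q)))))
      dirs_space (\<lambda>a. map (\<lambda>j. \<chi> i. a (j, i)) [0..<q]))"
proof -
  define \<sigma> where "\<sigma> = 1 / sqrt (real q)"
  have \<sigma>: "\<sigma> > 0" using q by (simp add: \<sigma>_def)
  let ?I = "{..<q} \<times> (UNIV :: 'n set)"
  let ?N = "density lborel (normal_density 0 \<sigma>)"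
  let ?G = "PiM ?I (\<lambda>_. ?N)"
  let ?mk = "\<lambda>a :: nat \<times> 'n \<Rightarrow> real. map (\<lambda>j. \<chi> i. a (j, i)) [0..<q]"
  have N: "prob_space ?N" using prob_space_normal_density[OF \<sigma>] .
  interpret G: prob_space ?G by (intro prob_space_PiM N)
  have sets_G [measurable_cong]: "sets ?G = sets (PiM ?I (\<lambda>_. borel))" by (intro sets_PiM_cong) auto
  have mk: "?mk \<in> measurable ?G dirs_space"
    unfolding dirs_space_def
  proof (rule measurable_vimage_algebra2)
    show "(\<lambda>a. (length (?mk a), \<lambda>i. if i < length (?mk a) then ?mk a ! i else 0))
        \<in> measurable ?G (count_space UNIV \<Otimes>\<^sub>M PiM UNIV (\<lambda>_. borel))"
    proof (rule measurable_Pair)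
      show "(\<lambda>a. \<lambda>j. if j < length (?mk a) then ?mk a ! j else 0) \<in> measurable ?G (PiM UNIV (\<lambda>_. borel))"
      proof (rule measurable_PiM_single')
        fix j :: nat
        show "(\<lambda>a. if j < length (?mk a) then ?mk a ! j else 0) \<in> borel_measurable ?G"
        proof (cases "j < q")
          case True
          have "(\<lambda>a. (\<chi> i. a (j, i)) :: real^'n) \<in> borel_measurable ?G"
          proof (rule borel_measurable_euclidean_space[THEN iffD2], rule ballI)
            fix b :: "real^'n" assume "b \<in> Basis"
            then obtain i where b: "b = axis i 1" by (auto simp: Basis_vec_def)
            have "(\<lambda>a. a (j, i)) \<in> measurable ?G ?N"
              using True by (intro measurable_component_singleton) simp
            then have "(\<lambda>a. a (j, i)) \<in> borel_measurable ?G" by simp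
            then show "(\<lambda>a. (\<chi> i. a (j, i)) \<bullet> b) \<in> borel_measurable ?G" by (simp add: b inner_axis)
          qed
          then show ?thesis using True by simp
        next
          case False
          then show ?thesis by simp
        qed
      next
        show "(\<lambda>a. \<lambda>j. if j < length (?mk a) then ?mk a ! j else 0) \<in> space ?G \<rightarrow> (\<Pi>\<^sub>E i\<in>UNIV. space borel)"
          by simp
      qed
    next
      show "(\<lambda>a. length (?mk a)) \<in> measurable ?G (count_space UNIV)" by simp
    qed
  next
    show "?mk \<in> space ?G \<rightarrow> UNIV" by simp
  qed
  \<comment> \<open>Entries with zero coefficient are left out: they would contribute degenerate
    normals of variance 0.\<close>
  define K where "K = Pair (0::nat) ` {i. u $ i \<noteq> 0}"
  have K: "finite K" "K \<subseteq> ?I" using q by (auto simp: K_def)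
  have K_ne: "K \<noteq> {}"
  proof
    assume "K = {}"
    then have "u = 0" by (auto simp: K_def vec_eq_iff)
    then show False using u by simp
  qed
  have comp: "distr ?G ?N (\<lambda>a. a k) = ?N" if "k \<in> ?I" for k
    by (rule distr_PiM_component[OF N that])
  have indep: "G.indep_vars (\<lambda>_. ?N) (\<lambda>k a. a k) ?I"
  proof (subst G.indep_vars_iff_distr_eq_PiM')
    have "distr ?G ?G (\<lambda>x. \<lambda>i\<in>?I. x i) = distr ?G ?G (\<lambda>x. x)"
      by (intro distr_cong refl) (auto simp: space_PiM)
    also have "\<dots> = ?G" by (rule distr_id)
    also have "\<dots> = PiM ?I (\<lambda>i. distr ?G ?N (\<lambda>a. a i))"
      by (intro PiM_cong refl) (simp only: comp)
    finally show "distr ?G ?G (\<lambda>x. \<lambda>i\<in>?I. x i) = PiM ?I (\<lambda>i. distr ?G ?N (\<lambda>a. a i))" .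
    show "?I \<noteq> {}" using q by (auto simp: lessThan_empty_iff)
    show "(\<lambda>a. a i) \<in> measurable ?G ?N" if "i \<in> ?I" for i
      using that by (rule measurable_component_singleton)
  qed
  have indep': "G.indep_vars (\<lambda>_. borel) (\<lambda>k a. u $ snd k * a k) K"
    by (rule G.indep_vars_compose2[OF G.indep_vars_subset[OF indep K(2)]]) simp
  have normal: "distributed ?G lborel (\<lambda>a. u $ snd k * a k) (normal_density 0 (\<bar>u $ snd k\<bar> * \<sigma>))"
    if "k \<in> K" for k
  proof -
    have k: "k \<in> ?I" "u $ snd k \<noteq> 0" using that K(2) by (auto simp: K_def)
    have "distr ?G lborel (\<lambda>a. a k) = distr ?G ?N (\<lambda>a. a k)" by (rule distr_cong) auto
    then have "distributed ?G lborel (\<lambda>a. a k) (normal_density 0 \<sigma>)"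
      unfolding distributed_def using comp[OF k(1)] measurable_component_singleton[OF k(1), of "\<lambda>_. ?N"]
      by simp
    from G.normal_density_affine[OF this \<sigma> k(2), of 0] show ?thesis by simp
  qed
  have sum: "(\<Sum>k\<in>K. u $ snd k * a k) = first_dir (?mk a) \<bullet> u" for a :: "nat \<times> 'n \<Rightarrow> real"
  proof -
    have "(\<Sum>k\<in>K. u $ snd k * a k) = (\<Sum>i\<in>{i. u $ i \<noteq> 0}. u $ i * a (0, i))"
      unfolding K_def by (simp add: sum.reindex inj_on_def)
    also have "\<dots> = (\<Sum>i\<in>UNIV. u $ i * a (0, i))" by (intro sum.mono_neutral_left) auto
    also have "\<dots> = first_dir (?mk a) \<bullet> u"
      using q by (simp add: first_dir_def inner_vec_def mult.commute)
    finally show ?thesis .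
  qed
  have var: "sqrt (\<Sum>k\<in>K. (\<bar>u $ snd k\<bar> * \<sigma>)\<^sup>2) = \<sigma>"
  proof -
    have "(\<Sum>k\<in>K. (\<bar>u $ snd k\<bar> * \<sigma>)\<^sup>2) = (\<Sum>i\<in>{i. u $ i \<noteq> 0}. (u $ i)\<^sup>2 * \<sigma>\<^sup>2)"
      unfolding K_def by (simp add: sum.reindex inj_on_def power_mult_distrib)
    also have "\<dots> = (\<Sum>i\<in>UNIV. (u $ i)\<^sup>2 * \<sigma>\<^sup>2)" by (intro sum.mono_neutral_left) auto
    also have "\<dots> = (norm u)\<^sup>2 * \<sigma>\<^sup>2"
      unfolding power2_norm_eq_inner by (simp add: sum_distrib_right inner_vec_def power2_eq_square)
    finally show ?thesis using u \<sigma> by simp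
  qed
  have "distributed ?G lborel (\<lambda>a. \<Sum>k\<in>K. u $ snd k * a k)
      (normal_density (\<Sum>k\<in>K. 0) (sqrt (\<Sum>k\<in>K. (\<bar>u $ snd k\<bar> * \<sigma>)\<^sup>2)))"
    by (rule G.sum_indep_normal[OF K(1) K_ne indep' _ normal]) (use \<sigma> in \<open>auto simp: K_def\<close>)
  then have dist: "distributed ?G lborel (\<lambda>a. first_dir (?mk a) \<bullet> u) (normal_density 0 \<sigma>)"
    unfolding sum var by simp
  have "measure (distr ?G dirs_space ?mk) {as. \<bar>first_dir as \<bullet> u\<bar> \<le> t}
      = G.prob {a \<in> space ?G. \<bar>first_dir (?mk a) \<bullet> u\<bar> \<le> t}"
  proof -
    have "{as \<in> space dirs_space. \<bar>first_dir as \<bullet> u\<bar> \<le> t} \<in> sets dirs_space" by measurable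
    then have "{as. \<bar>first_dir as \<bullet> u\<bar> \<le> t} \<in> sets dirs_space" by simp
    from measure_distr[OF mk this] show ?thesis
      by (simp add: vimage_def Int_def conj_commute)
  qed
  also have "\<dots> \<le> t / \<sigma>" by (rule G.normal_small_ball[OF dist \<sigma> t])
  finally show "measure (distr ?G dirs_space ?mk) {as. \<bar>first_dir as \<bullet> u\<bar> \<le> t} \<le> t * sqrt (real q)"
    by (simp add: \<sigma>_def)
  show "prob_space (distr ?G dirs_space ?mk)" by (rule G.prob_space_distr[OF mk])
qed

lemma sets_gen_law [measurable_cong, simp]: "sets (gen_law q MA) = sets dirs_space"
  by (simp add: gen_law_def)

text \<open>Conditioning on A divides Gaussian probabilities by at worst the probability of A,
  whence K. Nonzero total mass excludes the degenerate conditional law.\<close>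

lemma gen_law_first_dir_small_ball:
  fixes MA :: real
  assumes q: "q \<ge> 1" and nz: "measure (gen_law q MA :: (real^'n) list measure) UNIV \<noteq> 0"
  obtains K where "K \<ge> 0" "\<And>u t. norm (u :: real^'n) = 1 \<Longrightarrow> t \<ge> 0 \<Longrightarrow>
      measure (gen_law q MA) {as. \<bar>first_dir as \<bullet> u\<bar> \<le> t} \<le> K * t"
    "finite_measure (gen_law q MA :: (real^'n) list measure)"
    "\<exists>A \<in> sets dirs_space. (\<forall>as\<in>A. mnorm_list (as :: (real^'n) list) \<le> MA) \<and> measure (gen_law q MA) (- A) = 0"
proof -
  define N where "N = distr (PiM ({..<q} \<times> (UNIV :: 'n set)) (\<lambda>_. density lborel (normal_density 0 (1 / sqrt (real q)))))
      dirs_space (\<lambda>a. map (\<lambda>j. \<chi> i. a (j, i)) [0..<q])"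
  define A where "A = {as :: (real^'n) list. full_column_rank as \<and> mnorm_list as \<le> MA}"
  have G: "gen_law q MA = uniform_measure N A" unfolding gen_law_def N_def A_def ..
  have sN: "sets N = sets dirs_space" by (simp add: N_def)
  interpret N: prob_space N
    unfolding N_def by (rule gaussian_first_dir_small_ball(2)[OF q, of "axis undefined 1" 0]) simp_all
  \<comment> \<open>This also yields measurability of A, because \<open>emeasure\<close> vanishes
    outside the sigma-algebra.\<close>
  have A0: "emeasure N A \<noteq> 0" using nz measure_uniform_measure_null unfolding G by blast
  have AN: "A \<in> sets N" using A0 by (rule emeasure_neq_0_sets)
  have A_pos: "measure N A > 0" using A0 by (simp add: N.emeasure_eq_measure zero_less_measure_iff)
  have meas: "measure (gen_law q MA) B = measure N (A \<inter> B) / measure N A" if "B \<in> sets dirs_space" for B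
    unfolding G using A0 that by (intro measure_uniform_measure) (auto simp: sN)
  show thesis
  proof (rule that)
    show "0 \<le> sqrt (real q) / measure N A" by simp
    fix u :: "real^'n" and t :: real assume u: "norm u = 1" and t: "t \<ge> 0"
    have W: "{as. \<bar>first_dir as \<bullet> u\<bar> \<le> t} \<in> sets dirs_space"
    proof -
      have "{as \<in> space dirs_space. \<bar>first_dir as \<bullet> u\<bar> \<le> t} \<in> sets dirs_space" by measurable
      then show ?thesis by simp
    qed
    have "measure (gen_law q MA) {as. \<bar>first_dir as \<bullet> u\<bar> \<le> t} \<le> measure N {as. \<bar>first_dir as \<bullet> u\<bar> \<le> t} / measure N A"
      unfolding meas[OF W] by (intro divide_right_mono N.finite_measure_mono) (use W sN in auto)
    also have "\<dots> \<le> t * sqrt (real q) / measure N A"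
      unfolding N_def[symmetric] using gaussian_first_dir_small_ball(1)[OF q u t, folded N_def]
      by (intro divide_right_mono) auto
    finally show "measure (gen_law q MA) {as. \<bar>first_dir as \<bullet> u\<bar> \<le> t} \<le> sqrt (real q) / measure N A * t"
      by (simp add: mult.commute)
  next
    have "prob_space (uniform_measure N A)"
      by (rule prob_space_uniform_measure[OF A0]) simp
    then show "finite_measure (gen_law q MA :: (real^'n) list measure)"
      unfolding G prob_space_def by blast
  next
    have "- A \<in> sets dirs_space" using AN sN sets.compl_sets[of A dirs_space] by (simp add: Compl_eq_Diff_UNIV)
    then have "measure (gen_law q MA) (- A) = 0" by (simp add: meas)
    then show "\<exists>A \<in> sets dirs_space. (\<forall>as\<in>A. mnorm_list (as :: (real^'n) list) \<le> MA) \<and> measure (gen_law q MA) (- A) = 0"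
      using AN sN by (intro bexI[of _ A]) (auto simp: A_def)
  qed
qed

section \<open>The conditional law of the generated matrix\<close>

context qarsta_process
begin

lemma F_measurable_imp:
  assumes "h \<in> measurable (F k) N"
  shows "h \<in> measurable M N"
  using assms F_sub[of k] space_F[of k] unfolding measurable_def by auto

lemma gen_mat_measurable: "(\<lambda>\<omega>. gen_mat (S k \<omega>)) \<in> measurable M dirs_space"
  using gen_mat_meas by (rule F_measurable_imp)

text \<open>Extends \<open>gen_mat_law\<close> from rectangles to functions of the past and the new
  matrix: on E their joint law is a product measure, and Tonelli applies.\<close>

lemma gen_mat_disintegration:
  assumes q: "q \<ge> 1" and fin: "finite_measure (gen_law q (gen_bound P) :: (real^'n) list measure)"
    and E: "E \<in> sets (F k)" "E \<subseteq> {\<omega>. n_gen (S k \<omega>) = q}"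
    and h: "h \<in> borel_measurable (F k \<Otimes>\<^sub>M dirs_space)"
  shows "(\<integral>\<^sup>+\<omega>. h (\<omega>, gen_mat (S k \<omega>)) * indicator E \<omega> \<partial>M)
    = (\<integral>\<^sup>+\<omega>. (\<integral>\<^sup>+as. h (\<omega>, as) \<partial>gen_law q (gen_bound P)) * indicator E \<omega> \<partial>M)"
proof -
  let ?G = "gen_law q (gen_bound P) :: (real^'n) list measure"
  interpret G: finite_measure ?G by (rule fin)
  have EM: "E \<in> sets M" using E(1) F_sub by blast
  \<comment> \<open>\<open>M1\<close> is M restricted to E and viewed on F k; \<open>J\<close> is
    the joint law of the past and the new matrix on E.\<close>
  define M1 where "M1 = distr (density M (indicator E)) (F k) (\<lambda>\<omega>. \<omega>)"
  define J where "J = distr (density M (indicator E)) (F k \<Otimes>\<^sub>M dirs_space) (\<lambda>\<omega>. (\<omega>, gen_mat (S k \<omega>)))"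
  have id: "(\<lambda>\<omega>. \<omega>) \<in> measurable M (F k)" by (rule F_measurable_imp[of _ k]) simp
  have pair: "(\<lambda>\<omega>. (\<omega>, gen_mat (S k \<omega>))) \<in> measurable M (F k \<Otimes>\<^sub>M dirs_space)"
    by (intro measurable_Pair id gen_mat_measurable)
  have eM1: "emeasure M1 A = emeasure M (E \<inter> A)" if "A \<in> sets (F k)" for A
  proof -
    have AM: "A \<in> sets M" using that F_sub by blast
    have "emeasure M1 A = emeasure (density M (indicator E)) A"
      unfolding M1_def using that id AM sets.sets_into_space[OF AM]
      by (subst emeasure_distr) (auto simp: Int_absorb2)
    also have "\<dots> = emeasure M (E \<inter> A)" using EM AM by (rule emeasure_restricted)
    finally show ?thesis .
  qed
  have sM1: "sets M1 = sets (F k)" by (simp add: M1_def)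
  have fM1: "finite_measure M1"
  proof
    show "emeasure M1 (space M1) \<noteq> \<infinity>"
      unfolding M1_def space_distr using eM1[OF sets.top, unfolded M1_def] by simp
  qed
  have "M1 \<Otimes>\<^sub>M ?G = J"
  proof (rule pair_measure_eqI)
    show "sigma_finite_measure M1" using fM1 by (rule finite_measure.axioms)
    show "sigma_finite_measure ?G" by (rule G.sigma_finite_measure_axioms)
    show "sets (M1 \<Otimes>\<^sub>M ?G) = sets J"
      unfolding J_def sets_distr by (intro sets_pair_measure_cong sM1 sets_gen_law)
    fix A B assume "A \<in> sets M1" and B': "B \<in> sets ?G"
    then have A: "A \<in> sets (F k)" and B: "B \<in> sets dirs_space" by (auto simp: sM1)
    have AM: "A \<in> sets M" using A F_sub by blast
    let ?V = "A \<inter> {\<omega> \<in> space M. gen_mat (S k \<omega>) \<in> B}"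
    have V0: "{\<omega> \<in> space M. gen_mat (S k \<omega>) \<in> B} \<in> sets M"
      using measurable_sets[OF gen_mat_measurable B] by (simp add: vimage_def Int_def conj_commute)
    have "emeasure J (A \<times> B) = emeasure (density M (indicator E)) ?V"
      unfolding J_def using pair A B sets.sets_into_space[OF AM]
      by (subst emeasure_distr) (auto intro!: arg_cong2[where f = emeasure])
    also have "\<dots> = emeasure M (E \<inter> ?V)"
      using EM AM V0 by (intro emeasure_restricted) auto
    also have "E \<inter> ?V = (E \<inter> A) \<inter> {\<omega> \<in> space M. gen_mat (S k \<omega>) \<in> B}" by auto
    also have "emeasure M \<dots> = ennreal (prob (E \<inter> A) * measure ?G B)"
      unfolding emeasure_eq_measure
      by (subst gen_mat_law[OF q]) (use E A B in auto)
    also have "\<dots> = emeasure M1 A * emeasure ?G B"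
      by (simp add: eM1[OF A] emeasure_eq_measure G.emeasure_eq_measure ennreal_mult)
    finally show "emeasure M1 A * emeasure ?G B = emeasure J (A \<times> B)" by simp
  qed
  have hG: "h \<in> borel_measurable (M1 \<Otimes>\<^sub>M ?G)"
    using h measurable_cong_sets[OF sets_pair_measure_cong[OF sM1 sets_gen_law] refl] by blast
  have "(\<integral>\<^sup>+\<omega>. h (\<omega>, gen_mat (S k \<omega>)) * indicator E \<omega> \<partial>M) = integral\<^sup>N J h"
    unfolding J_def using pair h EM
    by (subst nn_integral_distr) (auto simp: nn_integral_density mult.commute)
  also have "\<dots> = (\<integral>\<^sup>+\<omega>. (\<integral>\<^sup>+as. h (\<omega>, as) \<partial>?G) \<partial>M1)"
    unfolding \<open>M1 \<Otimes>\<^sub>M ?G = J\<close>[symmetric] by (rule G.nn_integral_fst[OF hG, symmetric])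
  also have "\<dots> = (\<integral>\<^sup>+\<omega>. (\<integral>\<^sup>+as. h (\<omega>, as) \<partial>?G) * indicator E \<omega> \<partial>M)"
  proof -
    have m: "(\<lambda>\<omega>. \<integral>\<^sup>+as. h (\<omega>, as) \<partial>?G) \<in> borel_measurable (F k)"
      using G.borel_measurable_nn_integral_fst[of h "F k"] h
        measurable_cong_sets[OF sets_pair_measure_cong[OF refl sets_gen_law] refl] by blast
    then show ?thesis
      unfolding M1_def using id EM F_measurable_imp[OF m]
      by (subst nn_integral_distr) (auto simp: nn_integral_density mult.commute)
  qed
  finally show ?thesis .
qed

text \<open>K depends on q alone, while weight, threshold and vector may be random as long as the
  past determines them. Three thresholds are used later: 0, a constant, and a multiple of the
  radius.\<close>

lemma first_dir_small_ball:
  assumes q: "q \<ge> 1"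
  obtains K where "K \<ge> 0" "\<And>k E w \<tau> g. E \<in> sets (F k) \<Longrightarrow> E \<subseteq> {\<omega>. n_gen (S k \<omega>) = q} \<Longrightarrow>
    w \<in> borel_measurable (F k) \<Longrightarrow> \<tau> \<in> borel_measurable (F k) \<Longrightarrow> g \<in> borel_measurable (F k) \<Longrightarrow>
    (\<And>\<omega>. 0 \<le> \<tau> \<omega>) \<Longrightarrow> (\<And>\<omega>. 0 \<le> w \<omega>) \<Longrightarrow> (\<And>\<omega>. \<omega> \<in> E \<Longrightarrow> g \<omega> \<noteq> 0) \<Longrightarrow>
    (\<integral>\<^sup>+\<omega>. ennreal (w \<omega>) * indicator {\<omega> \<in> E. \<bar>first_dir (gen_mat (S k \<omega>)) \<bullet> g \<omega>\<bar> \<le> \<tau> \<omega> * norm (g \<omega>)} \<omega> \<partial>M)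
    \<le> (\<integral>\<^sup>+\<omega>. ennreal (w \<omega> * (K * \<tau> \<omega>)) * indicator E \<omega> \<partial>M)"
proof (cases "measure (gen_law q (gen_bound P) :: (real^'n) list measure) UNIV = 0")
  case True
  show thesis
  proof (rule that[of 0])
    fix k E and w \<tau> :: "'w \<Rightarrow> real" and g :: "'w \<Rightarrow> real^'n"
    assume E: "E \<in> sets (F k)" "E \<subseteq> {\<omega>. n_gen (S k \<omega>) = q}"
    have "prob E = prob (E \<inter> {\<omega> \<in> space M. gen_mat (S k \<omega>) \<in> UNIV})"
      using E(1) F_sub sets.sets_into_space[of E M] by (auto intro!: arg_cong[where f = prob])
    also have "\<dots> = 0"
      using gen_mat_law[OF q E, of UNIV] True sets.top[of dirs_space] by simp
    finally have "prob E = 0" .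
    then have "E \<in> null_sets M" using subsetD[OF F_sub E(1)] by (auto simp: emeasure_eq_measure)
    then have "AE \<omega> in M. \<omega> \<notin> E" by (rule AE_not_in)
    then have "(\<integral>\<^sup>+\<omega>. ennreal (w \<omega>) * indicator {\<omega> \<in> E. \<bar>first_dir (gen_mat (S k \<omega>)) \<bullet> g \<omega>\<bar> \<le> \<tau> \<omega> * norm (g \<omega>)} \<omega> \<partial>M)
       = (\<integral>\<^sup>+\<omega>. 0 \<partial>M)"
      by (intro nn_integral_cong_AE) (auto elim!: eventually_mono)
    then show "(\<integral>\<^sup>+\<omega>. ennreal (w \<omega>) * indicator {\<omega> \<in> E. \<bar>first_dir (gen_mat (S k \<omega>)) \<bullet> g \<omega>\<bar> \<le> \<tau> \<omega> * norm (g \<omega>)} \<omega> \<partial>M)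
      \<le> (\<integral>\<^sup>+\<omega>. ennreal (w \<omega> * (0 * \<tau> \<omega>)) * indicator E \<omega> \<partial>M)" by simp
  qed simp
next
  case False
  let ?G = "gen_law q (gen_bound P) :: (real^'n) list measure"
  obtain K where K: "K \<ge> 0" "\<And>u t. norm (u :: real^'n) = 1 \<Longrightarrow> t \<ge> 0 \<Longrightarrow>
      measure ?G {as. \<bar>first_dir as \<bullet> u\<bar> \<le> t} \<le> K * t" "finite_measure ?G"
    using gen_law_first_dir_small_ball[OF q False] by metis
  interpret G: finite_measure ?G by (rule K(3))
  show thesis
  proof (rule that[OF K(1)])
    fix k E and w \<tau> :: "'w \<Rightarrow> real" and g :: "'w \<Rightarrow> real^'n"
    assume E: "E \<in> sets (F k)" "E \<subseteq> {\<omega>. n_gen (S k \<omega>) = q}"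
      and [measurable]: "w \<in> borel_measurable (F k)" "\<tau> \<in> borel_measurable (F k)" "g \<in> borel_measurable (F k)"
      and nonneg: "\<And>\<omega>. 0 \<le> \<tau> \<omega>" "\<And>\<omega>. 0 \<le> w \<omega>" and g0: "\<And>\<omega>. \<omega> \<in> E \<Longrightarrow> g \<omega> \<noteq> 0"
    define h where "h = (\<lambda>(\<omega>, as). ennreal (w \<omega>) *
        (if \<bar>first_dir as \<bullet> g \<omega>\<bar> \<le> \<tau> \<omega> * norm (g \<omega>) then 1 else 0 :: ennreal))"
    have h: "h \<in> borel_measurable (F k \<Otimes>\<^sub>M dirs_space)" unfolding h_def by measurable
    have "(\<integral>\<^sup>+\<omega>. ennreal (w \<omega>) * indicator {\<omega> \<in> E. \<bar>first_dir (gen_mat (S k \<omega>)) \<bullet> g \<omega>\<bar> \<le> \<tau> \<omega> * norm (g \<omega>)} \<omega> \<partial>M)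
      = (\<integral>\<^sup>+\<omega>. h (\<omega>, gen_mat (S k \<omega>)) * indicator E \<omega> \<partial>M)"
      by (intro nn_integral_cong) (auto simp: h_def indicator_def)
    also have "\<dots> = (\<integral>\<^sup>+\<omega>. (\<integral>\<^sup>+as. h (\<omega>, as) \<partial>?G) * indicator E \<omega> \<partial>M)"
      by (rule gen_mat_disintegration[OF q K(3) E h])
    also have "\<dots> \<le> (\<integral>\<^sup>+\<omega>. ennreal (w \<omega> * (K * \<tau> \<omega>)) * indicator E \<omega> \<partial>M)"
    proof (rule nn_integral_mono)
      fix \<omega> assume "\<omega> \<in> space M"
      show "(\<integral>\<^sup>+as. h (\<omega>, as) \<partial>?G) * indicator E \<omega> \<le> ennreal (w \<omega> * (K * \<tau> \<omega>)) * indicator E \<omega>"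
      proof (cases "\<omega> \<in> E")
        case True
        let ?u = "(1 / norm (g \<omega>)) *\<^sub>R g \<omega>"
        let ?W = "{as. \<bar>first_dir as \<bullet> ?u\<bar> \<le> \<tau> \<omega>}"
        have gn: "norm (g \<omega>) > 0" using g0[OF True] by simp
        have iff: "\<bar>first_dir as \<bullet> g \<omega>\<bar> \<le> \<tau> \<omega> * norm (g \<omega>) \<longleftrightarrow> as \<in> ?W" for as
          using gn by (simp add: abs_mult divide_le_eq)
        have W: "?W \<in> sets ?G"
        proof -
          have "{as \<in> space dirs_space. \<bar>first_dir as \<bullet> ?u\<bar> \<le> \<tau> \<omega>} \<in> sets dirs_space" by measurable
          then show ?thesis by simp
        qed
        have "(\<integral>\<^sup>+as. h (\<omega>, as) \<partial>?G) = (\<integral>\<^sup>+as. ennreal (w \<omega>) * indicator ?W as \<partial>?G)"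
          unfolding h_def by (intro nn_integral_cong) (simp only: iff prod.case, simp add: indicator_def)
        also have "\<dots> = ennreal (w \<omega>) * ennreal (measure ?G ?W)"
          using W by (simp add: nn_integral_cmult_indicator G.emeasure_eq_measure)
        also have "\<dots> \<le> ennreal (w \<omega>) * ennreal (K * \<tau> \<omega>)"
          using gn by (intro mult_left_mono ennreal_leI K(2) nonneg) auto
        also have "\<dots> = ennreal (w \<omega> * (K * \<tau> \<omega>))" using nonneg by (simp add: ennreal_mult' K(1))
        finally show ?thesis using True by simp
      qed simp
    qed
    finally show "(\<integral>\<^sup>+\<omega>. ennreal (w \<omega>) * indicator {\<omega> \<in> E. \<bar>first_dir (gen_mat (S k \<omega>)) \<bullet> g \<omega>\<bar> \<le> \<tau> \<omega> * norm (g \<omega>)} \<omega> \<partial>M)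
      \<le> (\<integral>\<^sup>+\<omega>. ennreal (w \<omega> * (K * \<tau> \<omega>)) * indicator E \<omega> \<partial>M)" .
  qed
qed

lemma n_gen_event: "{\<omega> \<in> space M. n_gen (S k \<omega>) = q} \<in> sets (F k)"
  using measurable_sets[OF n_gen_meas[of k], of "{q}"] space_F[of k]
  by (simp add: vimage_def Int_def conj_commute)

text \<open>The norm bound is part of the conditioning event. As \<open>gen_mat_law\<close> fixes
  the number of columns, the claim is proved for each of the countably many values.\<close>

lemma AE_mnorm_gen_mat:
  "AE \<omega> in M. \<forall>k. n_gen (S k \<omega>) \<ge> 1 \<longrightarrow> mnorm_list (gen_mat (S k \<omega>)) \<le> gen_bound P"
proof -
  have *: "AE \<omega> in M. n_gen (S k \<omega>) = q \<longrightarrow> mnorm_list (gen_mat (S k \<omega>)) \<le> gen_bound P" if q: "q \<ge> 1" for k q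
  proof -
    let ?G = "gen_law q (gen_bound P) :: (real^'n) list measure"
    let ?E = "{\<omega> \<in> space M. n_gen (S k \<omega>) = q}"
    have "?E \<subseteq> {\<omega>. n_gen (S k \<omega>) = q}" by blast
    note law = gen_mat_law[OF q n_gen_event[of k q] this]
    have UNIV: "(UNIV :: (real^'n) list set) \<in> sets dirs_space"
      using sets.top[of dirs_space] by simp
    have EM: "?E \<in> sets M" using n_gen_event F_sub by blast
    show ?thesis
    proof (cases "measure ?G UNIV = 0")
      case True
      have "prob ?E = prob (?E \<inter> {\<omega> \<in> space M. gen_mat (S k \<omega>) \<in> UNIV})"
        by (auto intro!: arg_cong[where f = prob])
      also have "\<dots> = 0" using law[OF UNIV] True by simp
      finally have "?E \<in> null_sets M" using EM by (auto simp: emeasure_eq_measure)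
      then have "AE \<omega> in M. \<omega> \<notin> ?E" by (rule AE_not_in)
      then show ?thesis by (auto elim!: eventually_mono simp: AE_conj_iff intro: AE_I2)
    next
      case False
      obtain A where A: "A \<in> sets dirs_space" "\<And>as. as \<in> A \<Longrightarrow> mnorm_list as \<le> gen_bound P" "measure ?G (- A) = 0"
        using gen_law_first_dir_small_ball[OF q False] by metis
      have cA: "- A \<in> sets dirs_space" using sets.compl_sets[OF A(1)] by (simp add: Compl_eq_Diff_UNIV)
      have "prob (?E \<inter> {\<omega> \<in> space M. gen_mat (S k \<omega>) \<in> - A}) = 0"
        using law[OF cA] A(3) by simp
      moreover have "{\<omega> \<in> space M. gen_mat (S k \<omega>) \<in> - A} \<in> sets M"
        using measurable_sets[OF gen_mat_measurable cA] by (simp add: vimage_def Int_def conj_commute)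
      ultimately have "?E \<inter> {\<omega> \<in> space M. gen_mat (S k \<omega>) \<in> - A} \<in> null_sets M"
        using EM by (auto simp: emeasure_eq_measure)
      then show ?thesis
        by (rule AE_I') (use A(2) in auto)
    qed
  qed
  have "AE \<omega> in M. q \<ge> 1 \<longrightarrow> n_gen (S k \<omega>) = q \<longrightarrow> mnorm_list (gen_mat (S k \<omega>)) \<le> gen_bound P" for k q
    using *[of q k] by (cases "q \<ge> 1") simp_all
  then have "AE \<omega> in M. \<forall>k q. q \<ge> 1 \<longrightarrow> n_gen (S k \<omega>) = q \<longrightarrow> mnorm_list (gen_mat (S k \<omega>)) \<le> gen_bound P"
    by (intro AE_all_countable[THEN iffD2] allI)
  then show ?thesis by eventually_elim simp
qed

end

section \<open>Paths of the algorithm\<close>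

text \<open>The factor of \<Delta>^2 obtained by inserting the smallest noncritical model gradient
  norm, \<Delta> divided by \<open>crit_mu P\<close>, into the sufficient decrease bound.\<close>

definition decrease_const :: "'n::finite qarsta_inputs \<Rightarrow> real \<Rightarrow> real \<Rightarrow> real" where
  "decrease_const P \<kappa> c = c / crit_mu P * min 1 (1 / (crit_mu P * \<kappa>))"

text \<open>In turn: the value error cannot spoil the ratio test; the model gradient error is at
  most d; no direction survives the geometry test; the cap \<open>rad_max\<close> does not shrink
  the radius.\<close>

definition small_radius :: "'n::finite qarsta_inputs \<Rightarrow> real \<Rightarrow> real \<Rightarrow> real \<Rightarrow> real \<Rightarrow> real \<Rightarrow> bool" where
  "small_radius P p L \<kappa> c d \<longleftrightarrow>
     6 * p\<^sup>2 * L * d \<le> (1 - eta1 P) * decrease_const P \<kappa> c \<and> 3 * p * L * d \<le> 1 \<and>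
     p * (eps_rad P * d) < eps_geo P \<and> d \<le> rad_max P"

lemma decrease_const_pos:
  "valid_inputs n p P \<Longrightarrow> 1 \<le> \<kappa> \<Longrightarrow> 0 < c \<Longrightarrow> 0 < decrease_const P \<kappa> c"
  by (simp add: valid_inputs_def decrease_const_def)

lemma eventually_mult_less: "eventually (\<lambda>d. a * d < b) (at_right (0::real))" if "0 < b" for a b :: real
proof -
  have "((\<lambda>d. a * d) \<longlongrightarrow> a * 0) (at_right 0)" by (intro tendsto_intros)
  then show ?thesis using that by (auto intro: order_tendstoD(2))
qed

lemma small_radius_exists:
  assumes inputs: "valid_inputs n q P" and \<kappa>: "1 \<le> \<kappa>" and c: "0 < c"
  shows "eventually (small_radius P p L \<kappa> c) (at_right 0)"
proof -
  have "0 < (1 - eta1 P) * decrease_const P \<kappa> c" "0 < eps_geo P" "0 < rad_max P"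
    using decrease_const_pos[OF assms] inputs by (auto simp: valid_inputs_def)
  then have "eventually (\<lambda>d. 6 * p\<^sup>2 * L * d < (1 - eta1 P) * decrease_const P \<kappa> c \<and> 3 * p * L * d < 1 \<and>
     (p * eps_rad P) * d < eps_geo P \<and> 1 * d < rad_max P) (at_right 0)"
    by (intro eventually_conj eventually_mult_less) auto
  then show ?thesis by eventually_elim (simp add: small_radius_def mult.assoc)
qed

lemma column_scaleR: "column i (a *\<^sub>R A) = a *\<^sub>R column i (A :: real^'b^'a)"
  by (simp add: column_def vec_eq_iff)

text \<open>A single sample path, with the almost sure properties as plain assumptions.\<close>

locale qarsta_path =
  fixes P :: "'n::finite qarsta_inputs" and f :: "real^'n \<Rightarrow> real" and L f_low \<kappa> c :: real
    and S :: "nat \<Rightarrow> ('n, 'p::{finite,linorder}) qarsta_state"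
  assumes inputs: "valid_inputs CARD('n) CARD('p) P"
    and smooth: "C2_plus f L"
    and low: "\<And>x. f_low \<le> f x"
    and kappa: "1 \<le> \<kappa>" and c_pos: "0 < c"
    and hess: "\<And>k. mnorm (model_hessian f (S k)) \<le> \<kappa>"
    and decrease: "\<And>k. \<not> critical P f (S k) \<Longrightarrow>
          model f (S k) 0 - model f (S k) (tr_step (S k))
          \<ge> c * norm (gradient (model f (S k)) 0) *
              min (radius (S k))
                  (norm (gradient (model f (S k)) 0) / max (mnorm (model_hessian f (S k))) 1)"
    and run: "qarsta_run P f S"
    and rad_min: "rad_min P = 0"
    and gen_norm: "\<And>k. n_gen (S k) \<ge> 1 \<Longrightarrow> mnorm_list (gen_mat (S k)) \<le> gen_bound P"
begin

abbreviation x where "x k \<equiv> iterate (S k)"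
abbreviation \<Delta> where "\<Delta> k \<equiv> radius (S k)"
abbreviation g where "g k \<equiv> gradient f (x k)"
abbreviation crit where "crit k \<equiv> critical P f (S k)"
abbreviation gm where "gm k \<equiv> model_gradient f (x k) (fac_Q (S k)) (fac_R (S k))"
abbreviation ca where "ca \<equiv> decrease_const P \<kappa> c"

lemma params:
  "0 < rad_init P" "0 < rad_max P" "0 < gam_dec P" "gam_dec P < 1" "1 < gam_inc P"
  "0 < eta1 P" "eta1 P < 1" "0 < crit_mu P" "1 \<le> eps_rad P" "1 \<le> p_rand P" "1 \<le> gen_bound P"
  using inputs by (auto simp: valid_inputs_def)

lemma ca_pos: "0 < ca"
  using decrease_const_pos[OF inputs kappa c_pos] .

text \<open>Positivity of the earlier radii keeps the stopping test from triggering, which in turn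
  gives the next step; hence the strengthened induction.\<close>

lemma radius_pos_upto: "\<forall>j\<le>k. 0 < \<Delta> j"
proof (induction k)
  case 0
  then show ?case using run params by (simp add: qarsta_run_def qarsta_init_def)
next
  case (Suc k)
  then have "qarsta_step P f (S k) (S (Suc k))"
    using run rad_min by (auto simp: qarsta_run_def not_less less_imp_le)
  moreover have "0 < \<Delta> k" using Suc by simp
  ultimately have "0 < \<Delta> (Suc k)"
    using params by (auto simp: qarsta_step_def next_radius_def split: if_splits)
  then show ?case using Suc by (auto simp: le_Suc_eq)
qed

lemma radius_pos: "0 < \<Delta> k"
  using radius_pos_upto by blast

lemma step: "qarsta_step P f (S k) (S (Suc k))"
  using run rad_min radius_pos by (auto simp: qarsta_run_def not_less less_imp_le)

lemma qr: "is_qr (dir_mat (S k)) (fac_Q (S k)) (fac_R (S k))"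
  using step by (simp add: qarsta_step_def)

lemma gradient_model: "gradient (model f (S k)) 0 = gm k"
  unfolding model_def by (rule gradient_quad_model)

lemma crit_iff: "crit k \<longleftrightarrow> crit_mu P * norm (gm k) < \<Delta> k"
  by (simp add: critical_def gradient_model)

lemma finite_candidates: "finite (candidate_offsets (S k))"
proof -
  have "finite (sample_offsets (S k))"
    unfolding sample_offsets_def by (rule finite_image_set2) simp_all
  then show ?thesis by (simp add: candidate_offsets_def)
qed

lemma next_value_le:
  assumes "\<not> crit k" "v \<in> candidate_offsets (S k)"
  shows "f (x (Suc k)) \<le> f (x k + v)"
proof -
  have "f (x (Suc k)) \<le> Min ((\<lambda>v. f (x k + v)) ` candidate_offsets (S k))"
    using step[of k] assms(1) by (simp add: qarsta_step_def)
  also have "\<dots> \<le> f (x k + v)" using assms(2) finite_candidates by (intro Min_le) auto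
  finally show ?thesis .
qed

lemma value_decreasing: "f (x (Suc k)) \<le> f (x k)"
proof (cases "crit k")
  case True
  then show ?thesis using step[of k] by (simp add: qarsta_step_def)
next
  case False
  have "0 \<in> sample_offsets (S k)"
    unfolding sample_offsets_def by (rule CollectI, rule exI[of _ 0], rule exI[of _ 0]) simp
  then show ?thesis using next_value_le[OF False, of 0] by (simp add: candidate_offsets_def)
qed

lemma model_decrease:
  assumes "\<not> crit k"
  shows "c * norm (gm k) * min (\<Delta> k) (norm (gm k) / \<kappa>) \<le> model f (S k) 0 - model f (S k) (tr_step (S k))"
proof -
  have "norm (gm k) / \<kappa> \<le> norm (gm k) / max (mnorm (model_hessian f (S k))) 1"
    using hess[of k] kappa by (intro divide_left_mono) auto
  then have "c * norm (gm k) * min (\<Delta> k) (norm (gm k) / \<kappa>)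
      \<le> c * norm (gm k) * min (\<Delta> k) (norm (gm k) / max (mnorm (model_hessian f (S k))) 1)"
    using c_pos by (intro mult_left_mono min.mono) auto
  also have "\<dots> \<le> model f (S k) 0 - model f (S k) (tr_step (S k))"
    using decrease[OF assms] by (simp only: gradient_model)
  finally show ?thesis .
qed

lemma model_decrease_radius:
  assumes "\<not> crit k"
  shows "ca * (\<Delta> k)\<^sup>2 \<le> model f (S k) 0 - model f (S k) (tr_step (S k))"
proof -
  have gm: "\<Delta> k / crit_mu P \<le> norm (gm k)"
    using assms params by (simp add: crit_iff not_less pos_divide_le_eq mult.commute)
  have "ca * (\<Delta> k)\<^sup>2 = c * (\<Delta> k / crit_mu P) * (\<Delta> k * min 1 (1 / (crit_mu P * \<kappa>)))"
    by (simp add: decrease_const_def power2_eq_square)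
  also have "\<Delta> k * min 1 (1 / (crit_mu P * \<kappa>)) = min (\<Delta> k) (\<Delta> k / crit_mu P / \<kappa>)"
    using radius_pos[of k] by (simp add: min_mult_distrib_left)
  also have "c * (\<Delta> k / crit_mu P) * min (\<Delta> k) (\<Delta> k / crit_mu P / \<kappa>)
      \<le> c * norm (gm k) * min (\<Delta> k) (norm (gm k) / \<kappa>)"
  proof (rule mult_mono)
    show "c * (\<Delta> k / crit_mu P) \<le> c * norm (gm k)" using gm c_pos by (intro mult_left_mono) auto
    show "min (\<Delta> k) (\<Delta> k / crit_mu P / \<kappa>) \<le> min (\<Delta> k) (norm (gm k) / \<kappa>)"
      using gm kappa by (intro min.mono divide_right_mono) auto
    show "0 \<le> c * norm (gm k)" using c_pos by simp
    show "0 \<le> min (\<Delta> k) (\<Delta> k / crit_mu P / \<kappa>)"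
      using radius_pos[of k] params kappa by simp
  qed
  also have "\<dots> \<le> model f (S k) 0 - model f (S k) (tr_step (S k))" by (rule model_decrease[OF assms])
  finally show ?thesis .
qed

lemma model_decrease_pos:
  assumes "\<not> crit k"
  shows "0 < model f (S k) 0 - model f (S k) (tr_step (S k))"
proof -
  have "0 < ca * (\<Delta> k)\<^sup>2" using ca_pos radius_pos[of k] by simp
  then show ?thesis using model_decrease_radius[OF assms] by linarith
qed

lemma success_decrease:
  assumes "\<not> crit k" "\<not> rho f (S k) < eta1 P"
  shows "eta1 P * (model f (S k) 0 - model f (S k) (tr_step (S k))) \<le> f (x k) - f (x (Suc k))"
proof -
  have "eta1 P * (model f (S k) 0 - model f (S k) (tr_step (S k))) \<le> f (x k) - f (x k + full_step (S k))"
    using assms(2) model_decrease_pos[OF assms(1)] by (simp add: rho_def not_less pos_le_divide_eq)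
  moreover have "f (x (Suc k)) \<le> f (x k + full_step (S k))"
    by (rule next_value_le[OF assms(1)]) (simp add: candidate_offsets_def)
  ultimately show ?thesis by simp
qed

text \<open>Unless the radius shrinks by \<open>gam_dec P\<close>, the iteration is successful and f
  decreases by at least \<open>eta1 P * ca * (\<Delta> k)\<^sup>2\<close>. The constant scales this
  to the square of the largest possible next radius.\<close>

lemma radius_recursion:
  "(\<Delta> (Suc k))\<^sup>2 \<le> (gam_dec P)\<^sup>2 * (\<Delta> k)\<^sup>2 + (gam_inc P)\<^sup>2 / (eta1 P * ca) * (f (x k) - f (x (Suc k)))"
proof -
  let ?C = "(gam_inc P)\<^sup>2 / (eta1 P * ca)"
  have C: "0 \<le> ?C" using params ca_pos by simp
  have dec: "0 \<le> f (x k) - f (x (Suc k))" using value_decreasing[of k] by simp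
  show ?thesis
  proof (cases "\<Delta> (Suc k) = gam_dec P * \<Delta> k")
    case True
    then show ?thesis
      using mult_nonneg_nonneg[OF C dec] unfolding True power_mult_distrib by linarith
  next
    case False
    then have nc: "\<not> crit k" using step[of k] by (auto simp: qarsta_step_def)
    have next_rad: "\<Delta> (Suc k) = next_radius P f (S k)" using step[of k] nc by (simp add: qarsta_step_def)
    then have succ: "\<not> rho f (S k) < eta1 P" using False by (auto simp: next_radius_def)
    have "\<Delta> k \<le> gam_inc P * \<Delta> k" using params radius_pos[of k] by simp
    then have "\<Delta> (Suc k) \<le> gam_inc P * \<Delta> k" using next_rad succ by (auto simp: next_radius_def)
    then have "(\<Delta> (Suc k))\<^sup>2 \<le> (gam_inc P * \<Delta> k)\<^sup>2"
      using radius_pos[of "Suc k"] by (intro power_mono) auto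
    also have "\<dots> = ?C * (eta1 P * (ca * (\<Delta> k)\<^sup>2))"
      using params ca_pos by (simp add: power_mult_distrib)
    also have "\<dots> \<le> ?C * (f (x k) - f (x (Suc k)))"
    proof (rule mult_left_mono[OF _ C])
      have "eta1 P * (ca * (\<Delta> k)\<^sup>2) \<le> eta1 P * (model f (S k) 0 - model f (S k) (tr_step (S k)))"
        using model_decrease_radius[OF nc] params by simp
      also have "\<dots> \<le> f (x k) - f (x (Suc k))" by (rule success_decrease[OF nc succ])
      finally show "eta1 P * (ca * (\<Delta> k)\<^sup>2) \<le> f (x k) - f (x (Suc k))" .
    qed
    finally show ?thesis using params radius_pos[of k] by (simp add: add_increasing)
  qed
qed

lemma radius_tendsto_0: "\<Delta> \<longlonglongrightarrow> 0"
proof -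
  let ?C = "(gam_inc P)\<^sup>2 / (eta1 P * ca)" and ?q = "(gam_dec P)\<^sup>2"
  have C: "0 \<le> ?C" using params ca_pos by simp
  have q: "?q < 1" using params by (simp add: power_less_one_iff abs_square_less_1)
  \<comment> \<open>The extra square of the current radius is what lets the induction absorb the
    recursion.\<close>
  have bound: "(1 - ?q) * (\<Sum>k<n. (\<Delta> k)\<^sup>2) + (\<Delta> n)\<^sup>2 \<le> (\<Delta> 0)\<^sup>2 + ?C * (f (x 0) - f (x n))" for n
  proof (induction n)
    case (Suc n)
    have "?C * (f (x 0) - f (x (Suc n))) = ?C * (f (x 0) - f (x n)) + ?C * (f (x n) - f (x (Suc n)))"
      unfolding distrib_left[symmetric] by simp
    then show ?case using Suc radius_recursion[of n] by (simp add: algebra_simps)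
  qed simp
  have "(\<Sum>k<n. (\<Delta> k)\<^sup>2) \<le> ((\<Delta> 0)\<^sup>2 + ?C * (f (x 0) - f_low)) / (1 - ?q)" for n
  proof -
    have "?C * (f (x 0) - f (x n)) \<le> ?C * (f (x 0) - f_low)"
      using low[of "x n"] by (intro mult_left_mono C) simp
    then have "(1 - ?q) * (\<Sum>k<n. (\<Delta> k)\<^sup>2) \<le> (\<Delta> 0)\<^sup>2 + ?C * (f (x 0) - f_low)"
      using bound[of n] zero_le_power2[of "\<Delta> n"] by linarith
    then show ?thesis using q by (simp add: pos_le_divide_eq mult.commute)
  qed
  then have "summable (\<lambda>k. (\<Delta> k)\<^sup>2)" by (intro summableI_nonneg_bounded) auto
  then have "(\<lambda>k. (\<Delta> k)\<^sup>2) \<longlonglongrightarrow> 0" by (rule summable_LIMSEQ_zero)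
  then have "(\<lambda>k. sqrt ((\<Delta> k)\<^sup>2)) \<longlonglongrightarrow> sqrt 0" by (rule tendsto_real_sqrt)
  then show ?thesis using radius_pos by (simp add: less_imp_le)
qed

section \<open>Iterations with freshly generated directions\<close>

lemma n_gen_0: "n_gen (S 0) = CARD('p)"
  using run by (simp add: qarsta_run_def qarsta_init_def forms_dirs_def)

lemma forms_dirs_if_generated: "n_gen (S k) \<ge> 1 \<Longrightarrow> forms_dirs (S k)"
proof (cases k)
  case 0
  then show ?thesis using run by (simp add: qarsta_run_def qarsta_init_def)
next
  case (Suc j)
  moreover assume "n_gen (S k) \<ge> 1"
  ultimately show ?thesis using step[of j] by (auto simp: qarsta_step_def split: if_splits)
qed

lemma generated_after_noncritical:
  assumes "\<not> crit k"
  shows "1 \<le> n_gen (S (Suc k))" "small_radius P (real CARD('p)) L \<kappa> c (\<Delta> (Suc k)) \<Longrightarrow> n_gen (S (Suc k)) = CARD('p)"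
proof -
  have keeps: "keeps_dirs P (S k) (x (Suc k)) (\<Delta> (Suc k)) (kept_dirs (S (Suc k)))"
    and "forms_dirs (S (Suc k))"
    using step[of k] assms by (auto simp: qarsta_step_def)
  then have n: "n_gen (S (Suc k)) = CARD('p) - length (kept_dirs (S (Suc k)))"
    by (simp add: forms_dirs_def)
  show "1 \<le> n_gen (S (Suc k))"
    using keeps_dirs_length[OF keeps] params(10) n by linarith
  assume "small_radius P (real CARD('p)) L \<kappa> c (\<Delta> (Suc k))"
  then have "kept_dirs (S (Suc k)) = []"
    using params radius_pos[of "Suc k"] by (intro keeps_dirs_empty[OF keeps]) (auto simp: small_radius_def)
  then show "n_gen (S (Suc k)) = CARD('p)" using n by simp
qed

lemma card_ge_1: "1 \<le> CARD('p)"
  using zero_less_card_finite[where 'a='p] by linarith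

lemma generated_nonempty: "n_gen (S k) \<ge> 1 \<Longrightarrow> gen_mat (S k) \<noteq> []"
  using forms_dirs_length_gen_mat[OF forms_dirs_if_generated[of k]] by auto

lemma first_dir_le:
  assumes n: "n_gen (S k) = CARD('p)"
  shows "\<bar>first_dir (gen_mat (S k)) \<bullet> g k\<bar> \<le> gen_bound P * norm (transpose (fac_Q (S k)) *v g k)"
proof -
  have n1: "n_gen (S k) \<ge> 1" using n card_ge_1 by simp
  note ne = generated_nonempty[OF n1]
  have "\<bar>gen_mat (S k) ! 0 \<bullet> g k\<bar> \<le> norm (gen_mat (S k) ! 0) * norm (transpose (fac_Q (S k)) *v g k)"
    by (rule forms_dirs_first_le[OF forms_dirs_if_generated[OF n1] n radius_pos qr])
  also have "\<dots> \<le> gen_bound P * norm (transpose (fac_Q (S k)) *v g k)"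
    using norm_head_le_mnorm_list[OF ne] gen_norm[OF n1] by (intro mult_right_mono) auto
  finally show ?thesis using ne by (simp add: first_dir_def)
qed

lemma gram: "n_gen (S k) = CARD('p) \<Longrightarrow> transpose (dir_mat (S k)) ** dir_mat (S k) = (\<Delta> k)\<^sup>2 *\<^sub>R mat 1"
  using forms_dirs_gram[OF forms_dirs_if_generated] card_ge_1 by metis

lemma model_gradient_close:
  assumes n: "n_gen (S k) = CARD('p)" and s: "small_radius P (real CARD('p)) L \<kappa> c (\<Delta> k)"
  shows "norm (gm k - transpose (fac_Q (S k)) *v g k) \<le> \<Delta> k"
proof -
  have "norm (gm k - transpose (fac_Q (S k)) *v g k) \<le> 3 * real CARD('p) * L * (\<Delta> k)\<^sup>2"
    by (rule model_gradient_accuracy[OF smooth qr gram[OF n] radius_pos])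
  also have "\<dots> = (3 * real CARD('p) * L * \<Delta> k) * \<Delta> k" by (simp add: power2_eq_square)
  also have "\<dots> \<le> 1 * \<Delta> k"
    using s radius_pos[of k] by (intro mult_right_mono) (auto simp: small_radius_def)
  finally show ?thesis by simp
qed

text \<open>The guaranteed decrease is quadratic in the radius, the model error cubic.\<close>

lemma generated_success:
  assumes n: "n_gen (S k) = CARD('p)" and s: "small_radius P (real CARD('p)) L \<kappa> c (\<Delta> k)" and nc: "\<not> crit k"
  shows "\<not> rho f (S k) < eta1 P"
proof -
  let ?d = "model f (S k) 0 - model f (S k) (tr_step (S k))"
  let ?e = "6 * (real CARD('p))\<^sup>2 * L * (\<Delta> k) ^ 3"
  have tr: "norm (tr_step (S k)) \<le> \<Delta> k" using step[of k] nc by (simp add: qarsta_step_def)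
  have "\<bar>model f (S k) (tr_step (S k)) - f (x k + full_step (S k))\<bar> \<le> ?e"
    unfolding model_def full_step_def
    by (rule quad_model_value_accuracy[OF smooth qr gram[OF n] radius_pos tr])
  moreover have "model f (S k) 0 = f (x k)" by (simp add: model_def quad_model_0)
  ultimately have 1: "?d - ?e \<le> f (x k) - f (x k + full_step (S k))" by linarith
  have "?e = (6 * (real CARD('p))\<^sup>2 * L * \<Delta> k) * (\<Delta> k)\<^sup>2"
    by (simp add: power2_eq_square power3_eq_cube)
  also have "\<dots> \<le> ((1 - eta1 P) * ca) * (\<Delta> k)\<^sup>2"
    using s by (intro mult_right_mono) (auto simp: small_radius_def)
  also have "\<dots> \<le> (1 - eta1 P) * ?d"
    using model_decrease_radius[OF nc] params by (simp add: mult.assoc mult_left_mono)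
  finally have "eta1 P * ?d \<le> ?d - ?e" by (simp add: algebra_simps)
  with 1 have "eta1 P * ?d \<le> f (x k) - f (x k + full_step (S k))" by linarith
  then show ?thesis
    using model_decrease_pos[OF nc] by (simp add: rho_def not_less pos_le_divide_eq)
qed

lemma generated_noncritical_radius:
  assumes "n_gen (S k) = CARD('p)" "small_radius P (real CARD('p)) L \<kappa> c (\<Delta> k)" "\<not> crit k"
  shows "\<Delta> k \<le> \<Delta> (Suc k)"
proof -
  have "\<Delta> (Suc k) = next_radius P f (S k)" using step[of k] assms(3) by (simp add: qarsta_step_def)
  moreover have "\<Delta> k \<le> gam_inc P * \<Delta> k" using params radius_pos[of k] by simp
  moreover have "\<Delta> k \<le> rad_max P" using assms(2) by (simp add: small_radius_def)
  ultimately show ?thesis using generated_success[OF assms] by (simp add: next_radius_def)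
qed

text \<open>The criticality test bounds the model gradient by \<Delta> divided by
  \<open>crit_mu P\<close>, the model error adds \<Delta>, and the norm bound of the matrix
  contributes \<open>gen_bound P\<close>.\<close>

lemma critical_first_dir_le:
  assumes n: "n_gen (S k) = CARD('p)" and s: "small_radius P (real CARD('p)) L \<kappa> c (\<Delta> k)" and cr: "crit k"
  shows "\<bar>first_dir (gen_mat (S k)) \<bullet> g k\<bar> \<le> gen_bound P * (1 / crit_mu P + 1) * \<Delta> k"
proof -
  have "norm (gm k) \<le> \<Delta> k / crit_mu P"
    using cr params by (simp add: crit_iff pos_le_divide_eq mult.commute less_imp_le)
  then have "norm (transpose (fac_Q (S k)) *v g k) \<le> \<Delta> k / crit_mu P + \<Delta> k"
    using model_gradient_close[OF n s] norm_triangle_sub[of "transpose (fac_Q (S k)) *v g k" "gm k"]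
    by (simp add: norm_minus_commute del: transpose_matrix_vector)
  also have "\<dots> = (1 / crit_mu P + 1) * \<Delta> k" by (simp add: algebra_simps)
  finally have "norm (transpose (fac_Q (S k)) *v g k) \<le> (1 / crit_mu P + 1) * \<Delta> k" .
  then have "gen_bound P * norm (transpose (fac_Q (S k)) *v g k) \<le> gen_bound P * ((1 / crit_mu P + 1) * \<Delta> k)"
    using params by (intro mult_left_mono) auto
  then show ?thesis using first_dir_le[OF n] by (simp add: mult.assoc)
qed

text \<open>The gain is linear in the radius. The three conditions on \<beta> respectively absorb
  the model gradient error (2 \<beta> - \<Delta> >= \<beta>), exclude criticality, and make the
  radius the smaller term in the decrease bound.\<close>

lemma aligned_decrease:
  assumes n: "n_gen (S k) = CARD('p)" and s: "small_radius P (real CARD('p)) L \<kappa> c (\<Delta> k)"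
    and \<beta>: "\<Delta> k \<le> \<beta>" "\<Delta> k \<le> crit_mu P * \<beta>" "\<Delta> k \<le> \<beta> / \<kappa>"
    and al: "gen_bound P * (2 * \<beta>) < \<bar>first_dir (gen_mat (S k)) \<bullet> g k\<bar>"
  shows "eta1 P * c * \<beta> * \<Delta> k \<le> f (x k) - f (x (Suc k))"
proof -
  have \<beta>0: "0 < \<beta>" using radius_pos[of k] \<beta>(1) by simp
  have "gen_bound P * (2 * \<beta>) < gen_bound P * norm (transpose (fac_Q (S k)) *v g k)"
    using al first_dir_le[OF n] by simp
  then have "2 * \<beta> < norm (transpose (fac_Q (S k)) *v g k)" using params by simp
  then have gm: "\<beta> \<le> norm (gm k)"
    using model_gradient_close[OF n s] \<beta>(1) norm_triangle_sub[of "transpose (fac_Q (S k)) *v g k" "gm k"]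
    by (simp add: norm_minus_commute del: transpose_matrix_vector)
  have nc: "\<not> crit k"
  proof -
    have "crit_mu P * \<beta> \<le> crit_mu P * norm (gm k)" using gm params by (intro mult_left_mono) auto
    then show ?thesis using \<beta>(2) by (simp add: crit_iff)
  qed
  have "c * \<beta> * \<Delta> k \<le> c * norm (gm k) * min (\<Delta> k) (norm (gm k) / \<kappa>)"
  proof (rule mult_mono)
    show "c * \<beta> \<le> c * norm (gm k)" using gm c_pos by simp
    have "\<beta> / \<kappa> \<le> norm (gm k) / \<kappa>" using gm kappa by (intro divide_right_mono) auto
    then show "\<Delta> k \<le> min (\<Delta> k) (norm (gm k) / \<kappa>)" using \<beta>(3) by simp
    show "0 \<le> c * norm (gm k)" using c_pos by simp
    show "0 \<le> \<Delta> k" using radius_pos[of k] by simp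
  qed
  also have "\<dots> \<le> model f (S k) 0 - model f (S k) (tr_step (S k))" by (rule model_decrease[OF nc])
  finally have "eta1 P * (c * \<beta> * \<Delta> k) \<le> eta1 P * (model f (S k) 0 - model f (S k) (tr_step (S k)))"
    using params by (intro mult_left_mono) auto
  also have "\<dots> \<le> f (x k) - f (x (Suc k))"
    by (rule success_decrease[OF nc generated_success[OF n s nc]])
  finally show ?thesis by (simp add: mult.assoc)
qed

text \<open>Repeated critical steps only rescale the sample directions \<open>D\<close>, and the model gradients
  then force \<open>D\<^sup>T \<nabla>f(x) = 0\<close> in the limit.\<close>

lemma critical_forever_orthogonal:
  assumes cr: "\<And>k. k \<ge> j \<Longrightarrow> crit k"
  shows "transpose (dir_mat (S j)) *v g j = 0"
proof -
  let ?\<gamma> = "gam_dec P" and ?D = "dir_mat (S j)"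
  have const: "x (j + m) = x j \<and> dir_mat (S (j + m)) = ?\<gamma> ^ m *\<^sub>R ?D" for m
  proof (induction m)
    case (Suc m)
    then show ?case using step[of "j + m"] cr[of "j + m"] by (simp add: qarsta_step_def)
  qed simp
  define B where "B = (\<Sum>i\<in>UNIV. norm (column i ?D))"
  have B: "norm (column i ?D) \<le> B" for i unfolding B_def by (rule member_le_sum) auto
  have \<gamma>: "0 < ?\<gamma> ^ m" for m using params by simp
  \<comment> \<open>For scale s = \<open>?\<gamma> ^ m\<close> the critical test contributes s B
    \<Delta> divided by \<open>crit_mu P\<close>, the model error a multiple of s^3. Division by s
    leaves two null sequences.\<close>
  have bound: "\<bar>column i ?D \<bullet> g j\<bar> \<le> B * (\<Delta> (j + m) / crit_mu P) + 3 * real CARD('p) * L * B ^ 3 * (?\<gamma>\<^sup>2) ^ m" for i m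
  proof -
    let ?k = "j + m"
    let ?R = "fac_R (S ?k)"
    have col: "column i (dir_mat (S ?k)) = ?\<gamma> ^ m *\<^sub>R column i ?D" for i
      using const[of m] by (simp add: column_scaleR)
    have colB: "norm (column i (dir_mat (S ?k))) \<le> ?\<gamma> ^ m * B" for i
      unfolding col using B[of i] \<gamma>[of m] by simp
    have "norm (transpose ?R *v gm ?k - transpose (dir_mat (S ?k)) *v g ?k) \<le> 3 * real CARD('p) * L * (?\<gamma> ^ m * B) ^ 3"
      by (rule model_gradient_error[OF smooth qr colB])
    then have "\<bar>(transpose ?R *v gm ?k - transpose (dir_mat (S ?k)) *v g ?k) $ i\<bar> \<le> 3 * real CARD('p) * L * (?\<gamma> ^ m * B) ^ 3"
      using component_le_norm_cart order_trans by blast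
    then have 1: "\<bar>column i ?R \<bullet> gm ?k - ?\<gamma> ^ m * (column i ?D \<bullet> g j)\<bar> \<le> 3 * real CARD('p) * L * (?\<gamma> ^ m * B) ^ 3"
      using const[of m]
      by (simp only: vector_minus_component transpose_matrix_vector_nth column_scaleR inner_scaleR_left)
    have "\<bar>column i ?R \<bullet> gm ?k\<bar> \<le> norm (column i ?R) * norm (gm ?k)" by (rule Cauchy_Schwarz_ineq2)
    also have "\<dots> \<le> (?\<gamma> ^ m * B) * (\<Delta> ?k / crit_mu P)"
    proof (rule mult_mono)
      show "norm (column i ?R) \<le> ?\<gamma> ^ m * B" unfolding is_qr_norm_column[OF qr] by (rule colB)
      show "norm (gm ?k) \<le> \<Delta> ?k / crit_mu P"
        using cr[of ?k] params by (simp add: crit_iff pos_le_divide_eq mult.commute less_imp_le)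
      show "0 \<le> ?\<gamma> ^ m * B" using colB norm_ge_zero order_trans by blast
    qed simp
    finally have "\<bar>?\<gamma> ^ m * (column i ?D \<bullet> g j)\<bar>
        \<le> (?\<gamma> ^ m * B) * (\<Delta> ?k / crit_mu P) + 3 * real CARD('p) * L * (?\<gamma> ^ m * B) ^ 3"
      using 1 by linarith
    also have "\<dots> = ?\<gamma> ^ m * (B * (\<Delta> ?k / crit_mu P) + 3 * real CARD('p) * L * B ^ 3 * (?\<gamma>\<^sup>2) ^ m)"
      by (simp add: distrib_left power_mult_distrib power2_eq_square power3_eq_cube)
    finally show ?thesis using \<gamma>[of m] by (simp only: abs_mult abs_of_pos mult_le_cancel_left_pos)
  qed
  have "column i ?D \<bullet> g j = 0" for i
  proof -
    have "(\<lambda>m. \<Delta> (j + m)) \<longlonglongrightarrow> 0"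
      using LIMSEQ_ignore_initial_segment[OF radius_tendsto_0, of j] by (simp add: add.commute)
    moreover have "(\<lambda>m. (?\<gamma>\<^sup>2) ^ m) \<longlonglongrightarrow> 0"
    proof (rule LIMSEQ_power_zero)
      have "?\<gamma>\<^sup>2 < 1" using params by (simp add: power_less_one_iff abs_square_less_1)
      then show "norm (?\<gamma>\<^sup>2) < 1" by simp
    qed
    ultimately have "(\<lambda>m. B * (\<Delta> (j + m) / crit_mu P) + 3 * real CARD('p) * L * B ^ 3 * (?\<gamma>\<^sup>2) ^ m)
        \<longlonglongrightarrow> B * (0 / crit_mu P) + 3 * real CARD('p) * L * B ^ 3 * 0"
      by (intro tendsto_add tendsto_mult tendsto_divide tendsto_const) (use params in auto)
    then have "\<bar>column i ?D \<bullet> g j\<bar> \<le> B * (0 / crit_mu P) + 3 * real CARD('p) * L * B ^ 3 * 0"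
      by (rule LIMSEQ_le_const) (use bound in blast)
    then show ?thesis by simp
  qed
  then show ?thesis
    unfolding vec_eq_iff by (simp only: transpose_matrix_vector_nth zero_index) simp
qed

lemma not_critical_forever:
  assumes nonnull: "\<And>k. n_gen (S k) \<ge> 1 \<Longrightarrow> first_dir (gen_mat (S k)) \<bullet> g k \<noteq> 0"
  shows "\<exists>k\<ge>K. \<not> crit k"
proof (rule ccontr)
  assume "\<not> ?thesis"
  then have cr: "crit k" if "k \<ge> K" for k using that by blast
  \<comment> \<open>The last generation up to K. A noncritical iteration from j on would have to
    precede K and would cause a later generation.\<close>
  define j where "j = (GREATEST j. j \<le> K \<and> n_gen (S j) \<ge> 1)"
  have j: "j \<le> K \<and> n_gen (S j) \<ge> 1"
    unfolding j_def by (rule GreatestI_nat[of _ 0 K]) (use n_gen_0 card_ge_1 in auto)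
  have j_max: "i \<le> j" if "i \<le> K" "n_gen (S i) \<ge> 1" for i
    unfolding j_def by (rule Greatest_le_nat[of _ _ K]) (use that in auto)
  have "crit k" if "k \<ge> j" for k
  proof (rule ccontr)
    assume nc: "\<not> crit k"
    then have "Suc k \<le> K" using cr by (meson not_less_eq_eq)
    then have "Suc k \<le> j" using j_max generated_after_noncritical(1)[OF nc] by blast
    then show False using that by simp
  qed
  then have "transpose (dir_mat (S j)) *v g j = 0" by (rule critical_forever_orthogonal)
  then have "gen_mat (S j) ! 0 \<bullet> g j = 0"
    using j radius_pos by (intro forms_dirs_orthogonal_imp forms_dirs_if_generated) auto
  then have "first_dir (gen_mat (S j)) \<bullet> g j = 0"
    using generated_nonempty j by (simp add: first_dir_def)
  then show False using nonnull j by blast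
qed

text \<open>A small noncritical iteration is followed by a fresh matrix. If fresh matrices were
  never critical from then on, each would keep the radius from shrinking and produce another fresh
  one, so the radii would stay bounded away from 0.\<close>

lemma infinitely_often_critical_generated:
  assumes nonnull: "\<And>k. n_gen (S k) \<ge> 1 \<Longrightarrow> first_dir (gen_mat (S k)) \<bullet> g k \<noteq> 0"
    and d0: "0 < d0" and small: "\<And>d. 0 < d \<Longrightarrow> d \<le> d0 \<Longrightarrow> small_radius P (real CARD('p)) L \<kappa> c d"
  shows "\<exists>k\<ge>K. n_gen (S k) = CARD('p) \<and> \<Delta> k \<le> d0 \<and> crit k"
proof (rule ccontr)
  assume "\<not> ?thesis"
  then have no: "\<not> crit k" if "k \<ge> K" "n_gen (S k) = CARD('p)" "\<Delta> k \<le> d0" for k using that by blast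
  have "eventually (\<lambda>k. \<Delta> k < d0) sequentially"
    using radius_tendsto_0 d0 by (rule order_tendstoD(2))
  then obtain K1 where K1: "\<Delta> k \<le> d0" if "k \<ge> K1" for k
    unfolding eventually_sequentially by (meson less_imp_le)
  have sm: "small_radius P (real CARD('p)) L \<kappa> c (\<Delta> k)" if "k \<ge> K1" for k using K1[OF that] small radius_pos by blast
  obtain k0 where k0: "k0 \<ge> max K K1" "\<not> crit k0" using not_critical_forever[OF nonnull] by blast
  have gen: "n_gen (S (Suc k0 + i)) = CARD('p) \<and> \<Delta> (Suc k0) \<le> \<Delta> (Suc k0 + i)" for i
  proof (induction i)
    case 0
    then show ?case using generated_after_noncritical(2)[OF k0(2) sm] k0(1) by simp
  next
    case (Suc i)
    let ?k = "Suc k0 + i"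
    have nc: "\<not> crit ?k" using no[of ?k] Suc K1[of ?k] k0(1) by simp
    have "small_radius P (real CARD('p)) L \<kappa> c (\<Delta> ?k)" "small_radius P (real CARD('p)) L \<kappa> c (\<Delta> (Suc ?k))" using k0(1) by (auto intro!: sm)
    then have "n_gen (S (Suc ?k)) = CARD('p)" "\<Delta> ?k \<le> \<Delta> (Suc ?k)"
      using generated_after_noncritical(2)[OF nc] generated_noncritical_radius[OF _ _ nc] Suc by blast+
    then show ?case using Suc by simp
  qed
  have "(\<lambda>i. \<Delta> (Suc k0 + i)) \<longlonglongrightarrow> 0"
    using LIMSEQ_ignore_initial_segment[OF radius_tendsto_0, of "Suc k0"] by (simp add: add.commute)
  then have "\<Delta> (Suc k0) \<le> 0" by (rule LIMSEQ_le_const) (use gen in blast)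
  then show False using radius_pos[of "Suc k0"] by simp
qed

end

section \<open>Almost sure convergence\<close>

context qarsta_process
begin

lemma sets_F_imp: "A \<in> sets (F k) \<Longrightarrow> A \<in> sets M"
  using F_sub by blast

lemma gradient_measurable:
  assumes "C2_plus f L"
  shows "(\<lambda>\<omega>. gradient f (iterate (S k \<omega>))) \<in> borel_measurable (F k)"
proof -
  have "continuous_on UNIV (gradient f)"
    using assms by (auto simp: C2_plus_def intro!: continuous_at_imp_continuous_on differentiable_imp_continuous_within)
  then have "gradient f \<in> borel_measurable borel" by (rule borel_measurable_continuous_onI)
  then show ?thesis using iterate_meas by (rule measurable_compose[rotated])
qed

lemma value_measurable:
  assumes "C2_plus f L"
  shows "(\<lambda>\<omega>. f (iterate (S k \<omega>))) \<in> borel_measurable M"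
proof -
  have "continuous_on UNIV f"
    using assms by (auto simp: C2_plus_def intro!: continuous_at_imp_continuous_on differentiable_imp_continuous_within)
  then have "f \<in> borel_measurable borel" by (rule borel_measurable_continuous_onI)
  then show ?thesis using F_measurable_imp[OF iterate_meas] by (rule measurable_compose[rotated])
qed

lemma first_dir_event:
  assumes E: "E \<in> sets (F k)" and g: "g \<in> borel_measurable (F k)" and \<tau>: "\<tau> \<in> borel_measurable (F k)"
  shows "{\<omega> \<in> E. \<bar>first_dir (gen_mat (S k \<omega>)) \<bullet> g \<omega>\<bar> \<le> \<tau> \<omega> * norm (g \<omega>)} \<in> sets M"
proof -
  note [measurable] = F_measurable_imp[OF g] F_measurable_imp[OF \<tau>] sets_F_imp[OF E]
    measurable_compose[OF gen_mat_measurable measurable_first_dir]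
  have "{\<omega> \<in> space M. \<omega> \<in> E \<and> \<bar>first_dir (gen_mat (S k \<omega>)) \<bullet> g \<omega>\<bar> \<le> \<tau> \<omega> * norm (g \<omega>)} \<in> sets M"
    by measurable
  also have "{\<omega> \<in> space M. \<omega> \<in> E \<and> \<bar>first_dir (gen_mat (S k \<omega>)) \<bullet> g \<omega>\<bar> \<le> \<tau> \<omega> * norm (g \<omega>)}
      = {\<omega> \<in> E. \<bar>first_dir (gen_mat (S k \<omega>)) \<bullet> g \<omega>\<bar> \<le> \<tau> \<omega> * norm (g \<omega>)}"
    using sets.sets_into_space[OF sets_F_imp[OF E]] by auto
  finally show ?thesis .
qed

text \<open>The small-ball estimate with threshold 0, for countably many k and column
  numbers.\<close>

lemma AE_first_dir_not_orthogonal: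
  assumes C2: "C2_plus f L"
  shows "AE \<omega> in M. \<forall>k. n_gen (S k \<omega>) \<ge> 1 \<longrightarrow> gradient f (iterate (S k \<omega>)) \<noteq> 0 \<longrightarrow>
    first_dir (gen_mat (S k \<omega>)) \<bullet> gradient f (iterate (S k \<omega>)) \<noteq> 0"
proof -
  let ?g = "\<lambda>k \<omega>. gradient f (iterate (S k \<omega>))"
  have *: "AE \<omega> in M. q \<ge> 1 \<longrightarrow> n_gen (S k \<omega>) = q \<longrightarrow> ?g k \<omega> \<noteq> 0 \<longrightarrow> first_dir (gen_mat (S k \<omega>)) \<bullet> ?g k \<omega> \<noteq> 0" for k q
  proof (cases "q \<ge> 1")
    case True
    obtain K where "0 \<le> K" and K: "\<And>k E w \<tau> g. E \<in> sets (F k) \<Longrightarrow> E \<subseteq> {\<omega>. n_gen (S k \<omega>) = q} \<Longrightarrow>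
      w \<in> borel_measurable (F k) \<Longrightarrow> \<tau> \<in> borel_measurable (F k) \<Longrightarrow> g \<in> borel_measurable (F k) \<Longrightarrow>
      (\<And>\<omega>. 0 \<le> \<tau> \<omega>) \<Longrightarrow> (\<And>\<omega>. 0 \<le> w \<omega>) \<Longrightarrow> (\<And>\<omega>. \<omega> \<in> E \<Longrightarrow> g \<omega> \<noteq> 0) \<Longrightarrow>
      (\<integral>\<^sup>+\<omega>. ennreal (w \<omega>) * indicator {\<omega> \<in> E. \<bar>first_dir (gen_mat (S k \<omega>)) \<bullet> g \<omega>\<bar> \<le> \<tau> \<omega> * norm (g \<omega>)} \<omega> \<partial>M)
      \<le> (\<integral>\<^sup>+\<omega>. ennreal (w \<omega> * (K * \<tau> \<omega>)) * indicator E \<omega> \<partial>M)"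
      using first_dir_small_ball[OF True] by blast
    note g = gradient_measurable[OF C2, of k]
    define E where "E = {\<omega> \<in> space M. n_gen (S k \<omega>) = q} \<inter> {\<omega> \<in> space (F k). ?g k \<omega> \<noteq> 0}"
    have "{\<omega> \<in> space (F k). ?g k \<omega> \<noteq> 0} \<in> sets (F k)"
      using measurable_sets[OF g, of "- {0}"] by (simp add: vimage_def Int_def conj_commute)
    then have E: "E \<in> sets (F k)" unfolding E_def by (rule sets.Int[OF n_gen_event])
    let ?Z = "{\<omega> \<in> E. \<bar>first_dir (gen_mat (S k \<omega>)) \<bullet> ?g k \<omega>\<bar> \<le> 0 * norm (?g k \<omega>)}"
    have Z: "?Z \<in> sets M" by (rule first_dir_event[OF E g]) simp
    have "(\<integral>\<^sup>+\<omega>. ennreal 1 * indicator ?Z \<omega> \<partial>M) \<le> (\<integral>\<^sup>+\<omega>. ennreal (1 * (K * 0)) * indicator E \<omega> \<partial>M)"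
      by (rule K[OF E _ _ _ g]) (auto simp: E_def)
    then have "emeasure M ?Z = 0" using Z by simp
    then have "?Z \<in> null_sets M" using Z by auto
    then have "AE \<omega> in M. \<omega> \<notin> ?Z" by (rule AE_not_in)
    then show ?thesis by (rule AE_mp) (rule AE_I2, auto simp: E_def space_F)
  qed simp
  then have "AE \<omega> in M. \<forall>k q. q \<ge> 1 \<longrightarrow> n_gen (S k \<omega>) = q \<longrightarrow> ?g k \<omega> \<noteq> 0 \<longrightarrow>
      first_dir (gen_mat (S k \<omega>)) \<bullet> ?g k \<omega> \<noteq> 0"
    by (intro AE_all_countable[THEN iffD2] allI)
  then show ?thesis by eventually_elim simp
qed

text \<open>The assumption of a large gradient enters through \<open>E k\<close>, which concerns
  iteration k only and is determined by the past, so nothing is conditioned on the future. The chain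
  is P(bad k) <= K C I k, I k <= 2 T k, and the sum of T k is bounded.\<close>

lemma AE_gradient_small:
  fixes \<epsilon> :: real
  assumes inputs: "valid_inputs CARD('n) CARD('p) P" and C2: "C2_plus f L" and low: "\<And>x. f_low \<le> f x"
    and \<kappa>: "1 \<le> \<kappa>" and c: "0 < c"
    and path: "AE \<omega> in M. qarsta_path P f L f_low \<kappa> c (\<lambda>k. S k \<omega>)" and \<epsilon>: "0 < \<epsilon>"
  shows "AE \<omega> in M. \<exists>k. norm (gradient f (iterate (S k \<omega>))) < \<epsilon>"
proof -
  let ?q = "CARD('p)" and ?MA = "gen_bound P"
  define g where "g k \<omega> = gradient f (iterate (S k \<omega>))" for k \<omega>
  \<comment> \<open>The small-ball estimate wants weights that are nonnegative everywhere, whereas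
    radii are positive only almost surely.\<close>
  define r where "r k \<omega> = max 0 (radius (S k \<omega>))" for k \<omega>
  define v where "v k \<omega> = f (iterate (S k \<omega>))" for k \<omega>
  have q: "1 \<le> ?q" using zero_less_card_finite[where 'a='p] by linarith
  have g: "g k \<in> borel_measurable (F k)" for k
    unfolding g_def[abs_def] by (rule gradient_measurable[OF C2])
  have r: "r k \<in> borel_measurable (F k)" for k
    unfolding r_def[abs_def] using radius_meas[of k] by measurable
  have params: "0 < crit_mu P" "0 < eta1 P" "1 \<le> ?MA" using inputs by (auto simp: valid_inputs_def)
  obtain K where K0: "0 \<le> K" and K: "\<And>k E w \<tau> g. E \<in> sets (F k) \<Longrightarrow> E \<subseteq> {\<omega>. n_gen (S k \<omega>) = ?q} \<Longrightarrow>
      w \<in> borel_measurable (F k) \<Longrightarrow> \<tau> \<in> borel_measurable (F k) \<Longrightarrow> g \<in> borel_measurable (F k) \<Longrightarrow>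
      (\<And>\<omega>. 0 \<le> \<tau> \<omega>) \<Longrightarrow> (\<And>\<omega>. 0 \<le> w \<omega>) \<Longrightarrow> (\<And>\<omega>. \<omega> \<in> E \<Longrightarrow> g \<omega> \<noteq> 0) \<Longrightarrow>
      (\<integral>\<^sup>+\<omega>. ennreal (w \<omega>) * indicator {\<omega> \<in> E. \<bar>first_dir (gen_mat (S k \<omega>)) \<bullet> g \<omega>\<bar> \<le> \<tau> \<omega> * norm (g \<omega>)} \<omega> \<partial>M)
      \<le> (\<integral>\<^sup>+\<omega>. ennreal (w \<omega> * (K * \<tau> \<omega>)) * indicator E \<omega> \<partial>M)"
    using first_dir_small_ball[OF q] by blast
  \<comment> \<open>Chosen so that K t <= 1/2: the unfavourable event \<open>H k\<close> carries at
    most half of \<open>I k\<close>.\<close>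
  define t where "t = 1 / (2 * (K + 1))"
  have t: "0 < t" "K * t \<le> 1 / 2" using K0 by (auto simp: t_def field_simps)
  \<comment> \<open>Outside \<open>H k\<close>, the first column has inner product above t
    \<epsilon> with the gradient, which is exactly the threshold in
    \<open>aligned_decrease\<close>.\<close>
  define \<beta> where "\<beta> = t * \<epsilon> / (2 * ?MA)"
  have \<beta>: "0 < \<beta>" "?MA * (2 * \<beta>) = t * \<epsilon>" using t \<epsilon> params by (auto simp: \<beta>_def)
  have "eventually (\<lambda>d. small_radius P (real ?q) L \<kappa> c d \<and> 1 * d < \<beta> \<and> 1 * d < crit_mu P * \<beta> \<and> 1 * d < \<beta> / \<kappa>) (at_right 0)"
    using \<beta> params \<kappa> by (intro eventually_conj eventually_mult_less small_radius_exists[OF inputs \<kappa> c]) auto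
  then obtain b where b: "b > 0" "\<And>d. 0 < d \<Longrightarrow> d < b \<Longrightarrow> small_radius P (real ?q) L \<kappa> c d \<and> d < \<beta> \<and> d < crit_mu P * \<beta> \<and> d < \<beta> / \<kappa>"
    unfolding eventually_at_right_field by auto
  define D where "D = b / 2"
  have D: "0 < D" "\<And>d. 0 < d \<Longrightarrow> d \<le> D \<Longrightarrow> small_radius P (real ?q) L \<kappa> c d \<and> d < \<beta> \<and> d < crit_mu P * \<beta> \<and> d < \<beta> / \<kappa>"
    using b by (auto simp: D_def)
  define E where "E k = {\<omega> \<in> space M. n_gen (S k \<omega>) = ?q} \<inter> {\<omega> \<in> space (F k). r k \<omega> \<le> D \<and> \<epsilon> \<le> norm (g k \<omega>)}" for k
  have EF: "E k \<in> sets (F k)" for k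
  proof -
    note [measurable] = r[of k] g[of k]
    have "{\<omega> \<in> space (F k). r k \<omega> \<le> D \<and> \<epsilon> \<le> norm (g k \<omega>)} \<in> sets (F k)" by measurable
    then show ?thesis unfolding E_def by (rule sets.Int[OF n_gen_event])
  qed
  have vM [measurable]: "v k \<in> borel_measurable M" for k
    unfolding v_def[abs_def] by (rule value_measurable[OF C2])
  have rM [measurable]: "r k \<in> borel_measurable M" for k using r by (rule F_measurable_imp)
  have EM [measurable]: "E k \<in> sets M" for k using EF by (rule sets_F_imp)
  have Eq: "E k \<subseteq> {\<omega>. n_gen (S k \<omega>) = ?q}" for k by (auto simp: E_def)
  have Eg: "\<omega> \<in> E k \<Longrightarrow> g k \<omega> \<noteq> 0" for k \<omega> using \<epsilon> by (auto simp: E_def)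
  define H where "H k = {\<omega> \<in> E k. \<bar>first_dir (gen_mat (S k \<omega>)) \<bullet> g k \<omega>\<bar> \<le> t * norm (g k \<omega>)}" for k
  have HM [measurable]: "H k \<in> sets M" for k unfolding H_def by (rule first_dir_event[OF EF g]) simp
  \<comment> \<open>The constant of \<open>critical_first_dir_le\<close> divided by \<epsilon>, so
    that a fresh critical iteration in \<open>E k\<close> lies in \<open>bad k\<close>.\<close>
  define C where "C = ?MA * (1 / crit_mu P + 1) / \<epsilon>"
  have C: "0 \<le> C" using params \<epsilon> by (simp add: C_def)
  define bad where "bad k = {\<omega> \<in> E k. \<bar>first_dir (gen_mat (S k \<omega>)) \<bullet> g k \<omega>\<bar> \<le> (C * r k \<omega>) * norm (g k \<omega>)}" for k
  have badM: "bad k \<in> sets M" for k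
    unfolding bad_def by (rule first_dir_event[OF EF g borel_measurable_times[OF borel_measurable_const r]])
  define e where "e = eta1 P * c * \<beta>"
  have e: "0 < e" using params c \<beta> by (simp add: e_def)
  define I where "I k = (\<integral>\<^sup>+\<omega>. ennreal (r k \<omega>) * indicator (E k) \<omega> \<partial>M)" for k
  define T where "T k = (\<integral>\<^sup>+\<omega>. ennreal ((v k \<omega> - v (Suc k) \<omega>) / e) \<partial>M)" for k
  have I_le: "I k \<le> 2 * T k" for k
  proof -
    have "I k \<le> (\<integral>\<^sup>+\<omega>. ennreal D \<partial>M)"
      unfolding I_def
    proof (rule nn_integral_mono)
      fix \<omega> show "ennreal (r k \<omega>) * indicator (E k) \<omega> \<le> ennreal D"
        by (auto simp: E_def indicator_def intro: ennreal_leI)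
    qed
    also have "\<dots> = ennreal D" by (simp add: emeasure_space_1)
    \<comment> \<open>Finiteness, due to the radius being at most D on \<open>E k\<close>, permits
      the absorption of half of \<open>I k\<close> below.\<close>
    finally have fin: "I k < top" by (rule le_less_trans) simp
    have "(\<integral>\<^sup>+\<omega>. ennreal (r k \<omega>) * indicator (H k) \<omega> \<partial>M)
        \<le> (\<integral>\<^sup>+\<omega>. ennreal (r k \<omega> * (K * t)) * indicator (E k) \<omega> \<partial>M)"
      unfolding H_def by (rule K[OF EF Eq r _ g _ _ Eg]) (use t in \<open>auto simp: r_def\<close>)
    also have "\<dots> \<le> (\<integral>\<^sup>+\<omega>. ennreal (1/2) * (ennreal (r k \<omega>) * indicator (E k) \<omega>) \<partial>M)"
    proof (rule nn_integral_mono)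
      fix \<omega>
      have "r k \<omega> * (K * t) \<le> r k \<omega> * (1/2)" using t by (intro mult_left_mono) (auto simp: r_def)
      then have "ennreal (r k \<omega> * (K * t)) \<le> ennreal (1/2 * r k \<omega>)" by (intro ennreal_leI) simp
      also have "\<dots> = ennreal (1/2) * ennreal (r k \<omega>)" by (rule ennreal_mult) (auto simp: r_def)
      finally show "ennreal (r k \<omega> * (K * t)) * indicator (E k) \<omega> \<le> ennreal (1/2) * (ennreal (r k \<omega>) * indicator (E k) \<omega>)"
        by (auto simp: indicator_def)
    qed
    also have "\<dots> = ennreal (1/2) * I k" unfolding I_def by (rule nn_integral_cmult) measurable
    finally have half: "(\<integral>\<^sup>+\<omega>. ennreal (r k \<omega>) * indicator (H k) \<omega> \<partial>M) \<le> ennreal (1/2) * I k" .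
    have "I k \<le> (\<integral>\<^sup>+\<omega>. ennreal (r k \<omega>) * indicator (H k) \<omega> + ennreal ((v k \<omega> - v (Suc k) \<omega>) / e) \<partial>M)"
      unfolding I_def
    proof (rule nn_integral_mono_AE)
      show "AE \<omega> in M. ennreal (r k \<omega>) * indicator (E k) \<omega>
        \<le> ennreal (r k \<omega>) * indicator (H k) \<omega> + ennreal ((v k \<omega> - v (Suc k) \<omega>) / e)"
        using path
      proof eventually_elim
        case (elim \<omega>)
        interpret qarsta_path P f L f_low \<kappa> c "\<lambda>k. S k \<omega>" by (rule elim)
        show ?case
        proof (cases "\<omega> \<in> E k \<and> \<omega> \<notin> H k")
          case True
          then have *: "n_gen (S k \<omega>) = ?q" "radius (S k \<omega>) \<le> D" "\<epsilon> \<le> norm (g k \<omega>)"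
            "t * norm (g k \<omega>) < \<bar>first_dir (gen_mat (S k \<omega>)) \<bullet> g k \<omega>\<bar>"
            by (auto simp: E_def H_def r_def)
          note dD = D(2)[OF radius_pos *(2)]
          have "?MA * (2 * \<beta>) \<le> t * norm (g k \<omega>)" using *(3) t by (simp add: \<beta>)
          then have "eta1 P * c * \<beta> * radius (S k \<omega>) \<le> v k \<omega> - v (Suc k) \<omega>"
            unfolding v_def using *(4) dD
            by (intro aligned_decrease[OF *(1)]) (auto simp: g_def)
          then have "r k \<omega> \<le> (v k \<omega> - v (Suc k) \<omega>) / e"
            using e radius_pos[of k] by (simp add: r_def pos_le_divide_eq e_def mult.commute)
          then have "ennreal (r k \<omega>) \<le> ennreal ((v k \<omega> - v (Suc k) \<omega>) / e)" by (rule ennreal_leI)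
          then show ?thesis using True by simp
        qed (auto simp: indicator_def)
      qed
    qed
    also have "\<dots> = (\<integral>\<^sup>+\<omega>. ennreal (r k \<omega>) * indicator (H k) \<omega> \<partial>M) + T k"
      unfolding T_def by (rule nn_integral_add) measurable
    also have "\<dots> \<le> ennreal (1/2) * I k + T k" by (rule add_right_mono[OF half])
    finally have le: "I k \<le> ennreal (1/2) * I k + T k" .
    obtain i where i: "I k = ennreal i" "0 \<le> i" using fin by (cases "I k") auto
    show ?thesis
    proof (cases "T k")
      case (real s)
      have "ennreal (1/2) * ennreal i = ennreal (1/2 * i)"
        using i(2) by (intro ennreal_mult[symmetric]) auto
      moreover have "ennreal (1/2 * i) + ennreal s = ennreal (1/2 * i + s)"
        using i(2) real(1) by (intro ennreal_plus[symmetric]) auto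
      ultimately have "ennreal i \<le> ennreal (1/2 * i + s)"
        using le unfolding i(1) real(2) by (simp only:)
      then have "i \<le> 1/2 * i + s"
        by (rule ennreal_le_iff[THEN iffD1, rotated]) (use i real in simp)
      then have "i \<le> 2 * s" by simp
      then have "ennreal i \<le> ennreal (2 * s)" by (rule ennreal_leI)
      also have "\<dots> = 2 * ennreal s" using real by (subst ennreal_mult) auto
      finally show ?thesis by (simp add: i real)
    qed (simp add: ennreal_mult_top)
  qed
  define B where "B = (f (x_init P) - f_low) / e"
  have B: "0 \<le> B" using low[of "x_init P"] e by (simp add: B_def)
  have T_sum: "(\<Sum>k<n. T k) \<le> ennreal B" for n
  proof -
    have "(\<Sum>k<n. T k) = (\<integral>\<^sup>+\<omega>. (\<Sum>k<n. ennreal ((v k \<omega> - v (Suc k) \<omega>) / e)) \<partial>M)"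
      unfolding T_def by (rule nn_integral_sum[symmetric]) measurable
    also have "\<dots> \<le> (\<integral>\<^sup>+\<omega>. ennreal B \<partial>M)"
    proof (rule nn_integral_mono_AE)
      show "AE \<omega> in M. (\<Sum>k<n. ennreal ((v k \<omega> - v (Suc k) \<omega>) / e)) \<le> ennreal B"
        using path
      proof eventually_elim
        case (elim \<omega>)
        interpret qarsta_path P f L f_low \<kappa> c "\<lambda>k. S k \<omega>" by (rule elim)
        \<comment> \<open>Truncation of negative reals by \<open>ennreal\<close> is harmless, since
          f decreases along the path; the sum telescopes.\<close>
        have "(\<Sum>k<n. ennreal ((v k \<omega> - v (Suc k) \<omega>) / e)) = ennreal (\<Sum>k<n. (v k \<omega> - v (Suc k) \<omega>) / e)"
          using value_decreasing e by (intro sum_ennreal) (simp add: v_def)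
        also have "(\<Sum>k<n. (v k \<omega> - v (Suc k) \<omega>) / e) = (v 0 \<omega> - v n \<omega>) / e"
          using sum_lessThan_telescope'[of "\<lambda>k. v k \<omega>" n]
          by (simp add: sum_divide_distrib[symmetric])
        also have "\<dots> \<le> B"
        proof -
          have "iterate (S 0 \<omega>) = x_init P" using run by (simp add: qarsta_run_def qarsta_init_def)
          then show ?thesis unfolding B_def v_def using low[of "iterate (S n \<omega>)"] e
            by (intro divide_right_mono) auto
        qed
        finally show ?case by (simp add: ennreal_leI)
      qed
    qed
    also have "\<dots> = ennreal B" by (simp add: emeasure_space_1)
    finally show ?thesis .
  qed
  have bad_le: "emeasure M (bad k) \<le> ennreal (K * C) * I k" for k
  proof -
    have "emeasure M (bad k) = (\<integral>\<^sup>+\<omega>. ennreal 1 * indicator (bad k) \<omega> \<partial>M)" using badM by simp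
    also have "\<dots> \<le> (\<integral>\<^sup>+\<omega>. ennreal (1 * (K * (C * r k \<omega>))) * indicator (E k) \<omega> \<partial>M)"
      unfolding bad_def
      by (rule K[OF EF Eq borel_measurable_const borel_measurable_times[OF borel_measurable_const r] g _ _ Eg])
        (use C in \<open>auto simp: r_def\<close>)
    also have "\<dots> = (\<integral>\<^sup>+\<omega>. ennreal (K * C) * (ennreal (r k \<omega>) * indicator (E k) \<omega>) \<partial>M)"
    proof (rule nn_integral_cong)
      fix \<omega>
      have "ennreal (K * C * r k \<omega>) = ennreal (K * C) * ennreal (r k \<omega>)"
        using K0 C by (intro ennreal_mult) (auto simp: r_def)
      then show "ennreal (1 * (K * (C * r k \<omega>))) * indicator (E k) \<omega> = ennreal (K * C) * (ennreal (r k \<omega>) * indicator (E k) \<omega>)"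
        by (simp add: mult.assoc)
    qed
    also have "\<dots> = ennreal (K * C) * I k" unfolding I_def by (rule nn_integral_cmult) measurable
    finally show ?thesis .
  qed
  have "summable (\<lambda>k. measure M (bad k))"
  proof (rule summableI_nonneg_bounded)
    fix n
    have "ennreal (\<Sum>k<n. measure M (bad k)) = (\<Sum>k<n. emeasure M (bad k))"
      unfolding emeasure_eq_measure by (rule sum_ennreal[symmetric]) simp
    also have "\<dots> \<le> (\<Sum>k<n. ennreal (K * C) * (2 * T k))"
      by (intro sum_mono order_trans[OF bad_le] mult_left_mono I_le) simp
    also have "\<dots> = ennreal (K * C) * (2 * (\<Sum>k<n. T k))" by (simp add: sum_distrib_left)
    also have "\<dots> \<le> ennreal (K * C) * (2 * ennreal B)" by (intro mult_left_mono T_sum) auto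
    also have "\<dots> = ennreal (K * C * (2 * B))" using K0 C B by (simp add: ennreal_mult)
    finally show "(\<Sum>k<n. measure M (bad k)) \<le> K * C * (2 * B)"
      using K0 C B by (subst (asm) ennreal_le_iff) auto
  qed simp
  then have "AE \<omega> in M. eventually (\<lambda>k. \<omega> \<in> space M - bad k) sequentially"
    by (intro borel_cantelli_AE1 badM) (simp_all add: emeasure_eq_measure)
  then show ?thesis
    using path AE_first_dir_not_orthogonal[OF C2]
  proof eventually_elim
    case (elim \<omega>)
    interpret qarsta_path P f L f_low \<kappa> c "\<lambda>k. S k \<omega>" by (rule elim(2))
    show ?case
    proof (rule ccontr)
      assume "\<not> ?thesis"
      then have large: "\<epsilon> \<le> norm (g k \<omega>)" for k by (auto simp: g_def not_less)
      obtain k0 where k0: "\<omega> \<in> space M - bad k" if "k \<ge> k0" for k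
        using elim(1) unfolding eventually_sequentially by blast
      have "first_dir (gen_mat (S k \<omega>)) \<bullet> gradient f (iterate (S k \<omega>)) \<noteq> 0" if "n_gen (S k \<omega>) \<ge> 1" for k
        using elim(3) that large[of k] \<epsilon> by (auto simp: g_def)
      then obtain k where k: "k \<ge> k0" "n_gen (S k \<omega>) = ?q" "radius (S k \<omega>) \<le> D" "critical P f (S k \<omega>)"
        using infinitely_often_critical_generated[of D k0] D by blast
      have "\<bar>first_dir (gen_mat (S k \<omega>)) \<bullet> g k \<omega>\<bar> \<le> ?MA * (1 / crit_mu P + 1) * radius (S k \<omega>)"
        unfolding g_def using D(2)[OF radius_pos k(3)] by (intro critical_first_dir_le k) auto
      also have "\<dots> = (C * r k \<omega>) * \<epsilon>"
        using \<epsilon> radius_pos[of k] by (simp add: C_def r_def)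
      also have "\<dots> \<le> (C * r k \<omega>) * norm (g k \<omega>)"
        using C large by (intro mult_left_mono) (auto simp: r_def)
      finally have "\<omega> \<in> bad k"
        using k k0[OF k(1)] large[of k] D(1) by (auto simp: bad_def E_def r_def space_F)
      then show False using k0[OF k(1)] by blast
    qed
  qed
qed

end

theorem theorem10:
  fixes f :: "real^'n \<Rightarrow> real"
    and P :: "'n qarsta_inputs"
    and M :: "'w measure"
    and F :: "nat \<Rightarrow> 'w measure"
    and S :: "nat \<Rightarrow> 'w \<Rightarrow> ('n, 'p::{finite,linorder}) qarsta_state"
    and L_hess f_low \<kappa>\<^sub>H c\<^sub>1 \<alpha>\<^sub>D \<delta>\<^sub>S C\<^sub>1 :: real
  assumes inputs: "valid_inputs CARD('n) CARD('p) P"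
    and process: "qarsta_process M F P f S"
    and smooth: "C2_plus f L_hess"
    and bounded_below: "\<forall>x. f_low \<le> f x"
    and kappa_H: "1 \<le> \<kappa>\<^sub>H"
    and model_hessian_bound: "AE \<omega> in M. \<forall>k. mnorm (model_hessian f (S k \<omega>)) \<le> \<kappa>\<^sub>H"
    and c1: "0 < c\<^sub>1" "c\<^sub>1 \<le> 1/2"
    and sufficient_decrease: "AE \<omega> in M. \<forall>k. \<not> critical P f (S k \<omega>) \<longrightarrow>
          model f (S k \<omega>) 0 - model f (S k \<omega>) (tr_step (S k \<omega>))
          \<ge> c\<^sub>1 * norm (gradient (model f (S k \<omega>)) 0) *
              min (radius (S k \<omega>))
                  (norm (gradient (model f (S k \<omega>)) 0) / max (mnorm (model_hessian f (S k \<omega>))) 1)"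
    and alpha_D: "0 < \<alpha>\<^sub>D" "\<alpha>\<^sub>D < 1"
    and aligned: "\<forall>k. measure M {\<omega> \<in> space M. well_aligned \<alpha>\<^sub>D (dir_mat (S k \<omega>)) f (iterate (S k \<omega>))}
                      \<ge> 1 - \<delta>\<^sub>S"
    and C1_def: "C\<^sub>1 = inverse (ln (1 / gam_dec P)) * ln (gam_inc P)"
    and delta_S: "0 < \<delta>\<^sub>S" "\<delta>\<^sub>S < 1 / (C\<^sub>1 + 1)"
    and rad_min_zero: "rad_min P = 0"
  shows "measure M {\<omega> \<in> space M. (INF k. norm (gradient f (iterate (S k \<omega>)))) = 0} = 1"
proof -
  interpret qarsta_process M F P f S by (rule process)
  let ?g = "\<lambda>k \<omega>. norm (gradient f (iterate (S k \<omega>)))"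
  have path: "AE \<omega> in M. qarsta_path P f L_hess f_low \<kappa>\<^sub>H c\<^sub>1 (\<lambda>k. S k \<omega>)"
    using run model_hessian_bound sufficient_decrease AE_mnorm_gen_mat
  proof eventually_elim
    case (elim \<omega>)
    show ?case
      by unfold_locales (use elim inputs smooth bounded_below kappa_H c1 rad_min_zero in auto)
  qed
  \<comment> \<open>A sequence of tolerances tending to 0 keeps the number of exceptional null sets
    countable.\<close>
  have "AE \<omega> in M. \<forall>m. \<exists>k. ?g k \<omega> < 1 / real (Suc m)"
  proof (rule AE_all_countable[THEN iffD2, rule_format])
    fix m
    show "AE \<omega> in M. \<exists>k. ?g k \<omega> < 1 / real (Suc m)"
      by (rule AE_gradient_small[OF inputs smooth _ kappa_H c1(1) path]) (use bounded_below in auto)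
  qed
  then have AE: "AE \<omega> in M. (INF k. ?g k \<omega>) = 0"
  proof eventually_elim
    case (elim \<omega>)
    have bdd: "bdd_below (range (\<lambda>k. ?g k \<omega>))" by (rule bdd_belowI[of _ 0]) auto
    have "(INF k. ?g k \<omega>) \<le> 1 / real (Suc m)" for m
    proof -
      obtain k where "?g k \<omega> < 1 / real (Suc m)" using elim by blast
      then show ?thesis using cINF_lower[OF bdd UNIV_I, of k] by linarith
    qed
    then have "(INF k. ?g k \<omega>) \<le> 0"
      by (intro LIMSEQ_le_const[OF LIMSEQ_inverse_real_of_nat]) (auto simp: inverse_eq_divide)
    moreover have "0 \<le> (INF k. ?g k \<omega>)" by (rule cINF_greatest) auto
    ultimately show ?case by simp
  qed
  have g: "?g k \<in> borel_measurable M" for k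
    using F_measurable_imp[OF gradient_measurable[OF smooth]] by measurable
  have "(\<lambda>\<omega>. INF k. ?g k \<omega>) \<in> borel_measurable M"
    by (rule borel_measurable_cINF) (auto intro: g bdd_belowI[of _ 0])
  \<comment> \<open>Measurability is essential: \<open>measure\<close> would assign 0 to a
    nonmeasurable event.\<close>
  then have "{\<omega> \<in> space M. (INF k. ?g k \<omega>) = 0} \<in> sets M" by measurable
  from prob_Collect_eq_1[OF this] AE show ?thesis by blast
qed

end
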